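(* Let $p$ be a prime, let $n\geq 2$, and let $X_1,\ldots,X_n$ be pairwise disjoint subsets of $\mathbb{F}_p$ such that $\min_{1\leq i\leq n}|X_i|\geq 3$ and $\sum_{i=1}^n|X_i|\leq p-5$. If $a_1,\ldots,a_n\in\mathbb{F}_p^*$ are not all equal, then one of the following statements holds true: (i) $n=2$, $a_1=-a_2$ and $\{X_1,X_2\}=\{r[x,y],\,r([y+c,x-c]\setminus\{z\})\}$ for some $x,y,c,r,z\in\mathbb{F}_p$. (ii) $\left|\bigcup_{\sigma\in\mathbb{S}_n}\sum_{i=1}^n a_{\sigma(i)}X_i\right|>\sum_{i=1}^n|X_i|$.
   Context: $p$ is a prime, $\mathbb{F}_p=\mathbb{Z}/p\mathbb{Z}$ is the field with $p$ elements, and $\mathbb{F}_p^*=\mathbb{F}_p\setminus\{0\}$. $\mathbb{S}_n$ is the set of permutations of $\{1,\ldots,n\}$. For $x,y\in\mathbb{F}_p$, $[x,y]:=\{x,x+\overline{1},\ldots,x+\overline{i}\}$ where $i\in\{0,1,\ldots,p-1\}$ is the integer whose class $\overline{i}$ in $\mathbb{F}_p$ equals $y-x$. For $r\in\mathbb{F}_p$ and $X\subseteq\mathbb{F}_p$, $rX:=\{rx: x\in X\}$. Sums of sets are sumsets: $X+Y=\{x+y: x\in X, y\in Y\}$, and similarly for $\sum_i X_i$. *)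

theory Defs
  imports
    "Berlekamp_Zassenhaus.Finite_Field"
    "HOL-Library.Set_Algebras"
    "HOL-Combinatorics.Permutations"
begin

text \<open>
  The field with \<open>p\<close> elements is \<open>'p mod_ring\<close> for a type \<open>'p\<close> of class \<open>prime_card\<close>, with
  \<open>p = CARD('p)\<close>. Sumsets (\<open>+\<close>, \<open>\<Sum>\<close>) and dilates (\<open>r *o X\<close>) of sets are those of
  \<open>Set_Algebras\<close>.
\<close>

text \<open>
  The function \<open>to_int_mod_ring\<close> returns the representative in \<open>{0..<p}\<close>, so the interval
  wraps around modulo \<open>p\<close>. It is never empty: \<open>cyc_interval x (x - 1)\<close> is the whole field.
\<close>

definition cyc_interval :: "'p::prime_card mod_ring \<Rightarrow> 'p mod_ring \<Rightarrow> 'p mod_ring set" where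
  "cyc_interval x y = {x + of_nat j | j. j \<le> nat (to_int_mod_ring (y - x))}"

end

theory Submission
  imports Defs
begin

text \<open>
  For two sets, divide by \<open>a\<^sub>1\<close> and let \<open>S = (X + t Y) \<union> (t X + Y)\<close>. If \<open>card S \<le> card X + card Y\<close>,
  some set \<open>C\<close> of negatives of elements outside \<open>S\<close> satisfies \<open>card X + card Y + card C = p\<close>, while
  \<open>0 \<notin> X + t Y + C\<close> and \<open>0 \<notin> t X + Y + C\<close>. Both triples are then critical: they miss equality in
  the Cauchy--Davenport theorem by at most one. Hamidoune's atoms find a two-element set \<open>{0, d}\<close> for which
  \<open>C + {0, d}\<close> has at most \<open>card C + 2\<close> elements, so \<open>C\<close> is a union of at most two progressions of
  difference \<open>d\<close>, and the other two members of each triple are progressions with at most one hole.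
  Comparing the differences in the two triples gives \<open>t = - 1\<close>, and an explicit computation with
  intervals gives the exceptional form.

  For more sets, Cauchy--Davenport adds up the estimates for disjoint subfamilies with a surplus to
  spare, as soon as the coefficients split into two nonconstant parts. An exceptional pair determines
  the partner of each of its members, so exceptional pairs can be avoided. What remains is three sets
  and the case of a single different coefficient; there equality in Cauchy--Davenport and Vosper's
  theorem make all sets progressions with a common difference, for which the union over the
  permutations is visibly too large.
\<close>

text \<open>An atom of \<open>C\<close> may also have three elements, and then no direction
  \<open>d\<close> need be good. In that case \<open>card C = p - 6\<close>, and the complement of
  \<open>C\<close> is, up to sign and translation, the six-element double of a triple. The sets
  \<open>X\<close>, \<open>Y\<close> and their dilates by \<open>t\<close> are then translates of
  one another, which is incompatible with disjointness. A good direction is not quite canonical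
  either: when the components of two sets interleave, the progressions have difference
  \<open>d / 2\<close> instead of \<open>d\<close>. The differences found in the two triples are
  therefore compared through their squares, which asks for 15 to be nonzero. The margin 5 in the
  hypothesis is what gives \<open>card C \<ge> 5\<close>: if \<open>C\<close> is an interval and an
  isolated point, the interval keeps at least four elements, enough to control a sumset up to two
  holes. Because pairs have genuine exceptions, no induction can start from them: families of three
  and of four sets need their own arguments. For three sets with coefficients \<open>b\<close>,
  \<open>b\<close>, \<open>- b\<close> the counting of intervals gains too little, and the symmetry
  of the differences about 0 replaces it.\<close>

section \<open>Sumsets, translates and dilates\<close>

lemma plus_mem_iff: "x \<in> A + B \<longleftrightarrow> (\<exists>a\<in>A. \<exists>b\<in>B. x = a + b)"
  by (auto simp: set_plus_def)

lemma translate_eq_image: "x +o B = (+) x ` B"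
  by (auto simp: elt_set_plus_def)

lemma dilate_eq_image: "r *o B = (*) r ` B"
  by (auto simp: elt_set_times_def)

lemma card_translate [simp]: "card ((x::'a::ab_group_add) +o B) = card B"
  by (simp add: translate_eq_image card_image)

lemma card_dilate [simp]: "r \<noteq> 0 \<Longrightarrow> card ((r::'a::field) *o B) = card B"
  by (simp add: dilate_eq_image card_image inj_on_def)

lemma mem_translate_iff: "y \<in> (x::'a::ab_group_add) +o B \<longleftrightarrow> y - x \<in> B"
  by (simp add: set_minus_plus)

lemma mem_dilate_iff: "r \<noteq> 0 \<Longrightarrow> y \<in> (r::'a::field) *o B \<longleftrightarrow> y / r \<in> B"
  by (auto simp: dilate_eq_image image_iff) (metis nonzero_mult_div_cancel_left times_divide_eq_right)

lemma dilate_empty_iff [simp]: "r *o B = {} \<longleftrightarrow> B = {}"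
  by (simp add: dilate_eq_image)

lemma card_plus_commute: "card (A + B) = card (B + (A::'a::ab_semigroup_add set))"
  by (simp add: add.commute)

lemma card_le_card_plus:
  fixes B C :: "'p::prime_card mod_ring set"
  assumes "C \<noteq> {}"
  shows "card B \<le> card (B + C)"
proof -
  obtain c where "c \<in> C" using assms by blast
  then have "c +o B \<subseteq> B + C"
    by (auto simp: elt_set_plus_def plus_mem_iff add.commute)
  then have "card (c +o B) \<le> card (B + C)" by (intro card_mono) auto
  then show ?thesis by simp
qed

lemma card_compl: "card (- A) = CARD('p) - card (A :: 'p::prime_card mod_ring set)"
  by (simp add: Compl_eq_Diff_UNIV card_Diff_subset)

text \<open>The multiples of a nonzero \<open>x\<close> exhaust the prime field, so a proper
  nonempty subset has no period.\<close>

lemma translate_invariant_UNIV: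
  fixes B :: "'p::prime_card mod_ring set"
  assumes "x +o B \<subseteq> B" "x \<noteq> 0" "B \<noteq> {}"
  shows "B = UNIV"
proof -
  obtain b where b: "b \<in> B" using assms by blast
  have it: "b + of_nat i * x \<in> B" for i
  proof (induction i)
    case (Suc i)
    have "x + (b + of_nat i * x) \<in> x +o B" using Suc by blast
    then show ?case using assms(1) by (auto simp: algebra_simps)
  qed (simp add: b)
  have "y \<in> B" for y
  proof -
    obtain i where "(y - b) / x = of_nat i" using surj_of_nat_mod_ring by blast
    then have "y = b + of_nat i * x" using assms(2) by (simp add: field_simps)
    then show ?thesis using it by metis
  qed
  then show ?thesis by blast
qed

section \<open>Separating sets, atoms and the Cauchy--Davenport theorem\<close>

text \<open>Hamidoune's \<open>k\<close>-separating sets. The second condition mirrors the first: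
  the negated complement of \<open>B + C\<close> has at least \<open>k\<close> elements too, which
  makes the notion self-dual.\<close>

definition sep :: "nat \<Rightarrow> 'p::prime_card mod_ring set \<Rightarrow> 'p mod_ring set \<Rightarrow> bool" where
  "sep k C B \<longleftrightarrow> k \<le> card B \<and> card (B + C) + k \<le> CARD('p)"

text \<open>Hamidoune's \<open>k\<close>-atoms: least defect \<open>card (B + C) - card B\<close>,
  and least cardinality among those. The comparison is written with sums because subtraction on
  \<open>nat\<close> truncates.\<close>

definition atom :: "nat \<Rightarrow> 'p::prime_card mod_ring set \<Rightarrow> 'p mod_ring set \<Rightarrow> bool" where
  "atom k C B \<longleftrightarrow> sep k C B \<and> (\<forall>B'. sep k C B' \<longrightarrow>
     card (B + C) + card B' \<le> card (B' + C) + card B \<and>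
     (card (B + C) + card B' = card (B' + C) + card B \<longrightarrow> card B \<le> card B'))"

lemma exists_atom:
  fixes C :: "'p::prime_card mod_ring set"
  assumes "sep k C B0" "C \<noteq> {}"
  obtains B where "atom k C B"
proof -
  \<comment> \<open>The factor exceeds every cardinality, so minimising \<open>g\<close> minimises
    the defect and then the cardinality.\<close>
  define g where "g B = (card (B + C) - card B) * (CARD('p) + 1) + card B" for B
  obtain B where B: "sep k C B" and min: "\<And>B'. sep k C B' \<Longrightarrow> g B \<le> g B'"
    using ex_has_least_nat[of "sep k C" B0 g] assms(1) by blast
  have "card (B + C) + card B' \<le> card (B' + C) + card B \<and>
     (card (B + C) + card B' = card (B' + C) + card B \<longrightarrow> card B \<le> card B')"
    if B': "sep k C B'" for B'
  proof -
    have cB: "card B' \<le> CARD('p)" using card_mono[of UNIV B'] by simp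
    have ge: "card B \<le> card (B + C)" "card B' \<le> card (B' + C)"
      using card_le_card_plus assms(2) by blast+
    have le: "g B \<le> g B'" using min B' by blast
    have "card (B + C) - card B \<le> card (B' + C) - card B'"
    proof (rule ccontr)
      assume "\<not> ?thesis"
      then have "card (B' + C) - card B' + 1 \<le> card (B + C) - card B" by simp
      then have "(card (B' + C) - card B' + 1) * (CARD('p) + 1) \<le> (card (B + C) - card B) * (CARD('p) + 1)"
        by (rule mult_le_mono1)
      then show False using le cB unfolding g_def by simp
    qed
    moreover have "card B \<le> card B'" if "card (B + C) - card B = card (B' + C) - card B'"
      using le that unfolding g_def by simp
    ultimately show ?thesis using ge by linarith
  qed
  then have "atom k C B" unfolding atom_def using B by blast
  then show thesis by (rule that)
qed

text \<open>
  With \<open>W\<close> the negated complement of \<open>B + C\<close>, the pair \<open>(W, C)\<close> has the same defect as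
  \<open>(B, C)\<close>, so that an atom is at most as large as its dual \<open>W\<close>; this bounds
  \<open>(B \<union> (x + B)) + C\<close> away from the whole field, as submodularity requires.
\<close>
lemma atom_inter_translate:
  fixes C :: "'p::prime_card mod_ring set"
  assumes at: "atom k C B" and x: "x \<noteq> 0" and k: "k \<ge> 1" and C: "C \<noteq> {}"
  shows "card (B \<inter> (x +o B)) < k"
proof (rule ccontr)
  assume "\<not> ?thesis"
  then have big: "k \<le> card (B \<inter> (x +o B))" by simp
  define V U where "V = B \<inter> (x +o B)" and "U = B \<union> (x +o B)"
  have sB: "k \<le> card B" "card (B + C) + k \<le> CARD('p)" using at by (auto simp: atom_def sep_def)
  have min: "card (B + C) + card B' \<le> card (B' + C) + card B"
      "card (B + C) + card B' = card (B' + C) + card B \<Longrightarrow> card B \<le> card B'"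
    if "sep k C B'" for B' using at that by (auto simp: atom_def)
  have Bne: "B \<noteq> {}" using sB k by auto
  have "V \<noteq> B"
  proof
    assume "V = B"
    then have "B \<subseteq> x +o B" by (auto simp: V_def)
    then have "x +o B = B" by (intro card_subset_eq[symmetric]) auto
    then have "B = UNIV" using translate_invariant_UNIV[of x B] x Bne by simp
    then have "card B = CARD('p)" by simp
    then show False using card_le_card_plus[OF C, of B] sB k by simp
  qed
  then have Vless: "card V < card B" by (intro psubset_card_mono) (auto simp: V_def)
  define W where "W = uminus ` (- (B + C))"
  have cW: "card W = CARD('p) - card (B + C)"
    unfolding W_def by (subst card_image) (auto simp: card_compl)
  have WC: "W + C \<subseteq> uminus ` (- B)"
  proof
    fix y assume "y \<in> W + C"
    then obtain w c where w: "w \<in> W" "c \<in> C" "y = w + c" by (auto simp: plus_mem_iff)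
    then have nw: "- w \<notin> B + C" by (auto simp: W_def)
    have "- y \<notin> B"
    proof
      assume "- y \<in> B"
      then have "- y + c \<in> B + C" using w by blast
      then show False using nw w by simp
    qed
    then show "y \<in> uminus ` (- B)" by (metis ComplI image_eqI minus_minus)
  qed
  have "card (uminus ` (- B)) = CARD('p) - card B"
    by (subst card_image) (auto simp: card_compl)
  then have cWC: "card (W + C) \<le> CARD('p) - card B"
    using card_mono[OF _ WC] by simp
  have pB: "card B \<le> CARD('p)" using card_mono[of UNIV B] by simp
  have sW: "sep k C W" unfolding sep_def using cW cWC sB pB by linarith
  have WB: "card B \<le> card W" using min[OF sW] cW cWC sB pB by linarith
  have "V + C \<subseteq> (B + C) \<inter> (x +o (B + C))"
    unfolding V_def set_plus_rearrange3[symmetric]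
    by (intro Int_greatest set_plus_mono2) auto
  moreover have "U + C = (B + C) \<union> (x +o (B + C))"
    by (simp add: U_def Un_set_plus set_plus_rearrange3)
  ultimately have "card (V + C) + card (U + C)
      \<le> card ((B + C) \<inter> (x +o (B + C))) + card ((B + C) \<union> (x +o (B + C)))"
    by (simp add: card_mono)
  also have "\<dots> = card (B + C) + card (x +o (B + C))"
    using card_Un_Int[of "B + C" "x +o (B + C)"] by simp
  finally have sub: "card (V + C) + card (U + C) \<le> 2 * card (B + C)" by simp
  have UV: "card U + card V = 2 * card B"
    unfolding U_def V_def using card_Un_Int[of B "x +o B"] by simp
  have "card (V + C) \<le> card (B + C)" by (intro card_mono set_plus_mono2) (auto simp: V_def)
  then have sV: "sep k C V" unfolding sep_def using big sB by (auto simp: V_def)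
  have fV: "card (B + C) + card V \<le> card (V + C) + card B" using min sV by blast
  have sU: "sep k C U" unfolding sep_def
  proof
    show "k \<le> card U" using sB card_mono[of U B] by (force simp: U_def)
    \<comment> \<open>By \<open>sub\<close> and \<open>fV\<close>, \<open>card (U + C)\<close> is at
      most \<open>card (B + C) + card B - card V\<close>. Since \<open>card B \<le> card W\<close>
      and \<open>card V \<ge> k\<close>, this is at most \<open>p - k\<close>.\<close>
    show "card (U + C) + k \<le> CARD('p)"
      using sub fV WB cW sB big unfolding V_def[symmetric] by linarith
  qed
  \<comment> \<open>The defects of \<open>U\<close> and \<open>V\<close> add up to at most twice the
    minimal one and neither is below it, so \<open>V\<close> is a smaller set of minimal
    defect.\<close>
  have "card (B + C) + card U \<le> card (U + C) + card B" using min sU by blast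
  then have "card (B + C) + card V = card (V + C) + card B" using fV sub UV by linarith
  then show False using min(2)[OF sV] Vless by simp
qed

text \<open>A 1-atom is disjoint from each of its nonzero translates, hence a single point. Its
  defect \<open>card C - 1\<close> is a lower bound for the defect of \<open>A\<close>.\<close>

theorem Cauchy_Davenport:
  fixes A C :: "'p::prime_card mod_ring set"
  assumes "A \<noteq> {}" "C \<noteq> {}"
  shows "card (A + C) \<ge> min CARD('p) (card A + card C - 1)"
proof (cases "card (A + C) < CARD('p)")
  case True
  have "sep 1 C A" unfolding sep_def using True assms by (simp add: Suc_le_eq card_gt_0_iff)
  then obtain B where at: "atom 1 C B" using exists_atom assms by metis
  have "card B \<ge> 1" using at by (auto simp: atom_def sep_def)
  then obtain b where b: "b \<in> B" by fastforce
  have "B = {b}"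
  proof (rule ccontr)
    assume "B \<noteq> {b}"
    then obtain b' where b': "b' \<in> B" "b' \<noteq> b" using b by blast
    have "b' \<in> B \<inter> ((b' - b) +o B)" using b b' by (auto simp: mem_translate_iff)
    moreover have "card (B \<inter> ((b' - b) +o B)) < 1"
      using b' assms by (intro atom_inter_translate[OF at]) auto
    ultimately show False by (metis card_eq_0_iff empty_iff finite less_one)
  qed
  then have "card (B + C) = card C" "card B = 1"
    by (simp_all add: card_plus_commute[of "{b}"] card_plus_sing)
  moreover have "card (B + C) + card A \<le> card (A + C) + card B"
    using at \<open>sep 1 C A\<close> by (auto simp: atom_def)
  ultimately show ?thesis by simp
next
  case False
  then show ?thesis by simp
qed

section \<open>Intervals\<close>

text \<open>Start and length instead of two endpoints: the empty interval becomes available, and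
  lengths are added in \<open>nat\<close>, without reduction modulo \<open>p\<close>.\<close>

definition iv :: "'p::prime_card mod_ring \<Rightarrow> nat \<Rightarrow> 'p mod_ring set" where
  "iv s l = (\<lambda>i. s + of_nat i) ` {..<l}"

definition pos :: "'p::prime_card mod_ring \<Rightarrow> nat" where
  "pos x = nat (to_int_mod_ring x)"

lemma pos_less: "pos (x :: 'p::prime_card mod_ring) < CARD('p)"
  and of_nat_pos [simp]: "of_nat (pos x) = x"
proof -
  have r: "0 \<le> to_int_mod_ring x" "to_int_mod_ring x < int CARD('p)"
    using range_to_int_mod_ring[where 'a='p] by (auto simp: set_eq_iff image_iff)
  then show "pos x < CARD('p)" by (simp add: pos_def nat_less_iff)
  show "of_nat (pos x) = x" using r by (simp add: pos_def of_nat_of_int_mod_ring)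
qed

lemma pos_of_nat: "i < CARD('p) \<Longrightarrow> pos (of_nat i :: 'p::prime_card mod_ring) = i"
  by (simp add: pos_def of_nat_of_int_mod_ring)

lemma of_nat_eq_iff_less:
  "i < CARD('p) \<Longrightarrow> j < CARD('p) \<Longrightarrow> (of_nat i :: 'p::prime_card mod_ring) = of_nat j \<longleftrightarrow> i = j"
  by (metis pos_of_nat)

lemma of_nat_eq_0_iff_less:
  "i < CARD('p) \<Longrightarrow> (of_nat i :: 'p::prime_card mod_ring) = 0 \<longleftrightarrow> i = 0"
  using of_nat_eq_iff_less[where 'p='p and i=i and j=0] by simp

lemma iv_0 [simp]: "iv s 0 = {}"
  by (simp add: iv_def)

lemma iv_1 [simp]: "iv s (Suc 0) = {s}"
  by (simp add: iv_def lessThan_Suc)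

lemma iv_2: "iv s 2 = {s, s + 1}"
  by (auto simp: iv_def numeral_2_eq_2 lessThan_Suc)

lemma iv_empty_iff [simp]: "iv s l = {} \<longleftrightarrow> l = 0"
  by (auto simp: iv_def)

lemma ivI [intro]: "i < l \<Longrightarrow> s + of_nat i \<in> iv s l"
  by (auto simp: iv_def)

lemma ivE [elim?]:
  assumes "x \<in> iv s l" obtains i where "i < l" "x = s + of_nat i"
  using assms by (auto simp: iv_def)

lemma card_iv [simp]:
  "l \<le> CARD('p) \<Longrightarrow> card (iv s l :: 'p::prime_card mod_ring set) = l"
  unfolding iv_def by (subst card_image) (auto simp: inj_on_def of_nat_eq_iff_less)

lemma card_iv_le: "card (iv s l) \<le> l"
  unfolding iv_def using card_image_le[of "{..<l}"] by simp

lemma mem_iv_iff: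
  assumes "l \<le> CARD('p)"
  shows "(x :: 'p::prime_card mod_ring) \<in> iv s l \<longleftrightarrow> pos (x - s) < l"
proof
  assume "x \<in> iv s l"
  then obtain i where "i < l" "x = s + of_nat i" by (rule ivE)
  then show "pos (x - s) < l" using assms by (simp add: pos_of_nat)
next
  assume "pos (x - s) < l"
  then have "s + of_nat (pos (x - s)) \<in> iv s l" by (rule ivI)
  then show "x \<in> iv s l" by simp
qed

lemma mem_iv_of_nat_iff:
  assumes "l \<le> CARD('p)" "i < CARD('p)"
  shows "s + of_nat i \<in> (iv s l :: 'p::prime_card mod_ring set) \<longleftrightarrow> i < l"
  using assms by (simp add: mem_iv_iff pos_of_nat)

lemma iv_mono: "l \<le> m \<Longrightarrow> iv s l \<subseteq> iv s m"
  by (auto simp: iv_def)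

lemma iv_subset:
  assumes "i + l \<le> m" shows "iv (s + of_nat i) l \<subseteq> iv s m"
proof
  fix x assume "x \<in> iv (s + of_nat i) l"
  then obtain j where "j < l" "x = s + of_nat i + of_nat j" by (rule ivE)
  then show "x \<in> iv s m" using assms ivI[of "i + j" m s] by (simp add: add.assoc)
qed

lemma iv_split: "iv s (l + m) = iv s l \<union> iv (s + of_nat l) m"
proof (intro equalityI subsetI)
  fix x assume "x \<in> iv s (l + m)"
  then obtain i where i: "i < l + m" "x = s + of_nat i" by (rule ivE)
  show "x \<in> iv s l \<union> iv (s + of_nat l) m"
  proof (cases "i < l")
    case False
    then have "x = s + of_nat l + of_nat (i - l)" using i by simp
    then show ?thesis using ivI[of "i - l" m "s + of_nat l"] False i by auto
  qed (use i in auto)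
next
  fix x assume "x \<in> iv s l \<union> iv (s + of_nat l) m"
  then show "x \<in> iv s (l + m)"
    using iv_mono[of l "l + m" s] iv_subset[of l m "l + m" s] by auto
qed

lemma compl_iv:
  assumes "l \<le> CARD('p)"
  shows "- (iv s l :: 'p::prime_card mod_ring set) = iv (s + of_nat l) (CARD('p) - l)"
proof -
  have "iv s CARD('p) = (UNIV :: 'p mod_ring set)"
    by (rule card_subset_eq) auto
  then have U: "iv s l \<union> iv (s + of_nat l) (CARD('p) - l) = (UNIV :: 'p mod_ring set)"
    using iv_split[of s l "CARD('p) - l"] assms by simp
  have "card (iv s l \<union> iv (s + of_nat l) (CARD('p) - l) :: 'p mod_ring set)
      + card (iv s l \<inter> iv (s + of_nat l) (CARD('p) - l) :: 'p mod_ring set) = CARD('p)"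
    using assms card_Un_Int[of "iv s l" "iv (s + of_nat l) (CARD('p) - l) :: 'p mod_ring set"] by simp
  then have "iv s l \<inter> iv (s + of_nat l) (CARD('p) - l) = ({} :: 'p mod_ring set)"
    using U by simp
  then show ?thesis using U by blast
qed

lemma translate_iv: "x +o iv s l = iv (x + s) l"
  by (auto simp: translate_eq_image iv_def image_image add.assoc)

lemma iv_plus_iv:
  assumes "l \<ge> 1" "m \<ge> 1"
  shows "iv s l + iv t m = iv (s + t) (l + m - 1)"
proof (intro equalityI subsetI)
  fix x assume "x \<in> iv s l + iv t m"
  then obtain a b where "a \<in> iv s l" "b \<in> iv t m" "x = a + b" by (auto simp: plus_mem_iff)
  then obtain i j where "i < l" "j < m" "x = s + t + of_nat (i + j)"
    by (auto elim!: ivE simp: algebra_simps)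
  then show "x \<in> iv (s + t) (l + m - 1)" using ivI[of "i + j" "l + m - 1" "s + t"] by simp
next
  fix x assume "x \<in> iv (s + t) (l + m - 1)"
  then obtain i where i: "i < l + m - 1" "x = s + t + of_nat i" by (rule ivE)
  define j where "j = min i (l - 1)"
  have "j < l" "i - j < m" "j \<le> i" using i assms by (auto simp: j_def)
  moreover have "x = (s + of_nat j) + (t + of_nat (i - j))"
    using i \<open>j \<le> i\<close> by (simp add: algebra_simps)
  ultimately show "x \<in> iv s l + iv t m" by blast
qed

lemma uminus_iv:
  assumes "l \<ge> 1"
  shows "uminus ` iv s l = iv (- s - of_nat (l - 1)) l"
proof (intro equalityI subsetI)
  fix x assume "x \<in> uminus ` iv s l"
  then obtain i where i: "i < l" "x = - (s + of_nat i)" by (auto simp: iv_def)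
  then have "x = - s - of_nat (l - 1) + of_nat (l - 1 - i)" by simp
  then show "x \<in> iv (- s - of_nat (l - 1)) l" using ivI[of "l - 1 - i" l] assms by simp
next
  fix x assume "x \<in> iv (- s - of_nat (l - 1)) l"
  then obtain i where i: "i < l" "x = - s - of_nat (l - 1) + of_nat i" by (rule ivE)
  then have "x = - (s + of_nat (l - 1 - i))" by simp
  then show "x \<in> uminus ` iv s l" using ivI[of "l - 1 - i" l s] assms
    by (intro image_eqI[of x uminus "s + of_nat (l - 1 - i)"]) simp_all
qed

lemma iv_eq_iff:
  assumes "0 < l" "l < CARD('p)"
  shows "(iv s l :: 'p::prime_card mod_ring set) = iv t l \<longleftrightarrow> s = t"
proof
  assume eq: "(iv s l :: 'p mod_ring set) = iv t l"
  show "s = t"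
  proof (rule ccontr)
    assume ne: "s \<noteq> t"
    have "s \<in> iv t l" using ivI[of 0 l s] assms eq by simp
    then obtain i where i: "i < l" "s = t + of_nat i" by (rule ivE)
    then have "i > 0" using ne by (cases i) auto
    have "t + of_nat (l - 1) \<in> iv t l" using assms by (intro ivI) simp
    moreover have "t + of_nat l = s + of_nat (l - i)" using i by simp
    then have "t + of_nat l \<in> iv t l" using ivI[of "l - i" l s] \<open>i > 0\<close> assms eq by simp
    then show False using assms by (subst (asm) mem_iv_of_nat_iff) auto
  qed
qed simp

text \<open>
  Both the elements past the end of the shorter of the two overlapping arcs and those past the
  starting point of the shifted arc are new, until the shifted arc wraps around.
\<close>
lemma card_shift_diff_iv:
  assumes "0 < k" "k < CARD('p)" "0 < j" "j < CARD('p)"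
  shows "card ((of_nat j +o iv s k) - (iv s k :: 'p::prime_card mod_ring set))
           \<ge> min (min k j) (min (CARD('p) - j) (CARD('p) - k))"
proof -
  define r where "r = min (min k j) (min (CARD('p) - j) (CARD('p) - k))"
  have "iv (s + of_nat (max j k)) r \<subseteq> (of_nat j +o iv s k) - (iv s k :: 'p mod_ring set)"
  proof
    fix x :: "'p mod_ring" assume "x \<in> iv (s + of_nat (max j k)) r"
    then obtain i where i: "i < r" "x = s + of_nat (max j k) + of_nat i" by (rule ivE)
    then have x: "x = s + of_nat (max j k + i)" by simp
    have mj: "max j k + i < CARD('p)" using i by (auto simp: r_def)
    have "x \<notin> iv s k" unfolding x using assms mj by (subst mem_iv_of_nat_iff) auto
    moreover have "x - of_nat j = s + of_nat (max j k + i - j)" unfolding x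
      by simp
    moreover have "max j k + i - j < k" using i by (auto simp: r_def)
    ultimately have "x - of_nat j \<in> iv s k" by (metis ivI)
    with \<open>x \<notin> iv s k\<close> show "x \<in> (of_nat j +o iv s k) - iv s k"
      by (simp add: mem_translate_iff)
  qed
  then have "card (iv (s + of_nat (max j k)) r :: 'p mod_ring set)
      \<le> card ((of_nat j +o iv s k) - (iv s k :: 'p mod_ring set))"
    by (intro card_mono) auto
  moreover have "r \<le> CARD('p)" by (auto simp: r_def)
  ultimately show ?thesis by (simp add: r_def)
qed

section \<open>Sets whose sum with an interval is small\<close>

lemma card_plus_lessThan_ge:
  fixes P :: "nat set"
  assumes "finite P" "P \<noteq> {}" "L \<ge> 1"
  shows "card (P + {..<L}) \<ge> card P + L - 1"
proof -
  have "P \<union> (+) (Max P) ` {1..<L} \<subseteq> P + {..<L}"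
  proof
    fix x assume "x \<in> P \<union> (+) (Max P) ` {1..<L}"
    then consider "x \<in> P" | "Max P < x" "x < Max P + L" by force
    then show "x \<in> P + {..<L}"
    proof cases
      case 1
      then have "x + 0 \<in> P + {..<L}" using assms by (intro set_plus_intro) auto
      then show ?thesis by simp
    next
      case 2
      then have "Max P + (x - Max P) \<in> P + {..<L}" using assms by (intro set_plus_intro) auto
      then show ?thesis using 2 by simp
    qed
  qed
  then have "card (P \<union> (+) (Max P) ` {1..<L}) \<le> card (P + {..<L})"
    using assms by (intro card_mono finite_set_plus) auto
  moreover have "card (P \<union> (+) (Max P) ` {1..<L}) = card P + (L - 1)"
    using assms by (subst card_Un_disjoint) (auto simp: card_image dest: Max_ge)
  ultimately show ?thesis using assms by simp
qed

text \<open>A missed point \<open>y\<close> would split \<open>P\<close> into a lower and an upper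
  part whose sumsets do not meet. Each part gains at least \<open>L - 1\<close> elements, and the
  total gain \<open>2 * (L - 1)\<close> would exceed \<open>L - 1 + j\<close>.\<close>

lemma plus_lessThan_eq_lessThan:
  fixes P :: "nat set"
  assumes fin: "finite P" and z: "0 \<in> P" and M: "M \<in> P" "\<And>x. x \<in> P \<Longrightarrow> x \<le> M"
    and le: "card (P + {..<L}) \<le> card P + L - 1 + j" and j: "j < L - 1"
  shows "P + {..<L} = {..<M + L}"
proof (intro equalityI subsetI)
  fix x assume "x \<in> P + {..<L}"
  then obtain a b where "a \<in> P" "b < L" "x = a + b" by (auto simp: plus_mem_iff)
  then show "x \<in> {..<M + L}" using M(2)[of a] by simp
next
  fix y assume y: "y \<in> {..<M + L}"
  show "y \<in> P + {..<L}"
  proof (rule ccontr)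
    assume ny: "y \<notin> P + {..<L}"
    have *: "x + L \<le> y \<or> y < x" if "x \<in> P" for x
    proof (rule ccontr)
      assume "\<not> ?thesis"
      then have "x \<le> y" "y - x < L" by auto
      then have "x + (y - x) \<in> P + {..<L}" using that by (intro set_plus_intro) auto
      then show False using ny \<open>x \<le> y\<close> by simp
    qed
    define P1 P2 where "P1 = {x \<in> P. x + L \<le> y}" and "P2 = {x \<in> P. y < x}"
    have P: "P = P1 \<union> P2" "P1 \<inter> P2 = {}" using * by (auto simp: P1_def P2_def)
    have "0 \<in> P1" using *[OF z] z by (auto simp: P1_def)
    have "M \<in> P2" using *[OF M(1)] M(1) y by (auto simp: P2_def)
    have f: "finite P1" "finite P2" using fin P by auto
    have "x < y" if "x \<in> P1 + {..<L}" for x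
      using that by (auto simp: P1_def plus_mem_iff)
    moreover have "y < x" if "x \<in> P2 + {..<L}" for x
      using that by (auto simp: P2_def plus_mem_iff)
    ultimately have d: "(P1 + {..<L}) \<inter> (P2 + {..<L}) = {}"
      by (meson disjoint_iff order_less_asym)
    have "card (P + {..<L}) = card ((P1 + {..<L}) \<union> (P2 + {..<L}))"
      using P(1) by (metis Un_set_plus)
    also have "\<dots> = card (P1 + {..<L}) + card (P2 + {..<L})"
      using d f by (intro card_Un_disjoint finite_set_plus) auto
    finally have "card (P + {..<L}) = card (P1 + {..<L}) + card (P2 + {..<L})" .
    moreover have "card (P1 + {..<L}) \<ge> card P1 + L - 1" "card (P2 + {..<L}) \<ge> card P2 + L - 1"
      using f \<open>0 \<in> P1\<close> \<open>M \<in> P2\<close> j by (intro card_plus_lessThan_ge; force)+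
    moreover have "card P = card P1 + card P2" using P f by (simp add: card_Un_disjoint)
    ultimately show False using le j by linarith
  qed
qed

text \<open>Cut the cycle at a point \<open>w\<close> that the sumset misses. Counted from the first
  element of \<open>A\<close> after \<open>w\<close>, nothing wraps around, and the question becomes
  one about sets of natural numbers. The slack \<open>j\<close> bounds the number of holes of
  \<open>A\<close>; the sumset itself has none.\<close>

lemma almost_interval_of_plus_iv:
  fixes A :: "'p::prime_card mod_ring set"
  assumes ne: "A \<noteq> {}" and le: "card (A + iv s L) \<le> card A + L - 1 + j" and j: "j < L - 1"
    and lt: "card (A + iv s L) < CARD('p)"
  shows "\<exists>u l. A \<subseteq> iv u l \<and> u \<in> A \<and> u + of_nat (l - 1) \<in> A \<and> 1 \<le> l \<and> l \<le> card A + j \<and>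
    A + iv s L = iv (u + s) (l + L - 1) \<and> l + L - 1 < CARD('p)"
proof -
  have s: "A + iv s L = s +o (A + iv 0 L)"
    by (metis add.right_neutral set_plus_rearrange4 translate_iv)
  have "A + iv 0 L \<noteq> UNIV" using lt s by (metis card_translate CARD_mod_ring less_irrefl)
  then obtain w where w: "w \<notin> A + iv 0 L" by blast
  have wA: "w - of_nat i \<notin> A" if "i < L" for i
  proof
    assume "w - of_nat i \<in> A"
    then have "(w - of_nat i) + (0 + of_nat i) \<in> A + iv 0 L" using that by blast
    then show False using w by simp
  qed
  define g where "g = (LEAST g. w + of_nat g \<in> A)"
  obtain a where "a \<in> A" using ne by blast
  then have "w + of_nat (pos (a - w)) \<in> A" by simp
  then have gA: "w + of_nat g \<in> A" and gle: "g \<le> pos (a - w)"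
    unfolding g_def by (rule LeastI) (rule Least_le, simp add: \<open>a \<in> A\<close>)
  have gl: "w + of_nat i \<notin> A" if "i < g" for i
    using not_less_Least that unfolding g_def by blast
  have g1: "g \<ge> 1" using wA[of 0] j gA by (cases g) auto
  define v where "v = w + of_nat g"
  define P where "P = (\<lambda>x. pos (x - v)) ` A"
  have inj: "inj_on (\<lambda>x. pos (x - v)) A"
    by (rule inj_onI) (metis of_nat_pos diff_add_cancel)
  have cP: "card P = card A" unfolding P_def using inj by (rule card_image)
  have AP: "A = (\<lambda>i. v + of_nat i) ` P" by (simp add: P_def image_image)
  \<comment> \<open>The gap of \<open>A\<close> around \<open>w\<close> contains the
    \<open>L\<close> points ending at \<open>w\<close> and the \<open>g - 1\<close> points after it,
    so from any offset \<open>q\<close> at least \<open>g + L\<close> steps remain before the turn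
    is complete.\<close>
  have bound: "q + g + L \<le> CARD('p)" if q: "q \<in> P" for q
  proof (rule ccontr)
    assume n: "\<not> ?thesis"
    have qp: "q < CARD('p)" using q by (auto simp: P_def pos_less)
    have qA: "w + of_nat (g + q) \<in> A" using q AP by (auto simp: v_def algebra_simps)
    show False
    proof (cases "g + q \<ge> CARD('p)")
      case True
      have "w + of_nat (g + q - CARD('p)) \<in> A" using qA True by simp
      moreover have "g + q - CARD('p) < g" using qp True g1 by linarith
      ultimately show False using gl by blast
    next
      case False
      then have "w - of_nat (CARD('p) - (g + q)) \<in> A" using qA by (simp add: algebra_simps)
      moreover have "CARD('p) - (g + q) < L" using n False by linarith
      ultimately show False using wA by blast
    qed
  qed
  have fP: "finite P" by (simp add: P_def)
  have Pne: "P \<noteq> {}" using ne by (simp add: P_def)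
  have z: "0 \<in> P" using gA unfolding P_def v_def[symmetric]
    by (rule rev_image_eqI) (simp add: pos_of_nat[where i=0, simplified])
  define M where "M = Max P"
  have M: "M \<in> P" "\<And>x. x \<in> P \<Longrightarrow> x \<le> M" using fP Pne by (auto simp: M_def)
  have Mp: "M + L < CARD('p)" using bound[OF M(1)] g1 by simp
  have img: "A + iv 0 L = (\<lambda>i. v + of_nat i) ` (P + {..<L})"
  proof (intro equalityI subsetI)
    fix x assume "x \<in> A + iv 0 L"
    then obtain a b where "a \<in> A" "b \<in> iv 0 L" "x = a + b" by (auto simp: plus_mem_iff)
    then obtain q i where "q \<in> P" "i < L" "x = v + of_nat (q + i)"
      unfolding AP by (auto elim!: ivE simp: algebra_simps)
    then show "x \<in> (\<lambda>i. v + of_nat i) ` (P + {..<L})" by blast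
  next
    fix x assume "x \<in> (\<lambda>i. v + of_nat i) ` (P + {..<L})"
    then obtain q i where "q \<in> P" "i < L" "x = v + of_nat (q + i)"
      by (auto simp: plus_mem_iff)
    then have "v + of_nat q \<in> A" "x = (v + of_nat q) + (0 + of_nat i)"
      using AP by (auto simp: algebra_simps)
    moreover have "0 + of_nat i \<in> iv 0 L" using \<open>i < L\<close> by (rule ivI)
    ultimately show "x \<in> A + iv 0 L" by blast
  qed
  have sub: "P + {..<L} \<subseteq> {..<M + L}" using M(2) by (fastforce simp: plus_mem_iff)
  have "inj_on (\<lambda>i. v + of_nat i) (P + {..<L})"
  proof (rule inj_onI)
    fix x y assume "x \<in> P + {..<L}" "y \<in> P + {..<L}"
      and eq: "v + of_nat x = v + of_nat y"
    then have "x < M + L" "y < M + L" using sub by blast+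
    then have "x < CARD('p)" "y < CARD('p)" using Mp by simp_all
    then show "x = y" using eq by (simp add: of_nat_eq_iff_less)
  qed
  then have cimg: "card (A + iv 0 L) = card (P + {..<L})" unfolding img by (rule card_image)
  have "card (P + {..<L}) \<le> card P + L - 1 + j" using le s cimg cP by simp
  then have eq: "P + {..<L} = {..<M + L}"
    using plus_lessThan_eq_lessThan[OF fP z M _ j] by blast
  show ?thesis
  proof (intro exI conjI)
    show "A \<subseteq> iv v (M + 1)" using M(2) unfolding AP iv_def by (force simp: less_Suc_eq_le)
    show "v \<in> A" using gA by (simp add: v_def)
    show "v + of_nat (M + 1 - 1) \<in> A" using M(1) AP by auto
    show "M + 1 \<le> card A + j" using le s cimg eq j by simp
    have "A + iv 0 L = iv v (M + L)" unfolding img eq by (simp add: iv_def)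
    then show "A + iv s L = iv (v + s) (M + 1 + L - 1)"
      unfolding s by (simp add: translate_iv add.commute)
    show "M + 1 + L - 1 < CARD('p)" using Mp by simp
    show "1 \<le> M + 1" by simp
  qed
qed

lemma plus_pair: "A + {0, d} = A \<union> (d +o (A :: 'a::ab_group_add set))"
  by (auto simp: plus_mem_iff mem_translate_iff) (metis diff_add_cancel)

lemma card_plus_pair:
  fixes A :: "'p::prime_card mod_ring set"
  shows "card (A + {0, d}) = card A + card ((d +o A) - A)"
  unfolding plus_pair by (subst card_Un_disjoint[symmetric]) (auto intro: arg_cong[where f=card])

section \<open>Progressions and progressions with one hole\<close>

text \<open>Writing a progression as a dilated interval keeps the difference as a parameter, so that
  questions about one difference \<open>d\<close> reduce to \<open>d = 1\<close> by dividing by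
  \<open>d\<close>. Sets with at most one element are progressions for every nonzero
  \<open>d\<close>.\<close>

definition AP :: "'p::prime_card mod_ring \<Rightarrow> 'p mod_ring set \<Rightarrow> bool" where
  "AP d A \<longleftrightarrow> d \<noteq> 0 \<and> (\<exists>s. A = d *o iv s (card A))"

definition AAP :: "'p::prime_card mod_ring \<Rightarrow> 'p mod_ring set \<Rightarrow> bool" where
  "AAP d A \<longleftrightarrow> d \<noteq> 0 \<and> (\<exists>s. A \<subseteq> d *o iv s (card A + 1))"

lemma dilate_inverse: "d \<noteq> 0 \<Longrightarrow> inverse d *o (d *o A) = (A :: 'a::field set)"
  "d \<noteq> 0 \<Longrightarrow> d *o (inverse d *o A) = A"
  by (simp_all add: set_times_rearrange2)

lemma dilate_mono_iff: "d \<noteq> 0 \<Longrightarrow> d *o A \<subseteq> d *o B \<longleftrightarrow> A \<subseteq> (B :: 'a::field set)"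
  by (metis dilate_inverse(1) set_times_mono)

lemma dilate_eq_iff: "d \<noteq> 0 \<Longrightarrow> d *o A = d *o B \<longleftrightarrow> A = (B :: 'a::field set)"
  by (metis dilate_inverse(1))

lemma AP_dilate_iff:
  assumes "r \<noteq> 0" shows "AP (r * d) (r *o A) \<longleftrightarrow> AP d A"
  using assms by (auto simp: AP_def set_times_rearrange2[symmetric] dilate_eq_iff)

lemma AAP_dilate_iff:
  assumes "r \<noteq> 0" shows "AAP (r * d) (r *o A) \<longleftrightarrow> AAP d A"
  using assms by (auto simp: AAP_def set_times_rearrange2[symmetric] dilate_mono_iff)

lemma AP_1_iff: "AP 1 A \<longleftrightarrow> (\<exists>s. A = iv s (card A))"
  by (simp add: AP_def)

lemma AAP_1_iff: "AAP 1 A \<longleftrightarrow> (\<exists>s. A \<subseteq> iv s (card A + 1))"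
  by (simp add: AAP_def)

lemma AP_imp_AAP: "AP d A \<Longrightarrow> AAP d A"
  unfolding AP_def AAP_def by (metis iv_mono le_add1 set_times_mono)

lemma AP_1_I: "l \<le> card A \<Longrightarrow> A \<subseteq> iv s l \<Longrightarrow> AP 1 A"
  unfolding AP_1_iff
  by (metis card_iv_le card_seteq finite iv_mono order_trans)

lemma AAP_1_I: "A \<subseteq> iv s l \<Longrightarrow> l \<le> card A + 1 \<Longrightarrow> AAP 1 A"
  unfolding AAP_1_iff by (meson iv_mono order_trans)

lemma uminus_dilate: "(- 1) *o A = uminus ` (A :: 'a::ring_1 set)"
  by (auto simp: dilate_eq_image)

lemma dilate_uminus: "(- d) *o A = d *o (uminus ` (A :: 'a::ring_1 set))"
  by (auto simp: dilate_eq_image image_image)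

lemma AP_uminus: "A \<noteq> {} \<Longrightarrow> AP d A \<Longrightarrow> AP (- d) A"
proof -
  assume ne: "A \<noteq> {}" and "AP d A"
  then obtain s where s: "d \<noteq> 0" "A = d *o iv s (card A)" by (auto simp: AP_def)
  have c: "card A \<ge> 1" using ne by (simp add: Suc_le_eq card_gt_0_iff)
  have "d *o iv s (card A) = (- d) *o (uminus ` iv s (card A))"
    by (simp add: dilate_uminus image_image)
  then have "A = (- d) *o iv (- s - of_nat (card A - 1)) (card A)"
    using s uminus_iv[OF c] by metis
  then show ?thesis using s by (auto simp: AP_def)
qed

lemma AAP_uminus: "AAP d A \<Longrightarrow> AAP (- d) A"
proof -
  assume "AAP d A"
  then obtain s where s: "d \<noteq> 0" "A \<subseteq> d *o iv s (card A + 1)" by (auto simp: AAP_def)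
  have "d *o iv s (card A + 1) = (- d) *o (uminus ` iv s (card A + 1))"
    by (simp add: dilate_uminus image_image)
  then have "A \<subseteq> (- d) *o iv (- s - of_nat (card A + 1 - 1)) (card A + 1)"
    using s uminus_iv[of "card A + 1" s] by simp
  then show ?thesis using s by (auto simp: AAP_def)
qed

section \<open>Components of a set for the step 1\<close>

text \<open>The last elements of the maximal runs of consecutive elements. For a proper subset of
  the field, \<open>card (ends A)\<close> is the number of these runs.\<close>

definition ends :: "'p::prime_card mod_ring set \<Rightarrow> 'p mod_ring set" where
  "ends A = {e \<in> A. e + 1 \<notin> A}"

lemma card_plus_01: "card (A + {0, 1}) = card A + card (ends (A :: 'p::prime_card mod_ring set))"
proof -
  have "(1 +o A) - A = (+) 1 ` ends A"
    by (auto simp: ends_def mem_translate_iff image_iff) (metis add.commute diff_add_cancel)+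
  then show ?thesis unfolding card_plus_pair by (simp add: card_image)
qed

lemma interval_of_one_end:
  fixes A :: "'p::prime_card mod_ring set"
  assumes "card A + 2 \<le> CARD('p)" "card (ends A) \<le> 1"
  shows "AP 1 A"
proof (cases "A = {}")
  case False
  have "A + iv 0 2 = A + {0, 1}" by (simp add: iv_2)
  then have c: "card (A + iv 0 2) \<le> card A + 2 - 1 + 0" "card (A + iv 0 2) < CARD('p)"
    using card_plus_01[of A] assms by simp_all
  have j: "0 < 2 - (1::nat)" by simp
  obtain u l where "A \<subseteq> iv u l" "l \<le> card A + 0"
    using almost_interval_of_plus_iv[OF False c(1) j c(2)] by blast
  then show ?thesis by (intro AP_1_I) auto
qed (auto simp: AP_1_iff)

text \<open>Start at an element whose predecessor is missing and remove the run beginning there. One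
  end disappears and none is created, so the rest is a single interval. The last two clauses say
  that both intervals are followed by a gap; this maximality is what later keeps an interval from
  crossing between them.\<close>

lemma two_intervals_of_two_ends:
  fixes A :: "'p::prime_card mod_ring set"
  assumes A: "A \<noteq> {}" "card A + 2 \<le> CARD('p)" "card (ends A) \<le> 2"
  shows "AP 1 A \<or> (\<exists>s1 l1 s2 l2. l1 \<ge> 1 \<and> l2 \<ge> 1 \<and> A = iv s1 l1 \<union> iv s2 l2 \<and>
    card A = l1 + l2 \<and> iv s1 l1 \<inter> iv s2 l2 = {} \<and> s1 + of_nat l1 \<notin> A \<and> s2 + of_nat l2 \<notin> A)"
proof -
  have "\<not> (-1) +o A \<subseteq> A"
  proof
    assume "(-1) +o A \<subseteq> A"
    then have "A = UNIV" using A by (intro translate_invariant_UNIV[of "-1"]) auto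
    then show False using A by simp
  qed
  then obtain s where s: "s \<in> A" "s - 1 \<notin> A" by (auto simp: elt_set_plus_def)
  have "A \<noteq> UNIV" using A by auto
  then obtain y where y: "y \<notin> A" by blast
  define l where "l = (LEAST l. s + of_nat l \<notin> A)"
  have "s + of_nat (pos (y - s)) \<notin> A" using y by simp
  then have l: "s + of_nat l \<notin> A" unfolding l_def by (rule LeastI)
  have lA: "s + of_nat i \<in> A" if "i < l" for i using not_less_Least that unfolding l_def by blast
  have l1: "l \<ge> 1" using l s by (cases l) auto
  have ivA: "iv s l \<subseteq> A" using lA by (auto simp: iv_def)
  have lp: "l \<le> CARD('p)"
  proof (rule ccontr)
    assume "\<not> ?thesis"
    then have "s + of_nat (pos (y - s)) \<in> A" using pos_less[of "y - s"] by (intro lA) linarith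
    then show False using y by simp
  qed
  define A2 where "A2 = A - iv s l"
  have eA: "s + of_nat (l - 1) \<in> ends A" using lA[of "l - 1"] l l1 by (simp add: ends_def)
  have "ends A2 \<subseteq> ends A - {s + of_nat (l - 1)}"
  proof
    fix e assume e: "e \<in> ends A2"
    then have e2: "e \<in> A" "e \<notin> iv s l" "e + 1 \<notin> A2" by (auto simp: ends_def A2_def)
    have "e + 1 \<notin> A"
    proof
      assume "e + 1 \<in> A"
      then have "e + 1 \<in> iv s l" using e2 by (auto simp: A2_def)
      then obtain i where i: "i < l" "e + 1 = s + of_nat i" by (rule ivE)
      show False
      proof (cases i)
        case 0
        then have "e = s - 1" using i by (simp add: algebra_simps)
        then show False using s e2 by simp
      next
        case (Suc j)
        then have "e = s + of_nat j" using i by simp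
        then show False using e2 Suc i by (metis Suc_lessD ivI)
      qed
    qed
    moreover have "e \<noteq> s + of_nat (l - 1)" using e2 ivI[of "l - 1" l s] l1 by auto
    ultimately show "e \<in> ends A - {s + of_nat (l - 1)}" using e2 by (simp add: ends_def)
  qed
  then have "card (ends A2) \<le> card (ends A - {s + of_nat (l - 1)})" by (intro card_mono) auto
  also have "\<dots> = card (ends A) - 1" using eA by (simp add: card_Diff_singleton)
  finally have "card (ends A2) \<le> 1" using A by simp
  moreover have cA2: "card A = l + card A2"
    unfolding A2_def using ivA lp by (simp add: card_Diff_subset) (metis card_iv card_mono finite le_add_diff_inverse)
  ultimately have "AP 1 A2" using A by (intro interval_of_one_end) auto
  then obtain s2 where s2: "A2 = iv s2 (card A2)" by (auto simp: AP_1_iff)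
  show ?thesis
  proof (cases "A2 = {}")
    case True
    then show ?thesis using ivA cA2 by (auto simp: A2_def AP_1_iff)
  next
    case False
    then have c1: "card A2 \<ge> 1" by (simp add: Suc_le_eq card_gt_0_iff)
    have AU: "A = iv s l \<union> iv s2 (card A2)" using ivA s2 by (auto simp: A2_def)
    have D: "iv s l \<inter> iv s2 (card A2) = {}" using s2 by (auto simp: A2_def)
    have "s2 + of_nat (card A2) \<notin> A"
    proof
      assume a: "s2 + of_nat (card A2) \<in> A"
      have prev: "s2 + of_nat (card A2 - 1) \<in> iv s2 (card A2)" using c1 by (intro ivI) simp
      have "s2 + of_nat (card A2) \<notin> iv s2 (card A2)"
        using cA2 A c1 by (subst mem_iv_of_nat_iff) auto
      then have "s2 + of_nat (card A2) \<in> iv s l" using a AU by blast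
      then obtain i where i: "i < l" "s2 + of_nat (card A2) = s + of_nat i" by (rule ivE)
      show False
      proof (cases i)
        case 0
        then have "s2 + of_nat (card A2 - 1) = s - 1"
          using i c1 by (simp add: of_nat_diff algebra_simps)
        then show False using s prev AU by auto
      next
        case (Suc j)
        then have "s2 + of_nat (card A2 - 1) = s + of_nat j"
          using i c1 by (simp add: of_nat_diff algebra_simps)
        then show False using prev D Suc i by (metis Suc_lessD disjoint_iff ivI)
      qed
    qed
    then show ?thesis using l1 c1 AU D l cA2 by blast
  qed
qed

text \<open>
  Three translates of an atom already cover \<open>3 * card M - 3\<close> elements, as any two of them meet
  in at most one point. Playing this against an atom \<open>A\<close> of \<open>M\<close> leaves only small sizes.
\<close>
lemma card_plus_ge_three_translates:
  fixes A M :: "'p::prime_card mod_ring set"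
  assumes A: "card A \<ge> 3" and M: "\<And>x. x \<noteq> 0 \<Longrightarrow> card (M \<inter> (x +o M)) \<le> 1"
  shows "card (A + M) + 3 \<ge> 3 * card M"
proof -
  obtain T where "T \<subseteq> A" "card T = 3" using A by (meson obtain_subset_with_card_n)
  then obtain a b c where abc: "{a, b, c} \<subseteq> A" "a \<noteq> b" "a \<noteq> c" "b \<noteq> c"
    by (auto simp: card_3_iff)
  have two: "card ((x +o M) \<inter> (y +o M)) \<le> 1" if "x \<noteq> y" for x y
  proof -
    have "(x +o M) \<inter> (y +o M) = x +o (M \<inter> ((y - x) +o M))"
      by (auto simp: mem_translate_iff)
    then show ?thesis using M[of "y - x"] that by simp
  qed
  have "(a +o M) \<union> (b +o M) \<union> (c +o M) \<subseteq> A + M"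
    using abc by (auto simp: elt_set_plus_def)
  then have "card ((a +o M) \<union> (b +o M) \<union> (c +o M)) \<le> card (A + M)" by (intro card_mono) auto
  moreover have "card ((a +o M) \<union> (b +o M)) + card ((a +o M) \<inter> (b +o M)) = 2 * card M"
    using card_Un_Int[of "a +o M" "b +o M"] by simp
  moreover have "card ((a +o M) \<union> (b +o M) \<union> (c +o M))
      + card (((a +o M) \<union> (b +o M)) \<inter> (c +o M)) = card ((a +o M) \<union> (b +o M)) + card M"
    using card_Un_Int[of "(a +o M) \<union> (b +o M)" "c +o M"] by simp
  moreover have "card (((a +o M) \<union> (b +o M)) \<inter> (c +o M))
      \<le> card ((a +o M) \<inter> (c +o M)) + card ((b +o M) \<inter> (c +o M))"
    by (simp add: Int_Un_distrib2 card_Un_le)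
  ultimately show ?thesis using two[OF abc(2)] two[OF abc(3)] two[OF abc(4)] by linarith
qed

section \<open>Small 2-atoms and Vosper's theorem\<close>

text \<open>\<open>C\<close> is itself a 2-separating set for \<open>M\<close>, so an atom
  \<open>A\<close> of \<open>M\<close> has \<open>card (A + M) \<le> card A + card M\<close>. If
  \<open>A\<close> has two elements, then \<open>2 * card M - 1 \<le> card M + 2\<close>. If
  \<open>A\<close> and \<open>M\<close> both have at least three, the lower bounds
  \<open>3 * card M - 3\<close> and \<open>3 * card A - 3\<close> for the sumset leave only
  \<open>card A = card M = 3\<close> with equality.\<close>

lemma atom_2_card:
  fixes C M :: "'p::prime_card mod_ring set"
  assumes at: "atom 2 C M" and C: "card C \<ge> 2" and le: "card (M + C) \<le> card M + card C"
  shows "card M = 2 \<or> card M = 3 \<and> card (M + C) = 3 + card C"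
proof -
  have sM: "2 \<le> card M" "card (M + C) + 2 \<le> CARD('p)" using at by (auto simp: atom_def sep_def)
  have Cne: "C \<noteq> {}" and Mne: "M \<noteq> {}" using C sM by auto
  have Mx: "card (M \<inter> (x +o M)) \<le> 1" if "x \<noteq> 0" for x
    using atom_inter_translate[OF at that _ Cne] by simp
  have "sep 2 M C" using C sM by (simp add: sep_def card_plus_commute)
  then obtain A where A: "atom 2 M A" using exists_atom Mne by blast
  have Ax: "card (A \<inter> (x +o A)) \<le> 1" if "x \<noteq> 0" for x
    using atom_inter_translate[OF A that _ Mne] by simp
  have A2: "card A \<ge> 2" using A by (auto simp: atom_def sep_def)
  have fA: "card (A + M) + card C \<le> card (M + C) + card A"
    using A \<open>sep 2 M C\<close> by (auto simp: atom_def card_plus_commute[of C M])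
  show ?thesis
  proof (cases "card A = 2")
    case True
    then obtain a b where ab: "A = {a, b}" "a \<noteq> b" by (auto simp: card_2_iff)
    have "A + M = (a +o M) \<union> (b +o M)" by (auto simp: ab plus_mem_iff elt_set_plus_def)
    moreover have "(a +o M) \<inter> (b +o M) = a +o (M \<inter> ((b - a) +o M))"
      by (auto simp: mem_translate_iff)
    ultimately have "card (A + M) + card (M \<inter> ((b - a) +o M)) = 2 * card M"
      using card_Un_Int[of "a +o M" "b +o M"] by simp
    then have "card (A + M) + 1 \<ge> 2 * card M" using Mx[of "b - a"] ab by simp
    then show ?thesis using fA True le sM by linarith
  next
    case False
    then have "card A \<ge> 3" using A2 by simp
    then have "card (A + M) + 3 \<ge> 3 * card M" using card_plus_ge_three_translates Mx by blast
    moreover have "card (A + M) + 3 \<ge> 3 * card A" if "card M \<ge> 3"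
      using card_plus_ge_three_translates[of M A] that Ax by (simp add: card_plus_commute)
    ultimately show ?thesis using fA le sM \<open>card A \<ge> 3\<close> by linarith
  qed
qed

lemma translate_plus: "(x +o B) + C = x +o (B + (C :: 'a::comm_monoid_add set))"
  by (rule set_plus_rearrange3)

lemma card_plus_two_elements:
  fixes C :: "'p::prime_card mod_ring set"
  shows "card ({a, b} + C) = card (C + {0, b - a})"
proof -
  have "{a, b} = a +o {0, b - a}" by (auto simp: elt_set_plus_def)
  then show ?thesis by (simp add: translate_plus card_plus_commute)
qed

text \<open>Compare \<open>A\<close> with a 2-atom of \<open>C\<close>, whose defect is no larger. A
  three-element atom has defect \<open>card C\<close>, so it can occur only if \<open>A\<close>
  attains the assumed bound exactly.\<close>

lemma small_difference_pair_or_triple: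
  fixes A C :: "'p::prime_card mod_ring set"
  assumes "card A \<ge> 2" "card C \<ge> 2" "card (A + C) + 2 \<le> CARD('p)"
    and le: "card (A + C) \<le> card A + card C"
  shows "(\<exists>d. d \<noteq> 0 \<and> card (C + {0, d}) + card A \<le> card (A + C) + 2) \<or>
    (\<exists>M. card M = 3 \<and> card (M + C) = 3 + card C \<and> card (A + C) = card A + card C)"
proof -
  have sA: "sep 2 C A" using assms by (simp add: sep_def)
  then obtain M where M: "atom 2 C M" using exists_atom assms(2) by (metis card.empty not_numeral_le_zero)
  have f: "card (M + C) + card A \<le> card (A + C) + card M" using M sA by (auto simp: atom_def)
  have "card M = 2 \<or> card M = 3 \<and> card (M + C) = 3 + card C"
    using atom_2_card[OF M] assms f by linarith
  then show ?thesis
  proof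
    assume "card M = 2"
    then obtain a b where "M = {a, b}" "a \<noteq> b" by (auto simp: card_2_iff)
    then show ?thesis using f \<open>card M = 2\<close> card_plus_two_elements[of a b C]
      by (intro disjI1 exI[of _ "b - a"]) auto
  next
    assume "card M = 3 \<and> card (M + C) = 3 + card C"
    then show ?thesis using f le by (intro disjI2 exI[of _ M]) auto
  qed
qed

lemma AP_of_plus_pair:
  fixes C :: "'p::prime_card mod_ring set"
  assumes "d \<noteq> 0" "card C + 2 \<le> CARD('p)" "card (C + {0, d}) \<le> card C + 1"
  shows "AP d C"
proof -
  define C' where "C' = inverse d *o C"
  have C: "C = d *o C'" using assms by (simp add: C'_def dilate_inverse)
  have "d *o {0, 1} = {0, d}" by (simp add: dilate_eq_image)
  then have "C + {0, d} = d *o (C' + {0, 1})" unfolding C by (simp add: set_times_plus_distrib2)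
  then have "card (C' + {0, 1}) \<le> card C' + 1" "card C' = card C" using assms C by auto
  then have "AP 1 C'" using assms card_plus_01[of C'] by (intro interval_of_one_end) auto
  then show ?thesis using AP_dilate_iff[OF assms(1), of 1 C'] C by simp
qed

lemma AP_of_plus_AP:
  fixes A C :: "'p::prime_card mod_ring set"
  assumes "A \<noteq> {}" "card C \<ge> 2" "AP d C" "card (A + C) < CARD('p)"
    and "card (A + C) \<le> card A + card C - 1"
  shows "AP d A" "AP d (A + C)"
proof -
  obtain s where d: "d \<noteq> 0" and s: "C = d *o iv s (card C)" using assms by (auto simp: AP_def)
  define A' where "A' = inverse d *o A"
  have A: "A = d *o A'" using d by (simp add: A'_def dilate_inverse)
  have AC: "A + C = d *o (A' + iv s (card C))" unfolding A by (subst s) (simp add: set_times_plus_distrib2)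
  have cA: "card A' = card A" using A d by simp
  have ne: "A' \<noteq> {}" using assms A by auto
  have le: "card (A' + iv s (card C)) \<le> card A' + card C - 1 + 0" "0 < card C - 1"
    "card (A' + iv s (card C)) < CARD('p)" using assms AC cA d by simp_all
  obtain u l where "A' \<subseteq> iv u l" "l \<le> card A' + 0"
     and e: "A' + iv s (card C) = iv (u + s) (l + card C - 1)" "l + card C - 1 < CARD('p)"
    using almost_interval_of_plus_iv[OF ne le] by blast
  then have "A' \<subseteq> iv u l" "l \<le> card A'" by simp_all
  then have "AP 1 A'" by (intro AP_1_I)
  then show "AP d A" using AP_dilate_iff[OF d, of 1 A'] A by simp
  have "AP 1 (A' + iv s (card C))" unfolding AP_1_iff e using e(2) by (intro exI) simp
  then show "AP d (A + C)" using AP_dilate_iff[OF d, of 1] AC by simp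
qed

text \<open>The hypothesis puts the defect of \<open>A\<close> below \<open>card C\<close>, which
  rules out a three-element atom. A two-element atom shows that \<open>C\<close> has a single
  component for the step \<open>d\<close>, and adding a progression without slack carries
  \<open>d\<close> over to \<open>A\<close> and \<open>A + C\<close>.\<close>

theorem Vosper:
  fixes A C :: "'p::prime_card mod_ring set"
  assumes "card A \<ge> 2" "card C \<ge> 2" "card (A + C) + 2 \<le> CARD('p)"
    and le: "card (A + C) \<le> card A + card C - 1"
  obtains d where "AP d A" "AP d C" "AP d (A + C)"
proof -
  obtain d where d: "d \<noteq> 0" "card (C + {0, d}) + card A \<le> card (A + C) + 2"
    using small_difference_pair_or_triple[of A C] assms by force
  have "C \<noteq> {}" "A \<noteq> {}" using assms by auto
  then have "card C \<le> card (A + C)" using card_le_card_plus[of A C] by (simp add: card_plus_commute)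
  then have "AP d C" using assms d by (intro AP_of_plus_pair) auto
  then show thesis using AP_of_plus_AP[of A C d] assms that \<open>A \<noteq> {}\<close> by auto
qed

section \<open>Sets that every pair enlarges by at least three\<close>

lemma of_nat_ne_0: "0 < i \<Longrightarrow> i < CARD('p) \<Longrightarrow> (of_nat i :: 'p::prime_card mod_ring) \<noteq> 0"
  by (simp add: of_nat_eq_0_iff_less)

lemma numeral_ne_0:
  assumes "5 < CARD('p)"
  shows "(2 :: 'p::prime_card mod_ring) \<noteq> 0" "(3 :: 'p mod_ring) \<noteq> 0"
    "(4 :: 'p mod_ring) \<noteq> 0" "(5 :: 'p mod_ring) \<noteq> 0"
  using assms of_nat_ne_0[where 'p='p and i=2] of_nat_ne_0[where 'p='p and i=3]
    of_nat_ne_0[where 'p='p and i=4] of_nat_ne_0[where 'p='p and i=5] by simp_all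

lemma mem_uminus_image_iff: "y \<in> uminus ` X \<longleftrightarrow> - y \<in> (X :: 'a::group_add set)"
  by (auto simp: image_iff) (metis minus_minus)

text \<open>
  In the directions given by a triple \<open>M\<close> all of whose pairs have the same sumset with \<open>C\<close>,
  stepping by the difference \<open>u - v\<close> sends an end of \<open>C\<close> followed by a gap of length at least 2
  to an end whose gap is at most one shorter. Three ends cannot be permuted cyclically this way,
  so the gaps have lengths at most 3, 2 and 1.
\<close>
lemma rigid_triple:
  fixes C M :: "'p::prime_card mod_ring set"
  assumes C: "C \<noteq> {}" and p: "5 < CARD('p)"
    and rigid: "\<And>d. d \<noteq> 0 \<Longrightarrow> card (C + {0, d}) \<ge> card C + 3"
    and M: "card M = 3" "card (M + C) \<le> card C + 3"
    and pc: "card C + 6 \<le> CARD('p)"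
  shows "card C + 6 = CARD('p) \<and> card (M + M) = 6 \<and> (\<exists>k. M + M = k +o (uminus ` (- C)))"
proof -
  obtain m0 m1 m2 where m: "M = {m0, m1, m2}" "m0 \<noteq> m1" "m0 \<noteq> m2" "m1 \<noteq> m2"
    using M(1) by (auto simp: card_3_iff)
  define u v where "u = m1 - m0" and "v = m2 - m0"
  have uv: "u \<noteq> 0" "v \<noteq> 0" "u \<noteq> v" using m by (auto simp: u_def v_def)
  have M': "M = m0 +o {0, u, v}" using m by (auto simp: u_def v_def elt_set_plus_def)
  define D where "D = {0, u, v} + C"
  have "M + C = m0 +o D" unfolding M' D_def by (rule set_plus_rearrange3)
  then have cD: "card D \<le> card C + 3" using M by simp
  have D: "D = C \<union> (u +o C) \<union> (v +o C)"
    unfolding D_def by (auto simp: plus_mem_iff elt_set_plus_def)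
  \<comment> \<open>By rigidity any two of the three translates of \<open>C\<close> already cover as
    many elements as \<open>D\<close> can have. Every element of \<open>D\<close> therefore lies in
    at least two of the translates.\<close>
  have pairD: "{a, b} + C = D" if "a \<noteq> b" "{a, b} \<subseteq> {0, u, v}" for a b
  proof (rule card_seteq)
    show "{a, b} + C \<subseteq> D" unfolding D_def using that by (intro set_plus_mono2) auto
    show "card D \<le> card ({a, b} + C)"
      using cD rigid[of "b - a"] that card_plus_two_elements[of a b C] by auto
  qed simp
  have two: "y \<in> C \<and> y - u \<in> C \<or> y \<in> C \<and> y - v \<in> C \<or> y - u \<in> C \<and> y - v \<in> C" if "y \<in> D" for y
  proof -
    have "{a, b} + C = (a +o C) \<union> (b +o C)" for a b
      by (auto simp: plus_mem_iff elt_set_plus_def)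
    then have "D = (0 +o C) \<union> (u +o C)" "D = (0 +o C) \<union> (v +o C)" "D = (u +o C) \<union> (v +o C)"
      using pairD[of 0 u] pairD[of 0 v] pairD[of u v] uv by auto
    then have "y \<in> (0 +o C) \<union> (u +o C)" "y \<in> (0 +o C) \<union> (v +o C)" "y \<in> (u +o C) \<union> (v +o C)"
      using that by simp_all
    then show ?thesis by (auto simp: mem_translate_iff)
  qed
  \<comment> \<open>The ends of \<open>C\<close> for the step \<open>u\<close>; \<open>g e\<close>
    below is the length of the gap following the end \<open>e\<close>.\<close>
  define E where "E = {e \<in> C. e + u \<notin> C}"
  define g where "g e = (LEAST i. e + of_nat (i + 1) * u \<in> C)" for e
  have gC: "e + of_nat (g e + 1) * u \<in> C" if "e \<in> E" for e
  proof -
    have "e + of_nat (CARD('p) - 1 + 1) * u \<in> C" using that by (simp add: E_def)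
    then show ?thesis unfolding g_def by (rule LeastI)
  qed
  have gn: "e + of_nat i * u \<notin> C" if "1 \<le> i" "i \<le> g e" for e i
    using not_less_Least[of "i - 1" "\<lambda>i. e + of_nat (i + 1) * u \<in> C"] that
    unfolding g_def[symmetric] by simp
  have g_ge: "j \<le> g e" if "e \<in> E" "\<And>i. 1 \<le> i \<Longrightarrow> i \<le> j \<Longrightarrow> e + of_nat i * u \<notin> C" for e j
  proof (rule ccontr)
    assume "\<not> ?thesis"
    then show False using gC[OF that(1)] that(2)[of "g e + 1"] by auto
  qed
  have g1: "g e \<ge> 1" if "e \<in> E" for e using that by (intro g_ge) (auto simp: E_def dest!: antisym)
  have cover: "- C \<subseteq> (\<Union>e\<in>E. (\<lambda>i. e + of_nat i * u) ` {1..g e})"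
  proof
    fix y assume y: "y \<in> - C"
    obtain c where c: "c \<in> C" using C by blast
    define i where "i = (LEAST i. y - of_nat i * u \<in> C)"
    have "y - of_nat (pos ((y - c) / u)) * u \<in> C" using c uv by simp
    then have iC: "y - of_nat i * u \<in> C" unfolding i_def by (rule LeastI)
    have il: "y - of_nat j * u \<notin> C" if "j < i" for j using not_less_Least that unfolding i_def by blast
    have i1: "i \<ge> 1" using iC y by (cases i) auto
    define e where "e = y - of_nat i * u"
    have n: "e + of_nat j * u \<notin> C" if "1 \<le> j" "j \<le> i" for j
    proof -
      have "e + of_nat j * u = y - of_nat (i - j) * u" using that by (simp add: e_def algebra_simps)
      then show ?thesis using il[of "i - j"] that by simp
    qed
    have eE: "e \<in> E" using n[of 1] i1 iC by (simp add: E_def e_def)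
    moreover have "i \<le> g e" using eE n by (rule g_ge)
    moreover have "y = e + of_nat i * u" by (simp add: e_def)
    ultimately show "y \<in> (\<Union>e\<in>E. (\<lambda>i. e + of_nat i * u) ` {1..g e})"
      using i1 by (intro UN_I[of e] image_eqI[of _ _ i]) auto
  qed
  have "card (- C) \<le> (\<Sum>e\<in>E. card ((\<lambda>i. e + of_nat i * u) ` {1..g e}))"
    using card_mono[OF _ cover] card_UN_le[of E "\<lambda>e. (\<lambda>i. e + of_nat i * u) ` {1..g e}"] by simp
  also have "\<dots> \<le> (\<Sum>e\<in>E. g e)"
    by (intro sum_mono order_trans[OF card_image_le]) auto
  finally have sum_g: "CARD('p) - card C \<le> (\<Sum>e\<in>E. g e)" by (simp add: card_compl)
  have "card D = card C + card E"
  proof -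
    have "{0, u} + C = D" using pairD[of 0 u] uv by simp
    then have "card D = card (C + {0, u})" by (simp add: add.commute)
    moreover have "(u +o C) - C = (+) u ` E"
      by (auto simp: E_def mem_translate_iff image_iff) (metis add.commute diff_add_cancel)+
    ultimately show ?thesis by (simp add: card_plus_pair card_image)
  qed
  then have cE: "card E = 3" using cD rigid[OF uv(1)] pairD[of 0 u] uv by (simp add: add.commute)
  define w where "w = u - v"
  have w0: "w \<noteq> 0" "2 * w \<noteq> 0" "3 * w \<noteq> 0" using uv numeral_ne_0[OF p] by (auto simp: w_def)
  have inD: "e + u \<in> D" if "e \<in> C" for e using that by (simp add: D mem_translate_iff)
  have step: "e + w \<in> E \<and> g e - 1 \<le> g (e + w)" if e: "e \<in> E" "g e \<ge> 2" for e
  proof -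
    have "e + w \<in> C" using two[OF inD, of e] e by (auto simp: E_def w_def algebra_simps)
    moreover have n: "e + w + of_nat i * u \<notin> C" if "1 \<le> i" "i \<le> g e - 1" for i
    proof -
      define y where "y = e + of_nat (i + 1) * u"
      have "y \<notin> C" unfolding y_def using that by (intro gn) auto
      moreover have "y - u = e + of_nat i * u" by (simp add: y_def algebra_simps)
      then have "y - u \<notin> C" using gn[of i e] that by simp
      ultimately have "y \<notin> D" using two by blast
      then have "y - v \<notin> C" by (auto simp: D mem_translate_iff)
      then show ?thesis by (simp add: y_def w_def algebra_simps)
    qed
    ultimately have "e + w \<in> E" using n[of 1] e by (simp add: E_def)
    moreover have "g e - 1 \<le> g (e + w)" using \<open>e + w \<in> E\<close> n by (rule g_ge)
    ultimately show ?thesis by blast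
  qed
  have fE: "finite E" by simp
  have ww: "w + w \<noteq> 0" "w + (w + w) \<noteq> 0"
  proof -
    have "3 * w = (1 + 2) * w" by simp
    also have "\<dots> = w + (w + w)" by (simp only: distrib_right mult_1_left mult_2)
    finally show "w + (w + w) \<noteq> 0" using w0(3) by metis
    show "w + w \<noteq> 0" using w0(2) mult_2[of w] by metis
  qed
  have distinct3: "e \<noteq> e + w" "e \<noteq> e + w + w" "e + w \<noteq> e + w + w" for e
    using w0(1) ww by (metis add_cancel_right_right add.assoc)+
  have E3: "E = {e, e + w, e + w + w}" if "e \<in> E" "e + w \<in> E" "e + w + w \<in> E" for e
    using that distinct3[of e] cE by (intro card_seteq[symmetric]) auto
  have "\<exists>e\<in>E. g e \<le> 1"
  proof (rule ccontr)
    assume "\<not> ?thesis"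
    then have all: "e + w \<in> E" if "e \<in> E" for e using step[of e] that by force
    obtain e where e: "e \<in> E" using cE by fastforce
    have "E = {e, e + w, e + w + w}" using E3 all e by blast
    then have "e + w + w + w \<in> {e, e + w, e + w + w}" using all e by blast
    then consider "e + (w + (w + w)) = e" | "(e + w) + (w + w) = e + w" | "(e + w + w) + w = e + w + w"
      by (auto simp only: add.assoc insert_iff empty_iff)
    then show False using w0(1) ww by (metis add_cancel_left_right)
  qed
  then obtain es where es: "es \<in> E" "g es \<le> 1" by blast
  have "Max (g ` E) \<in> g ` E" using es by (intro Max_in) auto
  then obtain e where e: "e \<in> E" "g e = Max (g ` E)" by auto
  then have emax: "g e' \<le> g e" if "e' \<in> E" for e' using that by simp
  \<comment> \<open>The three gap lengths sum to at least six and one of them is at most 1, so the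
    longest is at least 3.\<close>
  have "(\<Sum>e\<in>E. g e) = g es + (\<Sum>e\<in>E - {es}. g e)" using fE es by (simp add: sum.remove)
  also have "\<dots> \<le> 1 + (\<Sum>e'\<in>E - {es}. g e)" using es emax by (intro add_mono sum_mono) auto
  also have "\<dots> = 1 + 2 * g e" using cE es by (simp add: card_Diff_singleton)
  finally have "g e \<ge> 3" using sum_g pc by linarith
  then have e1: "e + w \<in> E" "g e \<le> g (e + w) + 1" using step[of e] e by auto
  then have e2: "e + w + w \<in> E" "g (e + w) \<le> g (e + w + w) + 1" using step[of "e + w"] \<open>g e \<ge> 3\<close> by auto
  note EE = E3[OF e(1) e1(1) e2(1)]
  have "g (e + w + w) \<le> 1"
    using es EE \<open>g e \<ge> 3\<close> e1(2) by auto
  then have gs: "g (e + w + w) = 1" "g (e + w) \<le> 2" "g e \<le> 3" using g1[OF e2(1)] e1 e2 by auto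
  have "(\<Sum>e\<in>E. g e) = g e + (g (e + w) + g (e + w + w))"
    unfolding EE using distinct3[of e] by simp
  then have six: "CARD('p) = card C + 6" using sum_g gs pc by linarith
  \<comment> \<open>The reflection \<open>y \<mapsto> K - y\<close> sends the gaps after
    \<open>e\<close>, \<open>e + w\<close> and \<open>e + w + w\<close> into
    \<open>{m0 + m0, m0 + m1, m1 + m1}\<close>, \<open>{m0 + m2, m1 + m2}\<close> and
    \<open>{m2 + m2}\<close>.\<close>
  define K where "K = e + 3 * u + 2 * m0"
  have "(\<lambda>y. K - y) ` (- C) \<subseteq> M + M"
  proof
    fix z assume "z \<in> (\<lambda>y. K - y) ` (- C)"
    then obtain y where y: "y \<notin> C" "z = K - y" by auto
    then have "y \<in> (\<Union>e\<in>E. (\<lambda>i. e + of_nat i * u) ` {1..g e})" using cover by blast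
    then obtain f i where f: "f \<in> E" "1 \<le> i" "i \<le> g f" "y = f + of_nat i * u" by auto
    have "(f = e \<and> (i = 1 \<or> i = 2 \<or> i = 3)) \<or> (f = e + w \<and> (i = 1 \<or> i = 2)) \<or> (f = e + w + w \<and> i = 1)"
      using f gs unfolding EE by auto
    then have "z \<in> {m0 + m0, m1 + m1, m2 + m2, m0 + m1, m0 + m2, m1 + m2}"
      unfolding y(2) f(4) K_def by (auto simp: w_def u_def v_def algebra_simps)
    then show "z \<in> M + M" unfolding m by (auto simp: plus_mem_iff)
  qed
  moreover have c6: "card ((\<lambda>y. K - y) ` (- C)) = 6"
    using six by (subst card_image) (auto simp: inj_on_def card_compl)
  moreover have "card (M + M) \<le> 6"
  proof -
    have "M + M = set [m0 + m0, m1 + m1, m2 + m2, m0 + m1, m0 + m2, m1 + m2]"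
      unfolding m by (auto simp: plus_mem_iff add.commute)
    then have "card (M + M) \<le> length [m0 + m0, m1 + m1, m2 + m2, m0 + m1, m0 + m2, m1 + m2]"
      by (metis card_length)
    then show ?thesis by simp
  qed
  ultimately have "(\<lambda>y. K - y) ` (- C) = M + M" by (intro card_seteq) auto
  moreover have "(\<lambda>y. K - y) ` (- C) = K +o (uminus ` (- C))"
    by (auto simp: translate_eq_image image_image)
  ultimately show ?thesis using six c6 by metis
qed

text \<open>A sumset of the full size 6 excludes every coincidence \<open>x + y = z + z\<close> with
  distinct summands; \<open>x - y = y - x\<close> is excluded because 2 is invertible.\<close>

lemma six_differences:
  fixes A :: "'p::prime_card mod_ring set"
  assumes "card A = 3" "card (A + A) = 6" and p: "5 < CARD('p)"
  shows "card {x - y | x y. x \<in> A \<and> y \<in> A \<and> x \<noteq> y} = 6"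
proof -
  obtain a b c where A: "A = {a, b, c}" "a \<noteq> b" "a \<noteq> c" "b \<noteq> c"
    using assms(1) by (auto simp: card_3_iff)
  let ?l = "[a + a, b + b, c + c, a + b, a + c, b + c]"
  have "A + A = set ?l" unfolding A by (auto simp: plus_mem_iff add.commute)
  then have d: "distinct ?l" using assms(2) by (intro card_distinct) simp
  have two: "x + x = y + y \<longleftrightarrow> x = y" for x y :: "'p mod_ring"
    using numeral_ne_0(1)[OF p] by (metis mult_2 mult_left_cancel)
  have ne: "a - b \<noteq> b - a" "a - c \<noteq> c - a" "b - c \<noteq> c - b"
    using two A by (metis diff_add_cancel diff_add_eq)+
  have ne2: "a - b \<noteq> c - a" "b - a \<noteq> a - c" "a - b \<noteq> b - c" "b - a \<noteq> c - b" "a - c \<noteq> c - b" "c - a \<noteq> b - c"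
    using d by (auto simp: algebra_simps)
  have "{x - y | x y. x \<in> A \<and> y \<in> A \<and> x \<noteq> y} = {a - b, b - a, a - c, c - a, b - c, c - b}"
    using A by auto
  also have "card \<dots> = 6" using A ne ne2 by auto
  finally show ?thesis .
qed

text \<open>Double counting: an element \<open>x\<close> of the overlap for \<open>q\<close> yields
  the ordered pair \<open>(x, x - q)\<close> of distinct elements of \<open>D\<close>, and the pair
  determines \<open>q\<close>.\<close>

lemma sum_card_self_overlap:
  fixes D :: "'p::prime_card mod_ring set"
  assumes "0 \<notin> Q"
  shows "(\<Sum>q\<in>Q. card (D \<inter> (q +o D))) \<le> card D * card D - card D"
proof -
  have "(\<Sum>q\<in>Q. card (D \<inter> (q +o D))) = card (Sigma Q (\<lambda>q. D \<inter> (q +o D)))"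
    by simp
  also have "\<dots> = card ((\<lambda>(q, x). (x, x - q)) ` Sigma Q (\<lambda>q. D \<inter> (q +o D)))"
    by (subst card_image) (auto simp: inj_on_def)
  also have "\<dots> \<le> card (D \<times> D - (\<lambda>x. (x, x)) ` D)"
    using assms by (intro card_mono) (auto simp: mem_translate_iff)
  also have "\<dots> = card D * card D - card D"
    by (subst card_Diff_subset) (auto simp: card_cartesian_product card_image inj_on_def)
  finally show ?thesis .
qed

text \<open>For distinct \<open>x\<close>, \<open>y\<close> in \<open>A\<close>, the overlap of
  \<open>D\<close> with its translate by \<open>x - y\<close> contains a translate of
  \<open>A\<close> and, having at most three elements, equals it. Without a common difference the
  twelve differences of \<open>A\<close> and \<open>B\<close> would give overlaps of total size 36,
  more than the \<open>6 * 5\<close> ordered pairs in \<open>D\<close>. A common difference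
  identifies a translate of \<open>A\<close> with one of \<open>B\<close>.\<close>

lemma translate_of_equal_doubles:
  fixes A B D :: "'p::prime_card mod_ring set"
  assumes p: "5 < CARD('p)" and A: "card A = 3" "A + A = k +o D" and B: "card B = 3" "B + B = k' +o D"
    and D: "card D = 6" "\<And>q. q \<noteq> 0 \<Longrightarrow> card (D \<inter> (q +o D)) \<le> 3"
  shows "\<exists>x. B = x +o A"
proof -
  have cap: "D \<inter> ((x - y) +o D) = (x - k) +o A"
    if "card A = 3" "A + A = k +o D" "x \<in> A" "y \<in> A" "x \<noteq> y" for A k x y
  proof (rule card_seteq[symmetric])
    have D': "x' + a - k \<in> D" if "a \<in> A" "x' \<in> A" for a x' using that \<open>A + A = k +o D\<close>
      by (metis set_plus_intro mem_translate_iff)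
    show "(x - k) +o A \<subseteq> D \<inter> ((x - y) +o D)"
    proof
      fix z assume "z \<in> (x - k) +o A"
      then obtain a where a: "a \<in> A" "z = x - k + a" by (auto simp: elt_set_plus_def)
      then have "z = x + a - k" "z - (x - y) = y + a - k" by (simp_all add: algebra_simps)
      then show "z \<in> D \<inter> ((x - y) +o D)"
        using D'[OF a(1) \<open>x \<in> A\<close>] D'[OF a(1) \<open>y \<in> A\<close>] by (simp only: Int_iff mem_translate_iff)
    qed
    show "card (D \<inter> ((x - y) +o D)) \<le> card ((x - k) +o A)" using D(2)[of "x - y"] that by simp
  qed simp
  define diffs where "diffs A = {x - y | x y. x \<in> A \<and> y \<in> A \<and> x \<noteq> y}" for A :: "'p mod_ring set"
  have c6: "card (diffs A) = 6" "card (diffs B) = 6"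
    unfolding diffs_def using A B D p by (auto intro!: six_differences)
  have "diffs A \<inter> diffs B \<noteq> {}"
  proof
    assume dis: "diffs A \<inter> diffs B = {}"
    have "3 * card (diffs A \<union> diffs B) = (\<Sum>q\<in>diffs A \<union> diffs B. 3)" by simp
    also have "\<dots> = (\<Sum>q\<in>diffs A \<union> diffs B. card (D \<inter> (q +o D)))"
    proof (intro sum.cong refl)
      fix q assume "q \<in> diffs A \<union> diffs B"
      then show "3 = card (D \<inter> (q +o D))"
        using cap[OF A] cap[OF B] A B by (auto simp: diffs_def)
    qed
    also have "\<dots> \<le> card D * card D - card D"
      by (intro sum_card_self_overlap) (auto simp: diffs_def)
    finally have "3 * card (diffs A \<union> diffs B) \<le> 30" using D by simp
    then show False using c6 dis by (simp add: card_Un_disjoint)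
  qed
  then obtain x y x' y' where xy: "x \<in> A" "y \<in> A" "x \<noteq> y" "x' \<in> B" "y' \<in> B" "x' \<noteq> y'" "x - y = x' - y'"
    by (auto simp: diffs_def)
  have "(x - k) +o A = (x' - k') +o B" using cap[OF A xy(1-3)] cap[OF B xy(4-6)] xy(7) by simp
  then have "(- (x' - k')) +o ((x - k) +o A) = B" by (simp add: set_plus_rearrange2)
  then show ?thesis by (metis set_plus_rearrange2)
qed

text \<open>Read in the six-element negated complement \<open>D\<close>, the rigidity of
  \<open>C\<close> says that \<open>D\<close> meets each of its nonzero translates in at most
  \<open>6 - 3\<close> elements.\<close>

lemma rigid_triples_translates:
  fixes A B C :: "'p::prime_card mod_ring set"
  assumes C: "C \<noteq> {}" and p: "5 < CARD('p)"
    and rigid: "\<And>d. d \<noteq> 0 \<Longrightarrow> card (C + {0, d}) \<ge> card C + 3"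
    and pc: "card C + 6 \<le> CARD('p)"
    and A: "card A = 3" "card (A + C) \<le> card C + 3" and B: "card B = 3" "card (B + C) \<le> card C + 3"
  shows "\<exists>x. B = x +o A"
proof -
  define D where "D = uminus ` (- C)"
  obtain k where six: "card C + 6 = CARD('p)" and k: "A + A = k +o D"
    using rigid_triple[OF C p rigid A pc] by (auto simp: D_def)
  obtain k' where k': "B + B = k' +o D"
    using rigid_triple[OF C p rigid B pc] by (auto simp: D_def)
  have "card D = 6" using six by (simp add: D_def card_image card_compl)
  moreover have "card (D \<inter> (q +o D)) \<le> 3" if "q \<noteq> 0" for q
  proof -
    have "D \<inter> (q +o D) = uminus ` (- (C \<union> ((- q) +o C)))"
      by (auto simp: D_def mem_translate_iff mem_uminus_image_iff add.commute)
    then have "card (D \<inter> (q +o D)) = card (- (C \<union> ((- q) +o C)))"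
      by (simp add: card_image)
    then have "card (D \<inter> (q +o D)) = CARD('p) - card (C \<union> ((- q) +o C))"
      by (metis card_compl)
    then show ?thesis using rigid[of "- q"] that six by (simp add: plus_pair)
  qed
  ultimately show ?thesis using translate_of_equal_doubles[OF p A(1) k B(1) k'] by blast
qed

section \<open>Critical triples\<close>

text \<open>Apart from the size conditions the notion is symmetric, so each set can take the third
  place. Since \<open>A + C\<close> avoids the negatives of \<open>B\<close>, it has at most
  \<open>card A + card C\<close> elements, one more than the Cauchy--Davenport bound.\<close>

definition crit :: "'p::prime_card mod_ring set \<Rightarrow> 'p mod_ring set \<Rightarrow> 'p mod_ring set \<Rightarrow> bool" where
  "crit A B C \<longleftrightarrow> 3 \<le> card A \<and> 3 \<le> card B \<and> card A + card B + card C = CARD('p) \<and>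
     (\<forall>a\<in>A. \<forall>b\<in>B. \<forall>c\<in>C. a + b + c \<noteq> 0)"

lemma crit_commute: "crit A B C \<Longrightarrow> crit B A C"
  unfolding crit_def by (metis add.commute)

lemma crit_rotate:
  assumes "crit A B C" "3 \<le> card C" shows "crit B C A"
proof -
  have "b + c + a \<noteq> 0" if "a \<in> A" "b \<in> B" "c \<in> C" for a b c
    using assms(1) that unfolding crit_def by (metis add.commute add.left_commute)
  then show ?thesis using assms unfolding crit_def by simp
qed

lemma crit_plus:
  assumes "crit A B (C :: 'p::prime_card mod_ring set)"
  shows "uminus ` B \<subseteq> - (A + C)" "card (A + C) \<le> card A + card C"
proof -
  show s: "uminus ` B \<subseteq> - (A + C)"
  proof
    fix y assume "y \<in> uminus ` B"
    then have y: "- y \<in> B" by (simp add: mem_uminus_image_iff)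
    have "y \<notin> A + C"
    proof
      assume "y \<in> A + C"
      then obtain a c where ac: "a \<in> A" "c \<in> C" "y = a + c" by (auto simp: plus_mem_iff)
      then have "a + (- y) + c = 0" by simp
      then show False using assms ac y unfolding crit_def by blast
    qed
    then show "y \<in> - (A + C)" by simp
  qed
  have "card (uminus ` B) \<le> card (- (A + C))" using s by (intro card_mono) auto
  then have "card B \<le> CARD('p) - card (A + C)" by (simp add: card_image card_compl)
  moreover have "card A + card B + card C = CARD('p)" "3 \<le> card B" using assms by (auto simp: crit_def)
  ultimately show "card (A + C) \<le> card A + card C" by linarith
qed

lemma AP_1_compl: "AP 1 A \<Longrightarrow> AP 1 (- A)"
proof -
  assume "AP 1 A"
  then obtain s where s: "A = iv s (card A)" by (auto simp: AP_1_iff)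
  have "card A \<le> CARD('a)" using card_mono[of UNIV A] by simp
  then have "- A = iv (s + of_nat (card A)) (card (- A))"
    using compl_iv[of "card A" s] s card_compl[of A] by simp
  then show ?thesis by (auto simp: AP_1_iff)
qed

lemma AP_1_uminus_image: "AP 1 A \<Longrightarrow> AP 1 (uminus ` A)"
proof (cases "A = {}")
  case False
  assume "AP 1 A"
  then obtain s where s: "A = iv s (card A)" by (auto simp: AP_1_iff)
  have "card A \<ge> 1" using False by (simp add: Suc_le_eq card_gt_0_iff)
  then have "uminus ` A = iv (- s - of_nat (card A - 1)) (card A)"
    using s uminus_iv[of "card A" s] by metis
  moreover have "card (uminus ` A) = card A" by (simp add: card_image)
  ultimately show ?thesis unfolding AP_1_iff by metis
qed (auto simp: AP_1_iff)

lemma AP_compl: "AP d A \<Longrightarrow> AP d (- A)"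
  and AP_uminus_image: "AP d A \<Longrightarrow> AP d (uminus ` A)"
proof -
  assume A: "AP d A"
  then have d: "d \<noteq> 0" by (simp add: AP_def)
  define A' where "A' = inverse d *o A"
  have AA: "A = d *o A'" using d by (simp add: A'_def dilate_inverse)
  have A': "AP 1 A'" using AP_dilate_iff[OF d, of 1 A'] A AA by simp
  have "- A = d *o (- A')" unfolding AA using d by (auto simp: mem_dilate_iff)
  then show "AP d (- A)" using AP_1_compl[OF A'] AP_dilate_iff[OF d, of 1 "- A'"] by simp
  have "uminus ` A = d *o (uminus ` A')" unfolding AA by (simp add: dilate_eq_image image_image)
  then show "AP d (uminus ` A)" using AP_1_uminus_image[OF A'] AP_dilate_iff[OF d, of 1 "uminus ` A'"] by simp
qed

text \<open>When \<open>A + C\<close> is as large as possible, it is exactly the complement of the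
  negated \<open>B\<close>; complements and negatives of progressions keep the difference.\<close>

lemma crit_AP_third:
  assumes "crit A B (C :: 'p::prime_card mod_ring set)" "AP d (A + C)" "card (A + C) = card A + card C"
  shows "AP d B"
proof -
  have "card (uminus ` B) = card (- (A + C))"
    using assms by (auto simp: card_image card_compl crit_def)
  then have "uminus ` B = - (A + C)"
    using crit_plus(1)[OF assms(1)] by (intro card_subset_eq) auto
  then have "AP d (uminus ` B)" using AP_compl[OF assms(2)] by simp
  then have "AP d (uminus ` (uminus ` B))" by (rule AP_uminus_image)
  then show ?thesis by (simp add: image_image)
qed

lemma crit_AAP_of_interval:
  assumes cr: "crit A B (C :: 'p::prime_card mod_ring set)" and C: "AP 1 C" "card C \<ge> 3"
  shows "AAP 1 A"
proof -
  obtain s where s: "C = iv s (card C)" using C by (auto simp: AP_1_iff)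
  have A: "A \<noteq> {}" using cr by (auto simp: crit_def)
  have le: "card (A + iv s (card C)) \<le> card A + card C - 1 + 1" "1 < card C - 1"
      "card (A + iv s (card C)) < CARD('p)"
    using crit_plus(2)[OF cr] C s cr by (auto simp: crit_def)
  obtain u l where "A \<subseteq> iv u l" "l \<le> card A + 1"
    using almost_interval_of_plus_iv[OF A le] by blast
  then show ?thesis by (rule AAP_1_I)
qed

text \<open>Using only the interval part of \<open>C\<close> costs one more unit of slack, and slack
  2 demands \<open>L \<ge> 4\<close>. If the slack is exhausted, the interval alone already produces
  all of \<open>A + C\<close>, which is then an interval whose complement is the negated
  \<open>B\<close>.\<close>

lemma crit_interval_and_point_half:
  assumes cr: "crit A B (C :: 'p::prime_card mod_ring set)"
    and C: "iv s L \<subseteq> C" "card C = L + 1" "L \<ge> 4"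
  shows "AAP 1 A \<or> AP 1 B"
proof -
  have A: "A \<noteq> {}" using cr by (auto simp: crit_def)
  have cp: "card A + card B + card C = CARD('p)" "card B \<ge> 3" using cr by (auto simp: crit_def)
  have sub: "A + iv s L \<subseteq> A + C" using C by (intro set_plus_mono2) auto
  then have "card (A + iv s L) \<le> card (A + C)" by (intro card_mono) auto
  then have le: "card (A + iv s L) \<le> card A + L - 1 + 2" "2 < L - 1" "card (A + iv s L) < CARD('p)"
    using crit_plus(2)[OF cr] C cp by auto
  obtain u l where u: "A \<subseteq> iv u l" "l \<le> card A + 2" "A + iv s L = iv (u + s) (l + L - 1)"
      "l + L - 1 < CARD('p)"
    using almost_interval_of_plus_iv[OF A le] by blast
  show ?thesis
  proof (cases "l \<le> card A + 1")
    case True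
    then show ?thesis using u AAP_1_I by blast
  next
    case False
    then have l: "l = card A + 2" using u by simp
    then have c: "card (A + iv s L) = card A + card C" using u C by simp
    then have "A + iv s L = A + C" using sub crit_plus(2)[OF cr] by (intro card_seteq) auto
    moreover have "AP 1 (A + iv s L)" unfolding u(3) AP_1_iff using u(4) by (intro exI) simp
    ultimately show ?thesis using crit_AP_third[OF cr] c by auto
  qed
qed

lemma crit_interval_and_point:
  assumes cr: "crit A B (C :: 'p::prime_card mod_ring set)"
    and C: "iv s L \<subseteq> C" "card C = L + 1" "L \<ge> 4"
  shows "AAP 1 A \<and> AAP 1 B"
proof -
  have "card C \<ge> 3" using C by simp
  then have "crit B C A" "crit A C B" using cr by (auto intro: crit_rotate crit_commute)
  then have "AP 1 A \<Longrightarrow> AAP 1 B" "AP 1 B \<Longrightarrow> AAP 1 A"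
    using crit_AAP_of_interval[of B C A] crit_AAP_of_interval[of A C B] cr by (auto simp: crit_def)
  then show ?thesis
    using crit_interval_and_point_half[OF cr C] crit_interval_and_point_half[OF crit_commute[OF cr] C]
    by blast
qed

text \<open>The negated complement \<open>iv t L\<close> of the target is an interval, and
  \<open>A + iv t L\<close> avoids the negated \<open>B\<close>. Now one summand is an interval, and
  there is no slack.\<close>

lemma AP_of_plus_subset_iv:
  fixes A B :: "'p::prime_card mod_ring set"
  assumes "A \<noteq> {}" "B \<noteq> {}" "A + B \<subseteq> iv u n" "n + 1 \<le> card A + card B" "n + 2 \<le> CARD('p)"
  shows "AP 1 A"
proof -
  define L where "L = CARD('p) - n"
  define t where "t = - (u + of_nat n) - of_nat (L - 1)"
  have K: "iv t L = uminus ` (- iv u n :: 'p mod_ring set)"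
    unfolding t_def L_def using assms by (subst compl_iv) (auto simp: uminus_iv)
  have "A + iv t L \<subseteq> - (uminus ` B)"
  proof
    fix y assume "y \<in> A + iv t L"
    then obtain a k where ak: "a \<in> A" "k \<in> iv t L" "y = a + k" by (auto simp: plus_mem_iff)
    then have nk: "- k \<notin> iv u n" unfolding K by (simp add: mem_uminus_image_iff)
    have "- y \<notin> B"
    proof
      assume "- y \<in> B"
      then have "a + (- y) \<in> iv u n" using ak assms by blast
      then show False using ak nk by simp
    qed
    then show "y \<in> - (uminus ` B)" by (simp add: mem_uminus_image_iff)
  qed
  then have "card (A + iv t L) \<le> card (- (uminus ` B))" by (intro card_mono) auto
  also have "\<dots> = CARD('p) - card B" by (simp only: card_compl) (simp add: card_image)
  finally have c: "card (A + iv t L) \<le> CARD('p) - card B" .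
  have B: "card B \<ge> 1" "card B \<le> CARD('p)" using assms card_mono[of UNIV B] by (auto simp: Suc_le_eq card_gt_0_iff)
  have le: "card (A + iv t L) \<le> card A + L - 1 + 0" "0 < L - 1" "card (A + iv t L) < CARD('p)"
    using c B assms by (auto simp: L_def)
  obtain u l where "A \<subseteq> iv u l" "l \<le> card A + 0"
    using almost_interval_of_plus_iv[OF assms(1) le] by blast
  then show ?thesis by (intro AP_1_I[of l]) auto
qed

section \<open>Sumsets inside a union of two intervals\<close>

text \<open>Discrete connectedness: a walk with steps of 1 can leave a component only through the
  element just past its end, which is missing from the union.\<close>

lemma iv_subset_two_intervals:
  assumes sub: "iv s l \<subseteq> iv u n \<union> iv v k" and l: "l \<ge> 1"
    and e: "u + of_nat n \<notin> iv u n \<union> iv v k" "v + of_nat k \<notin> iv u n \<union> iv v k"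
  shows "iv s l \<subseteq> iv u n \<or> iv s l \<subseteq> iv v k"
proof -
  have *: "iv s l \<subseteq> iv u n" if "s \<in> iv u n" "iv s l \<subseteq> iv u n \<union> iv v k"
    "u + of_nat n \<notin> iv u n \<union> iv v k" for u v n k
  proof -
    have "i < l \<longrightarrow> s + of_nat i \<in> iv u n" for i
    proof (induction i)
      case (Suc i)
      show ?case
      proof
        assume i: "Suc i < l"
        then have "s + of_nat i \<in> iv u n" using Suc by simp
        then obtain x where x: "x < n" "s + of_nat i = u + of_nat x" by (rule ivE)
        then have eq: "s + of_nat (Suc i) = u + of_nat (Suc x)" by (simp add: algebra_simps)
        have "s + of_nat (Suc i) \<in> iv s l" using i by (rule ivI)
        then have "s + of_nat (Suc i) \<in> iv u n \<union> iv v k" using that(2) by blast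
        then have "s + of_nat (Suc i) \<noteq> u + of_nat n" using that(3) by metis
        then have "Suc x \<noteq> n" using eq by auto
        then show "s + of_nat (Suc i) \<in> iv u n" unfolding eq using x by (intro ivI) simp
      qed
    qed (use that in simp)
    then show ?thesis by (auto simp: iv_def)
  qed
  have "s \<in> iv s l" using ivI[of 0 l s] l by simp
  then have "s \<in> iv u n \<or> s \<in> iv v k" using sub by blast
  then show ?thesis using *[of u n v k] *[of v k u n] sub e by (auto simp: Un_commute)
qed

lemma iv_subset_offset:
  assumes "iv s l \<subseteq> (iv u n :: 'p::prime_card mod_ring set)" "l \<ge> 1" "n < CARD('p)"
  obtains x where "s = u + of_nat x" "x + l \<le> n"
proof -
  have "s \<in> iv u n" using assms(1) ivI[of 0 l s] assms(2) by auto
  then obtain x where x: "x < n" "s = u + of_nat x" by (rule ivE)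
  have "x + l \<le> n"
  proof (rule ccontr)
    assume "\<not> ?thesis"
    then have "s + of_nat (n - x) \<in> iv s l" using x by (intro ivI) auto
    moreover have "s + of_nat (n - x) = u + of_nat n" using x by simp
    ultimately have "u + of_nat n \<in> iv u n" using assms(1) by auto
    then show False using assms(3) by (subst (asm) mem_iv_of_nat_iff) auto
  qed
  then show thesis using x that by blast
qed

lemma erosion:
  fixes A :: "'p::prime_card mod_ring set"
  assumes "A + iv t m \<subseteq> iv u n" "m \<ge> 1" "n < CARD('p)"
  shows "A \<subseteq> iv (u - t) (n + 1 - m)"
proof
  fix a assume a: "a \<in> A"
  then have "iv (a + t) m \<subseteq> iv u n"
    using assms(1) unfolding translate_iv[symmetric] by (auto simp: elt_set_plus_def)
  then obtain x where "a + t = u + of_nat x" "x + m \<le> n"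
    using iv_subset_offset assms by blast
  then have "a = u - t + of_nat x" "x < n + 1 - m" by (auto simp: algebra_simps)
  then show "a \<in> iv (u - t) (n + 1 - m)" by auto
qed

lemma card_le_erosion:
  fixes A :: "'p::prime_card mod_ring set"
  assumes "A + iv t m \<subseteq> iv u n" "m \<ge> 1" "n < CARD('p)" "A \<noteq> {}"
  shows "card A + m \<le> n + 1"
proof -
  have A: "A \<subseteq> iv (u - t) (n + 1 - m)" using assms by (intro erosion)
  then have "n + 1 - m \<noteq> 0" using assms(4) by auto
  moreover have "card A \<le> n + 1 - m"
    using card_mono[OF _ A] card_iv_le[of "u - t" "n + 1 - m"] by simp
  ultimately show ?thesis by linarith
qed

text \<open>Sort the elements of \<open>B\<close> by the component that receives the translated
  interval. If both classes are nonempty, \<open>card_le_erosion\<close> gives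
  \<open>card B + 2 * a \<le> n + k + 2\<close>, against \<open>n + k = a + card B\<close> and
  \<open>a \<ge> 3\<close>. Otherwise the sumset lies in a single interval.\<close>

lemma interval_plus_subset_two_intervals:
  fixes B :: "'p::prime_card mod_ring set"
  assumes A: "iv s a + B \<subseteq> iv u n \<union> iv v k" "a \<ge> 3" "card B \<ge> 3" "a < CARD('p)"
    and e: "u + of_nat n \<notin> iv u n \<union> iv v k" "v + of_nat k \<notin> iv u n \<union> iv v k"
    and nk: "n + k = a + card B" "n \<ge> 1" "k \<ge> 1" "n + k + 1 \<le> CARD('p)"
  shows "AP 1 B"
proof -
  define B1 where "B1 = {b \<in> B. iv (s + b) a \<subseteq> iv u n}"
  define B2 where "B2 = {b \<in> B. iv (s + b) a \<subseteq> iv v k}"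
  have B: "B = B1 \<union> B2"
  proof -
    have "iv (s + b) a \<subseteq> iv u n \<or> iv (s + b) a \<subseteq> iv v k" if "b \<in> B" for b
    proof (rule iv_subset_two_intervals[OF _ _ e])
      have "iv (s + b) a = b +o iv s a" by (simp add: translate_iv add.commute)
      also have "\<dots> \<subseteq> iv s a + B" using that by (rule set_plus_mono4)
      finally show "iv (s + b) a \<subseteq> iv u n \<union> iv v k" using A by blast
    qed (use A in simp)
    then show ?thesis by (auto simp: B1_def B2_def)
  qed
  have sub: "B1 + iv s a \<subseteq> iv u n" "B2 + iv s a \<subseteq> iv v k"
  proof -
    have "B' + iv s a \<subseteq> J" if "\<forall>b\<in>B'. iv (s + b) a \<subseteq> J" for B' J
    proof
      fix y assume "y \<in> B' + iv s a"
      then obtain b x where b: "b \<in> B'" "x \<in> iv s a" "y = b + x" by (auto simp: plus_mem_iff)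
      then obtain i where "i < a" "x = s + of_nat i" by (auto elim: ivE)
      then have "y = (s + b) + of_nat i" "i < a" using b by (simp_all add: algebra_simps)
      then have "y \<in> iv (s + b) a" by (simp only: ivI)
      then show "y \<in> J" using that b by blast
    qed
    then show "B1 + iv s a \<subseteq> iv u n" "B2 + iv s a \<subseteq> iv v k" by (simp_all add: B1_def B2_def)
  qed
  consider "B1 = {}" | "B2 = {}" | "B1 \<noteq> {}" "B2 \<noteq> {}" by blast
  then show ?thesis
  proof cases
    case 1
    then show ?thesis using sub B A nk by (intro AP_of_plus_subset_iv[of B "iv s a" v k]) auto
  next
    case 2
    then show ?thesis using sub B A nk by (intro AP_of_plus_subset_iv[of B "iv s a" u n]) auto
  next
    case 3
    have "card B1 + a \<le> n + 1" "card B2 + a \<le> k + 1"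
      using card_le_erosion[OF sub(1)] card_le_erosion[OF sub(2)] 3 A nk by auto
    moreover have "card B \<le> card B1 + card B2" unfolding B by (rule card_Un_le)
    ultimately show ?thesis using nk A by linarith
  qed
qed

text \<open>
  The four sums of a component of \<open>A\<close> and a component of \<open>B\<close> are intervals, each inside one of
  the two components of the target. If exactly one of them is alone in its component, that
  component is a singleton up to one; if two opposite ones share a component, halving merges the
  two components of \<open>A\<close>.
\<close>
lemma two_by_two_odd_one:
  fixes A B :: "'p::prime_card mod_ring set"
  assumes A: "A = iv s1 l1 \<union> iv s2 l2" "l1 \<ge> 1" "l2 \<ge> 1" "card A = l1 + l2"
    and B: "B = iv t1 m1 \<union> iv t2 m2" "m1 \<ge> 1" "m2 \<ge> 1" "card B = m1 + m2"
    and nk: "n + k = card A + card B" "n < CARD('p)" "k < CARD('p)"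
    and sub: "iv s1 l1 + iv t1 m1 \<subseteq> iv u n" "iv s1 l1 + iv t2 m2 \<subseteq> iv u n"
      "iv s2 l2 + iv t1 m1 \<subseteq> iv u n" "iv s2 l2 + iv t2 m2 \<subseteq> iv v k"
  shows "AAP 1 A \<and> AAP 1 B"
proof -
  have "card (iv s2 l2 :: 'p mod_ring set) + m2 \<le> k + 1" "l2 \<le> CARD('p)"
    using card_le_erosion[OF sub(4)] A B nk card_mono[of UNIV A] by auto
  then have k: "l2 + m2 \<le> k + 1" by simp
  have "A + iv t1 m1 \<subseteq> iv u n" using sub by (simp add: A(1) Un_set_plus)
  then have "A \<subseteq> iv (u - t1) (n + 1 - m1)" using B nk by (intro erosion)
  moreover have "n + 1 - m1 \<le> card A + 1" using k nk A B by linarith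
  moreover have "iv s1 l1 + B \<subseteq> iv u n" using sub by (simp add: B(1) set_plus_Un)
  then have "B + iv s1 l1 \<subseteq> iv u n" by (simp add: add.commute)
  then have "B \<subseteq> iv (u - s1) (n + 1 - l1)" using A nk by (intro erosion)
  moreover have "n + 1 - l1 \<le> card B + 1" using k nk A B by linarith
  ultimately show ?thesis using AAP_1_I by blast
qed

lemma two_by_two_alternating:
  fixes A B :: "'p::prime_card mod_ring set"
  assumes A: "A = iv s1 l1 \<union> iv s2 l2" "l1 \<ge> 1" "l2 \<ge> 1" "card A = l1 + l2"
    and B: "m1 \<ge> 1" "m2 \<ge> 1"
    and nk: "n + k = l1 + l2 + m1 + m2" "n < CARD('p)" "k < CARD('p)"
    and sub: "iv s1 l1 + iv t1 m1 \<subseteq> iv u n" "iv s2 l2 + iv t2 m2 \<subseteq> iv u n"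
      "iv s1 l1 + iv t2 m2 \<subseteq> iv v k" "iv s2 l2 + iv t1 m1 \<subseteq> iv v k"
    and two: "(2 :: 'p mod_ring) \<noteq> 0"
  shows "AAP (inverse 2) A"
proof -
  note sub' = sub[unfolded iv_plus_iv[OF A(2) B(1)] iv_plus_iv[OF A(3) B(2)]
    iv_plus_iv[OF A(2) B(2)] iv_plus_iv[OF A(3) B(1)]]
  obtain x where x: "s1 + t1 = u + of_nat x" "x + (l1 + m1 - 1) \<le> n"
    by (rule iv_subset_offset[OF sub'(1)]) (use A B nk in auto)
  obtain y where y: "s2 + t2 = u + of_nat y" "y + (l2 + m2 - 1) \<le> n"
    by (rule iv_subset_offset[OF sub'(2)]) (use A B nk in auto)
  obtain z where z: "s1 + t2 = v + of_nat z" "z + (l1 + m2 - 1) \<le> k"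
    by (rule iv_subset_offset[OF sub'(3)]) (use A B nk in auto)
  obtain w where w: "s2 + t1 = v + of_nat w" "w + (l2 + m1 - 1) \<le> k"
    by (rule iv_subset_offset[OF sub'(4)]) (use A B nk in auto)
  \<comment> \<open>The doubled components of \<open>A\<close> are offset by \<open>o1\<close>,
    because \<open>2 * (s2 - s1)\<close> is a signed sum of the four starting points of the
    sums.\<close>
  define o1 where "o1 = int y + int w - int x - int z"
  have "2 * s2 - 2 * s1 = (s2 + t2) + (s2 + t1) - (s1 + t1) - (s1 + t2)" by (simp add: algebra_simps)
  also have "\<dots> = of_int o1" unfolding x(1) y(1) z(1) w(1) by (simp add: o1_def)
  finally have s2: "2 * s2 = 2 * s1 + of_int o1" by (simp add: algebra_simps)
  have bounds: "int x + int z + int l1 \<le> int l2 + 2" "int y + int w + int l2 \<le> int l1 + 2"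
    using x y z w nk A B by linarith+
  \<comment> \<open>By \<open>bounds\<close>, both doubled components stay within
    \<open>card A\<close> steps of the lower of their two starting points.\<close>
  define base where "base = 2 * s1 + of_int (min 0 o1)"
  have mem: "2 * s1 + of_int c \<in> iv base (card A + 1)"
    if "min 0 o1 \<le> c" "c - min 0 o1 \<le> int (card A)" for c
  proof -
    have "2 * s1 + of_int c = base + of_nat (nat (c - min 0 o1))" using that by (simp add: base_def)
    moreover have "nat (c - min 0 o1) < card A + 1" using that by linarith
    ultimately show ?thesis by (metis ivI)
  qed
  have "2 *o A \<subseteq> iv base (card A + 1)"
  proof
    fix a assume "a \<in> 2 *o A"
    then consider i where "i < l1" "a = 2 * (s1 + of_nat i)" | i where "i < l2" "a = 2 * (s2 + of_nat i)"
      unfolding A(1) dilate_eq_image by (auto elim!: ivE)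
    then show "a \<in> iv base (card A + 1)"
    proof cases
      case 1
      have "a = 2 * s1 + of_int (2 * int i)" unfolding 1 by (simp add: algebra_simps)
      moreover have "min 0 o1 \<le> 2 * int i" "2 * int i - min 0 o1 \<le> int (card A)"
        using 1 bounds unfolding o1_def A(4) by linarith+
      ultimately show ?thesis using mem by metis
    next
      case 2
      have "a = 2 * s1 + of_int (o1 + 2 * int i)" unfolding 2 distrib_left s2 by (simp add: algebra_simps)
      moreover have "min 0 o1 \<le> o1 + 2 * int i" "o1 + 2 * int i - min 0 o1 \<le> int (card A)"
        using 2 bounds unfolding o1_def A(4) by linarith+
      ultimately show ?thesis using mem by metis
    qed
  qed
  then have "AAP 1 (2 *o A)" using two by (intro AAP_1_I) auto
  then show ?thesis using AAP_dilate_iff[OF two, of "inverse 2" A] two by simp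
qed

lemma plus_subset_two_intervals:
  fixes A B :: "'p::prime_card mod_ring set"
  assumes A: "card A \<ge> 3" "card (ends A) \<le> 2" and B: "card B \<ge> 3" "card (ends B) \<le> 2"
    and AB: "A + B \<subseteq> iv u n \<union> iv v k"
    and e: "u + of_nat n \<notin> iv u n \<union> iv v k" "v + of_nat k \<notin> iv u n \<union> iv v k"
    and nk: "n + k = card A + card B" "n \<ge> 1" "k \<ge> 1" "n + k + 1 \<le> CARD('p)"
  shows "AAP 1 A \<and> AAP 1 B \<or> AAP (inverse 2) A \<and> AAP (inverse 2) B"
proof -
  have np: "n < CARD('p)" "k < CARD('p)" using nk by auto
  have ne: "A \<noteq> {}" "B \<noteq> {}" using A B by auto
  have p5: "5 < CARD('p)" using A B nk by linarith
  note two = numeral_ne_0(1)[OF p5]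
  consider "AP 1 A" | "AP 1 B" | "\<not> AP 1 A" "\<not> AP 1 B" by blast
  then show ?thesis
  proof cases
    case 1
    then obtain s where s: "A = iv s (card A)" by (auto simp: AP_1_iff)
    have "iv s (card A) + B \<subseteq> iv u n \<union> iv v k" using AB unfolding s[symmetric] .
    then have "AP 1 B"
      by (rule interval_plus_subset_two_intervals[OF _ A(1) B(1) _ e nk]) (use nk in simp)
    then show ?thesis using 1 AP_imp_AAP by blast
  next
    case 2
    then obtain s where s: "B = iv s (card B)" by (auto simp: AP_1_iff)
    have "iv s (card B) + A \<subseteq> iv u n \<union> iv v k"
      using AB unfolding s[symmetric] by (simp add: add.commute)
    then have "AP 1 A"
      by (rule interval_plus_subset_two_intervals[OF _ B(1) A(1) _ e _ nk(2,3,4)]) (use nk in simp_all)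
    then show ?thesis using 2 AP_imp_AAP by blast
  next
    case 3
    obtain s1 l1 s2 l2 where As: "A = iv s1 l1 \<union> iv s2 l2" "l1 \<ge> 1" "l2 \<ge> 1" "card A = l1 + l2"
      using two_intervals_of_two_ends[OF ne(1) _ A(2)] 3 nk B by auto
    obtain t1 m1 t2 m2 where Bs: "B = iv t1 m1 \<union> iv t2 m2" "m1 \<ge> 1" "m2 \<ge> 1" "card B = m1 + m2"
      using two_intervals_of_two_ends[OF ne(2) _ B(2)] 3 nk A by auto
    have As': "A = iv s2 l2 \<union> iv s1 l1" "card A = l2 + l1" using As by auto
    have Bs': "B = iv t2 m2 \<union> iv t1 m1" "card B = m2 + m1" using Bs by auto
    have sums: "A + B = (iv s1 l1 + iv t1 m1) \<union> (iv s1 l1 + iv t2 m2) \<union> (iv s2 l2 + iv t1 m1) \<union> (iv s2 l2 + iv t2 m2)"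
      unfolding As Bs by (simp add: Un_set_plus set_plus_Un Un_assoc Un_left_commute)
    have in_one: "iv s l + iv t m \<subseteq> iv u n \<or> iv s l + iv t m \<subseteq> iv v k"
      if "l \<ge> 1" "m \<ge> 1" "iv s l + iv t m \<subseteq> A + B" for s l t m
    proof -
      have "iv (s + t) (l + m - 1) \<subseteq> iv u n \<union> iv v k"
        using that(3) AB unfolding iv_plus_iv[OF that(1,2)] by (rule order_trans)
      then show ?thesis
        unfolding iv_plus_iv[OF that(1,2)] using iv_subset_two_intervals[OF _ _ e] that by auto
    qed
    \<comment> \<open>The two target components can be exchanged, so the first of the four sums is
      taken to lie in \<open>iv u n\<close>; the other three then leave eight patterns.\<close>
    have main: "AAP 1 A \<and> AAP 1 B \<or> AAP (inverse 2) A \<and> AAP (inverse 2) B"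
      if 11: "iv s1 l1 + iv t1 m1 \<subseteq> iv u n"
        and o12: "iv s1 l1 + iv t2 m2 \<subseteq> iv u n \<or> iv s1 l1 + iv t2 m2 \<subseteq> iv v k"
        and o21: "iv s2 l2 + iv t1 m1 \<subseteq> iv u n \<or> iv s2 l2 + iv t1 m1 \<subseteq> iv v k"
        and o22: "iv s2 l2 + iv t2 m2 \<subseteq> iv u n \<or> iv s2 l2 + iv t2 m2 \<subseteq> iv v k"
        and nk: "n + k = card A + card B" "n \<ge> 1" "k \<ge> 1" "n + k + 1 \<le> CARD('p)"
      for u n v k
    proof -
      have np: "n < CARD('p)" "k < CARD('p)" using nk by auto
      have kn: "k + n = card A + card B" using nk by simp
      consider
        (all) "iv s1 l1 + iv t2 m2 \<subseteq> iv u n" "iv s2 l2 + iv t1 m1 \<subseteq> iv u n" "iv s2 l2 + iv t2 m2 \<subseteq> iv u n"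
      | (odd22) "iv s1 l1 + iv t2 m2 \<subseteq> iv u n" "iv s2 l2 + iv t1 m1 \<subseteq> iv u n" "iv s2 l2 + iv t2 m2 \<subseteq> iv v k"
      | (odd21) "iv s1 l1 + iv t2 m2 \<subseteq> iv u n" "iv s2 l2 + iv t1 m1 \<subseteq> iv v k" "iv s2 l2 + iv t2 m2 \<subseteq> iv u n"
      | (odd12) "iv s1 l1 + iv t2 m2 \<subseteq> iv v k" "iv s2 l2 + iv t1 m1 \<subseteq> iv u n" "iv s2 l2 + iv t2 m2 \<subseteq> iv u n"
      | (odd11) "iv s1 l1 + iv t2 m2 \<subseteq> iv v k" "iv s2 l2 + iv t1 m1 \<subseteq> iv v k" "iv s2 l2 + iv t2 m2 \<subseteq> iv v k"
      | (rows) "iv s1 l1 + iv t2 m2 \<subseteq> iv u n" "iv s2 l2 + iv t1 m1 \<subseteq> iv v k" "iv s2 l2 + iv t2 m2 \<subseteq> iv v k"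
      | (cols) "iv s1 l1 + iv t2 m2 \<subseteq> iv v k" "iv s2 l2 + iv t1 m1 \<subseteq> iv u n" "iv s2 l2 + iv t2 m2 \<subseteq> iv v k"
      | (alt) "iv s1 l1 + iv t2 m2 \<subseteq> iv v k" "iv s2 l2 + iv t1 m1 \<subseteq> iv v k" "iv s2 l2 + iv t2 m2 \<subseteq> iv u n"
        using o12 o21 o22 by meson
      then show ?thesis
      proof cases
        case all
        then have "A + B \<subseteq> iv u n" using 11 sums by auto
        then have "AP 1 A" "AP 1 B" using ne nk
          AP_of_plus_subset_iv[of A B u n] AP_of_plus_subset_iv[of B A u n] by (auto simp: add.commute)
        then show ?thesis using 3 by blast
      next
        case odd22
        then show ?thesis using two_by_two_odd_one[OF As Bs nk(1) np 11] by blast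
      next
        case odd21
        then show ?thesis
          using two_by_two_odd_one[OF As'(1) As(3,2) As'(2) Bs'(1) Bs(3,2) Bs'(2) nk(1) np]
            two_by_two_odd_one[OF As Bs'(1) Bs(3,2) Bs'(2) nk(1) np] 11 by blast
      next
        case odd12
        then show ?thesis
          using two_by_two_odd_one[OF As'(1) As(3,2) As'(2) Bs nk(1) np]
            two_by_two_odd_one[OF As Bs'(1) Bs(3,2) Bs'(2) nk(1) np] 11 by blast
      next
        case odd11
        then show ?thesis
          using two_by_two_odd_one[OF As'(1) As(3,2) As'(2) Bs'(1) Bs(3,2) Bs'(2) kn np(2,1)] 11 by blast
      next
        \<comment> \<open>Each component of \<open>A\<close> now adds all of \<open>B\<close> inside
          its own target, so \<open>2 * card B + card A \<le> n + k + 2\<close> and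
          \<open>card B \<le> 2\<close>.\<close>
        case rows
        have "iv s1 l1 + B \<subseteq> iv u n" "iv s2 l2 + B \<subseteq> iv v k"
          using 11 rows by (simp_all add: Bs(1) set_plus_Un)
        then have "B + iv s1 l1 \<subseteq> iv u n" "B + iv s2 l2 \<subseteq> iv v k" by (simp_all add: add.commute)
        then have "card B + l1 \<le> n + 1" "card B + l2 \<le> k + 1"
          using card_le_erosion As np ne by blast+
        then show ?thesis using nk As B by linarith
      next
        case cols
        have "A + iv t1 m1 \<subseteq> iv u n" "A + iv t2 m2 \<subseteq> iv v k"
          using 11 cols by (simp_all add: As(1) Un_set_plus)
        then have "card A + m1 \<le> n + 1" "card A + m2 \<le> k + 1"
          using card_le_erosion Bs np ne by blast+
        then show ?thesis using nk Bs A by linarith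
      next
        case alt
        have nk': "n + k = l1 + l2 + m1 + m2" "n + k = m1 + m2 + l1 + l2" using nk As Bs by auto
        have "AAP (inverse 2) A"
          using two_by_two_alternating[OF As Bs(2,3) nk'(1) np 11 alt(3) alt(1,2) two] .
        moreover have "AAP (inverse 2) B"
          by (rule two_by_two_alternating[OF Bs As(2,3) nk'(2) np, of s1 u s2 v])
            (use 11 alt two in \<open>auto simp: add.commute\<close>)
        ultimately show ?thesis by blast
      qed
    qed
    have o: "iv s1 l1 + iv t1 m1 \<subseteq> iv u n \<or> iv s1 l1 + iv t1 m1 \<subseteq> iv v k"
      "iv s1 l1 + iv t2 m2 \<subseteq> iv u n \<or> iv s1 l1 + iv t2 m2 \<subseteq> iv v k"
      "iv s2 l2 + iv t1 m1 \<subseteq> iv u n \<or> iv s2 l2 + iv t1 m1 \<subseteq> iv v k"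
      "iv s2 l2 + iv t2 m2 \<subseteq> iv u n \<or> iv s2 l2 + iv t2 m2 \<subseteq> iv v k"
    proof -
      have "iv s1 l1 + iv t1 m1 \<subseteq> A + B" "iv s1 l1 + iv t2 m2 \<subseteq> A + B"
        "iv s2 l2 + iv t1 m1 \<subseteq> A + B" "iv s2 l2 + iv t2 m2 \<subseteq> A + B"
        unfolding sums by blast+
      then show "iv s1 l1 + iv t1 m1 \<subseteq> iv u n \<or> iv s1 l1 + iv t1 m1 \<subseteq> iv v k"
        "iv s1 l1 + iv t2 m2 \<subseteq> iv u n \<or> iv s1 l1 + iv t2 m2 \<subseteq> iv v k"
        "iv s2 l2 + iv t1 m1 \<subseteq> iv u n \<or> iv s2 l2 + iv t1 m1 \<subseteq> iv v k"
        "iv s2 l2 + iv t2 m2 \<subseteq> iv u n \<or> iv s2 l2 + iv t2 m2 \<subseteq> iv v k"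
        using in_one As(2,3) Bs(2,3) by simp_all
    qed
    have kn: "k + n = card A + card B" "k + n + 1 \<le> CARD('p)" using nk by auto
    show ?thesis using o(1)
    proof
      assume "iv s1 l1 + iv t1 m1 \<subseteq> iv u n"
      then show ?thesis using main o nk by blast
    next
      assume "iv s1 l1 + iv t1 m1 \<subseteq> iv v k"
      then show ?thesis using main[of v k u n] o kn nk(2,3) by blast
    qed
  qed
qed

section \<open>Critical triples whose third set has at most two components\<close>

lemma card_ends_negated_complement:
  "card (ends (- (uminus ` C))) = card (ends (C :: 'p::prime_card mod_ring set))"
proof -
  have "ends (- (uminus ` C)) = (\<lambda>e. - e - 1) ` ends C"
  proof (intro equalityI subsetI)
    fix y assume "y \<in> ends (- (uminus ` C))"
    then have "- y \<notin> C" "- y - 1 \<in> C" by (auto simp: ends_def mem_uminus_image_iff)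
    then have "- y - 1 \<in> ends C" "y = - (- y - 1) - 1" by (auto simp: ends_def)
    then show "y \<in> (\<lambda>e. - e - 1) ` ends C" by blast
  qed (auto simp: ends_def mem_uminus_image_iff add.commute)
  then show ?thesis by (simp add: card_image inj_on_def)
qed

lemma AP_1_of_negated_complement:
  assumes "AP 1 (- (uminus ` C))" shows "AP 1 C"
proof -
  have "C = uminus ` (- (- (uminus ` C)))" by (simp add: image_image)
  then show ?thesis using AP_1_uminus_image[OF AP_1_compl[OF assms]] by metis
qed

lemma subset_shift_iv:
  fixes A :: "'p::prime_card mod_ring set"
  assumes "A \<subseteq> iv s (k + 2)" "k + 4 \<le> CARD('p)"
  shows "(\<And>a. a \<in> A \<Longrightarrow> a + 2 \<in> iv s (k + 2)) \<Longrightarrow> A \<subseteq> iv s k"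
    "(\<And>a. a \<in> A \<Longrightarrow> a - 2 \<in> iv s (k + 2)) \<Longrightarrow> A \<subseteq> iv (s + 2) k"
proof -
  assume *: "\<And>a. a \<in> A \<Longrightarrow> a + 2 \<in> iv s (k + 2)"
  show "A \<subseteq> iv s k"
  proof
    fix a assume a: "a \<in> A"
    then obtain i where i: "i < k + 2" "a = s + of_nat i" using assms by (auto elim: ivE)
    have "s + of_nat (i + 2) \<in> iv s (k + 2)" using *[OF a] i by (simp add: algebra_simps)
    then have "i + 2 < k + 2" using i assms by (subst (asm) mem_iv_of_nat_iff) auto
    then show "a \<in> iv s k" using i by auto
  qed
next
  assume *: "\<And>a. a \<in> A \<Longrightarrow> a - 2 \<in> iv s (k + 2)"
  show "A \<subseteq> iv (s + 2) k"
  proof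
    fix a assume a: "a \<in> A"
    then obtain i where i: "i < k + 2" "a - 2 = s + of_nat i" using * by (blast elim: ivE)
    then have a': "a = s + of_nat (i + 2)" by (simp add: algebra_simps)
    have "s + of_nat (i + 2) \<in> iv s (k + 2)" using a assms a' by auto
    then have "i < k" using i assms by (subst (asm) mem_iv_of_nat_iff) auto
    moreover have "a = (s + 2) + of_nat i" using a' by simp
    ultimately show "a \<in> iv (s + 2) k" by (metis ivI)
  qed
qed

text \<open>In units of \<open>d\<close>, adding 1 shifts an interval by \<open>j = 1 / d\<close>.
  With at least three elements inside and outside, exactly two new elements appear only for a shift
  by 2 or -2: a shift by 1 or -1 creates one, any longer shift at least three.\<close>

lemma unit_step_of_AP:
  fixes C' :: "'p::prime_card mod_ring set"
  assumes C': "AP d C'" "card C' \<ge> 3" "card C' + 3 \<le> CARD('p)"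
    and c: "card (C' + {0, 1}) = card C' + 2"
  shows "1 = 2 * d \<or> 1 = - (2 * d)"
proof -
  obtain s where d: "d \<noteq> 0" and s: "C' = d *o iv s (card C')" using C' by (auto simp: AP_def)
  define k j where "k = card C'" and "j = pos (inverse d)"
  have j: "of_nat j = inverse d" "j < CARD('p)" by (auto simp: j_def pos_less)
  have "j \<noteq> 0" using j d by (metis of_nat_0 inverse_nonzero_iff_nonzero)
  have "d *o {0, of_nat j} = {0, 1}" using d by (simp add: dilate_eq_image j)
  then have "C' + {0, 1} = d *o (iv s k + {0, of_nat j})"
    using s by (simp add: set_times_plus_distrib2 k_def)
  then have "card (iv s k + {0, of_nat j}) = k + 2" using c d by (simp add: k_def)
  then have two: "card ((of_nat j +o iv s k) - (iv s k :: 'p mod_ring set)) = 2"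
    using C' by (simp add: card_plus_pair k_def)
  have "min (min k j) (min (CARD('p) - j) (CARD('p) - k)) \<le> 2"
    using card_shift_diff_iv[of k j s] C' two j \<open>j \<noteq> 0\<close> by (simp add: k_def)
  then have "j \<le> 2 \<or> CARD('p) - j \<le> 2" using C' by (auto simp: k_def min_def split: if_splits)
  moreover have "j \<noteq> 1"
  proof
    assume "j = 1"
    then have "(of_nat j +o iv s k) - iv s k \<subseteq> {s + of_nat k}"
    proof (intro subsetI)
      fix y assume y: "y \<in> (of_nat j +o iv s k) - iv s k"
      then have "y \<in> iv (1 + s) k" using \<open>j = 1\<close> by (simp add: translate_iv)
      then obtain i where i: "i < k" "y = 1 + s + of_nat i" by (rule ivE)
      then have y': "y = s + of_nat (Suc i)" by (simp add: algebra_simps)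
      then have "\<not> Suc i < k" using y ivI by blast
      then have "Suc i = k" using i by simp
      then show "y \<in> {s + of_nat k}" using y' by (simp only: singleton_iff)
    qed
    then have "card ((of_nat j +o iv s k) - iv s k) \<le> card {s + of_nat k}"
      by (rule card_mono[rotated]) simp
    then show False using two by simp
  qed
  moreover have "CARD('p) - j \<noteq> 1"
  proof
    assume "CARD('p) - j = 1"
    then have "j = CARD('p) - 1" using j(2) by linarith
    then have m1: "of_nat j = (- 1 :: 'p mod_ring)" using j(2) by (simp add: of_nat_diff)
    then have "(of_nat j +o iv s k) - iv s k \<subseteq> {s - 1}"
    proof (intro subsetI)
      fix y assume y: "y \<in> (of_nat j +o iv s k) - iv s k"
      then have "y \<in> iv (- 1 + s) k" using m1 by (simp add: translate_iv)
      then obtain i where i: "i < k" "y = - 1 + s + of_nat i" by (rule ivE)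
      show "y \<in> {s - 1}"
      proof (cases i)
        case (Suc i')
        then have "y = s + of_nat i'" "i' < k" using i by (auto simp: algebra_simps)
        then show ?thesis using y ivI by blast
      qed (use i in simp)
    qed
    then have "card ((of_nat j +o iv s k) - iv s k) \<le> card {s - 1}"
      by (rule card_mono[rotated]) simp
    then show False using two by simp
  qed
  ultimately have "j = 2 \<or> j = CARD('p) - 2" using \<open>j \<noteq> 0\<close> j(2) by linarith
  then have "of_nat j = (2 :: 'p mod_ring) \<or> of_nat j = (- 2 :: 'p mod_ring)"
    using C' by (auto simp: of_nat_diff)
  then have "inverse d = 2 \<or> inverse d = - 2" using j by simp
  moreover have "inverse d * d = 1" using d by simp
  ultimately show ?thesis by auto
qed

lemma half_of_unit_step:
  assumes "1 = 2 * d \<or> 1 = - (2 * d)"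
  shows "d = inverse 2 \<or> d = - inverse (2 :: 'a::field)"
  using assms
proof
  assume "1 = 2 * d"
  then show ?thesis using inverse_unique[of 2 d] by simp
next
  assume "1 = - (2 * d)"
  then have "2 * (- d) = 1" by simp
  then have "inverse 2 = - d" by (rule inverse_unique)
  then have "d = - inverse 2" by (simp only: minus_minus)
  then show ?thesis ..
qed

text \<open>
  When both components of \<open>C\<close> have at least two elements, \<open>C = C' + {0, 1}\<close>, and moving the
  summand \<open>{0, 1}\<close> from \<open>C\<close> to \<open>A\<close> bounds the number of ends of \<open>A\<close> by 3; in the case of
  equality Vosper's theorem applies.
\<close>
lemma crit_two_long_intervals:
  fixes A B C :: "'p::prime_card mod_ring set"
  assumes cr: "crit A B C" and c5: "card C \<ge> 5"
    and C: "C = iv s1 l1 \<union> iv s2 l2" "l1 \<ge> 2" "l2 \<ge> 2" "card C = l1 + l2"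
    and dis: "iv s1 l1 \<inter> iv s2 l2 = {}"
  shows "card (ends A) \<le> 2 \<or> AAP (inverse 2) A \<and> AAP (inverse 2) B"
proof -
  have cp: "card A + card B + card C = CARD('p)" "card A \<ge> 3" "card B \<ge> 3" using cr by (auto simp: crit_def)
  have p5: "5 < CARD('p)" using cp by linarith
  define C' where "C' = iv s1 (l1 - 1) \<union> iv s2 (l2 - 1)"
  have ex: "iv s l = iv s (l - 1) + {0, 1}" if "l \<ge> 2" for s :: "'p mod_ring" and l
    using iv_plus_iv[of "l - 1" 2 s 0] that by (simp add: iv_2)
  have C'C: "C' + {0, 1} = C"
    unfolding C'_def C(1) Un_set_plus using ex[of l1 s1] ex[of l2 s2] C by simp
  have sub: "iv s1 (l1 - 1) \<subseteq> iv s1 l1" "iv s2 (l2 - 1) \<subseteq> iv s2 l2" by (intro iv_mono; simp)+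
  have lp: "l1 - 1 \<le> CARD('p)" "l2 - 1 \<le> CARD('p)" using C cp by linarith+
  have "card C' = (l1 - 1) + (l2 - 1)"
    unfolding C'_def using sub dis lp by (subst card_Un_disjoint) auto
  then have cC': "card C' + 2 = card C" using C by simp
  define A' where "A' = A + {0, 1}"
  have cA': "card A' = card A + card (ends A)" by (simp add: A'_def card_plus_01)
  have AC: "A' + C' = A + C"
    unfolding A'_def C'C[symmetric] by (simp add: add.assoc add.commute add.left_commute)
  have le: "card (A' + C') \<le> card A + card C" using crit_plus(2)[OF cr] AC by simp
  have ne: "A' \<noteq> {}" "C' \<noteq> {}" using cA' cC' cp c5 by auto
  \<comment> \<open>As \<open>card C' = card C - 2\<close> and
    \<open>card A' = card A + card (ends A)\<close>, the bound stays within
    \<open>card A + card C\<close> for at most three ends, with equality at three.\<close>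
  have "min CARD('p) (card A' + card C' - 1) \<le> card (A' + C')" using Cauchy_Davenport ne by blast
  then have q3: "card (ends A) \<le> 3" and eq: "card (ends A) = 3 \<Longrightarrow> card (A' + C') = card A + card C"
    using le cA' cC' cp c5 by linarith+
  show ?thesis
  proof (cases "card (ends A) = 3")
    case True
    have v: "card A' \<ge> 2" "card C' \<ge> 2" "card (A' + C') + 2 \<le> CARD('p)"
      "card (A' + C') \<le> card A' + card C' - 1"
      using cA' cC' cp c5 le True by linarith+
    obtain d where d: "AP d A'" "AP d C'" "AP d (A' + C')" using Vosper[OF v] by blast
    have u: "1 = 2 * d \<or> 1 = - (2 * d)"
      using C'C cC' cp c5 by (intro unit_step_of_AP[OF d(2)]) auto
    have d2: "d = inverse 2 \<or> d = - inverse 2" using u half_of_unit_step by blast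
    have dn: "d \<noteq> 0" using d by (simp add: AP_def)
    obtain s where s: "A' = d *o iv s (card A')" using d by (auto simp: AP_def)
    define A0 where "A0 = inverse d *o A"
    have A: "A = d *o A0" using dn by (simp add: A0_def dilate_inverse)
    have len: "card A' = (card A + 1) + 2" using cA' True by simp
    have A'mem: "y \<in> A' \<longleftrightarrow> y / d \<in> iv s ((card A + 1) + 2)" for y
      by (subst s) (simp add: mem_dilate_iff[OF dn] len)
    have mem: "a \<in> iv s ((card A + 1) + 2) \<and> a + 1 / d \<in> iv s ((card A + 1) + 2)" if "a \<in> A0" for a
    proof -
      have "d * a \<in> A" using that A by (auto simp: dilate_eq_image)
      then have "d * a + 0 \<in> A'" "d * a + 1 \<in> A'" unfolding A'_def by (intro set_plus_intro; simp)+
      then show ?thesis using dn unfolding A'mem by (simp add: add_divide_distrib)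
    qed
    have A0: "A0 \<subseteq> iv s ((card A + 1) + 2)" "card A + 1 + 4 \<le> CARD('p)"
      using mem cp c5 by (blast, linarith)
    have "1 / d = 2 \<or> 1 / d = - 2" using u dn by (metis mult_minus_left nonzero_mult_div_cancel_right)
    then have "A0 \<subseteq> iv s (card A + 1) \<or> A0 \<subseteq> iv (s + 2) (card A + 1)"
    proof
      assume "1 / d = 2"
      then have "a + 2 \<in> iv s ((card A + 1) + 2)" if "a \<in> A0" for a using mem[OF that] by simp
      then show ?thesis using subset_shift_iv(1)[OF A0] by blast
    next
      assume "1 / d = - 2"
      then have "a - 2 \<in> iv s ((card A + 1) + 2)" if "a \<in> A0" for a using mem[OF that] by simp
      then show ?thesis using subset_shift_iv(2)[OF A0] by blast
    qed
    moreover have "card A0 = card A" using A dn by simp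
    ultimately have "AAP 1 A0" using AAP_1_iff by metis
    then have "AAP d A" using AAP_dilate_iff[OF dn, of 1 A0] A by simp
    moreover have "AP d B" using crit_AP_third[OF cr, of d] d(3) eq[OF True] AC by simp
    then have "AAP d B" by (rule AP_imp_AAP)
    ultimately have all: "AAP d A" "AAP d B" "AAP (- d) A" "AAP (- d) B"
      by (auto intro: AAP_uminus)
    show ?thesis using d2
    proof
      assume "d = inverse 2"
      then show ?thesis using all by metis
    next
      assume "d = - inverse 2"
      then have "inverse 2 = - d" by (simp only: minus_minus)
      then show ?thesis using all by metis
    qed
  qed (use q3 in simp)
qed

text \<open>If \<open>C\<close> is not an interval, it has two components. Beside an isolated point
  the other one has at least four elements, by \<open>card C \<ge> 5\<close>. Two longer components
  leave either the difference 1/2, from equality in Vosper's theorem, or \<open>A\<close> and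
  \<open>B\<close> with at most two ends each. In the latter case the negated complement
  \<open>D\<close> of \<open>C\<close> is a union of two intervals that must accommodate
  \<open>A + B\<close>.\<close>

theorem crit_two_ends:
  fixes A B C :: "'p::prime_card mod_ring set"
  assumes cr: "crit A B C" and c5: "card C \<ge> 5" and q: "card (C + {0, 1}) \<le> card C + 2"
  shows "AAP 1 A \<and> AAP 1 B \<or> AAP (inverse 2) A \<and> AAP (inverse 2) B"
proof -
  have cp: "card A + card B + card C = CARD('p)" "card A \<ge> 3" "card B \<ge> 3" using cr by (auto simp: crit_def)
  have eC: "card (ends C) \<le> 2" using q by (simp add: card_plus_01)
  have Cne: "C \<noteq> {}" using c5 by auto
  define D where "D = - (uminus ` C)"
  have eD: "card (ends D) \<le> 2" unfolding D_def by (simp only: card_ends_negated_complement eC)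
  have cD: "card D = card A + card B"
    unfolding D_def by (simp only: card_compl) (use cp in \<open>simp add: card_image\<close>)
  have AB: "A + B \<subseteq> D"
  proof
    fix y assume "y \<in> A + B"
    then obtain a b where "a \<in> A" "b \<in> B" "y = a + b" by (auto simp: plus_mem_iff)
    then have "- y \<notin> C" using cr unfolding crit_def by (metis add.right_inverse)
    then show "y \<in> D" by (simp add: D_def mem_uminus_image_iff)
  qed
  show ?thesis
  proof (cases "AP 1 C")
    case True
    then show ?thesis
      using crit_AAP_of_interval[OF cr] crit_AAP_of_interval[OF crit_commute[OF cr]] c5 by simp
  next
    case False
    obtain s1 l1 s2 l2 where C: "l1 \<ge> 1" "l2 \<ge> 1" "C = iv s1 l1 \<union> iv s2 l2" "card C = l1 + l2"
      "iv s1 l1 \<inter> iv s2 l2 = {}"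
      using two_intervals_of_two_ends[OF Cne _ eC] False cp by auto
    have "\<not> AP 1 D" using AP_1_of_negated_complement False unfolding D_def by blast
    moreover have "D \<noteq> {}" "card D + 2 \<le> CARD('p)" using cD cp c5 by auto
    ultimately obtain u n v k where D: "n \<ge> 1" "k \<ge> 1" "D = iv u n \<union> iv v k" "card D = n + k"
      "u + of_nat n \<notin> D" "v + of_nat k \<notin> D"
      using two_intervals_of_two_ends[OF _ _ eD] by auto
    consider "l1 = 1" | "l2 = 1" | "l1 \<ge> 2" "l2 \<ge> 2" using C by linarith
    then show ?thesis
    proof cases
      case 1
      then show ?thesis using crit_interval_and_point[OF cr, of s2 l2] C c5 by auto
    next
      case 2
      then show ?thesis using crit_interval_and_point[OF cr, of s1 l1] C c5 by auto
    next
      case 3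
      note long = crit_two_long_intervals[OF _ c5 C(3) 3 C(4,5)]
      show ?thesis
      proof (cases "card (ends A) \<le> 2 \<and> card (ends B) \<le> 2")
        case True
        show ?thesis
          by (rule plus_subset_two_intervals[of A B u n v k]) (use True cp cD c5 D AB in auto)
      next
        case False
        then show ?thesis using long[OF cr] long[OF crit_commute[OF cr]] by blast
      qed
    qed
  qed
qed

lemma crit_dilate:
  assumes "crit A B (C :: 'p::prime_card mod_ring set)" "r \<noteq> 0"
  shows "crit (r *o A) (r *o B) (r *o C)"
proof -
  have "r * a + r * b + r * c \<noteq> 0" if "a \<in> A" "b \<in> B" "c \<in> C" for a b c
  proof -
    have "r * a + r * b + r * c = r * (a + b + c)" by (simp add: algebra_simps)
    moreover have "a + b + c \<noteq> 0" using assms(1) that unfolding crit_def by blast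
    ultimately show ?thesis using assms(2) by simp
  qed
  then show ?thesis using assms unfolding crit_def dilate_eq_image
    by (simp add: card_image inj_on_def)
qed

text \<open>In the first alternative \<open>d\<close> depends on \<open>C\<close> alone and serves
  every pair that completes \<open>C\<close> to a critical triple; this is what makes two triples
  with the same \<open>C\<close> comparable. The second alternative is the rigid case, where the
  small sets are translates of each other.\<close>

theorem crit_structure:
  fixes A0 B0 C :: "'p::prime_card mod_ring set"
  assumes cr: "crit A0 B0 C" and c5: "card C \<ge> 5"
  shows "(\<exists>d. d \<noteq> 0 \<and> (\<forall>A B. crit A B C \<longrightarrow> (\<exists>e\<in>{d, d * inverse 2}. AAP e A \<and> AAP e B))) \<or>
    (\<forall>A B. crit A B C \<longrightarrow> card A = 3 \<and> card B = 3 \<and> card (A + A) = 6 \<and>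
       (\<forall>B'. card B' = 3 \<and> card (B' + C) \<le> card C + 3 \<longrightarrow> (\<exists>x. B' = x +o A)))"
proof (cases "\<exists>d. d \<noteq> 0 \<and> card (C + {0, d}) \<le> card C + 2")
  case True
  then obtain d where d: "d \<noteq> 0" "card (C + {0, d}) \<le> card C + 2" by blast
  define C1 where "C1 = inverse d *o C"
  have C: "C = d *o C1" using d by (simp add: C1_def dilate_inverse)
  have cC1: "card C1 = card C" using C d by simp
  have "d *o {0, 1} = {0, d}" by (simp add: dilate_eq_image)
  then have "C + {0, d} = d *o (C1 + {0, 1})" unfolding C by (simp add: set_times_plus_distrib2)
  then have q: "card (C1 + {0, 1}) \<le> card C1 + 2" using d cC1 by simp
  have "\<exists>e\<in>{d, d * inverse 2}. AAP e A \<and> AAP e B" if AB: "crit A B C" for A B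
  proof -
    have "crit (inverse d *o A) (inverse d *o B) C1"
      unfolding C1_def using AB d by (intro crit_dilate) auto
    from crit_two_ends[OF this _ q] have "\<exists>e\<in>{1, inverse 2}. AAP e (inverse d *o A) \<and> AAP e (inverse d *o B)"
      using c5 cC1 by auto
    then obtain e where e: "e \<in> {1, inverse 2}" "AAP e (inverse d *o A)" "AAP e (inverse d *o B)" by blast
    have "AAP (d * e) A" "AAP (d * e) B"
      using AAP_dilate_iff[OF d(1), of e "inverse d *o A"] AAP_dilate_iff[OF d(1), of e "inverse d *o B"]
        e dilate_inverse(2)[OF d(1)] by metis+
    moreover have "d * e \<in> {d, d * inverse 2}"
      using e(1) by (metis insert_iff singletonD mult_1_right)
    ultimately show ?thesis by blast
  qed
  then show ?thesis using d by blast
next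
  case False
  then have rigid: "card C + 3 \<le> card (C + {0, d})" if "d \<noteq> 0" for d using that by force
  have cp: "card A + card B + card C = CARD('p)" "card A \<ge> 3" "card B \<ge> 3" if "crit A B C" for A B
    using that by (auto simp: crit_def)
  have p5: "5 < CARD('p)" and pc: "card C + 6 \<le> CARD('p)" using cp[OF cr] by linarith+
  have Cne: "C \<noteq> {}" using c5 by auto
  have pre: "card A0 \<ge> 2" "card C \<ge> 2" "card (A0 + C) + 2 \<le> CARD('p)" "card (A0 + C) \<le> card A0 + card C"
    using crit_plus(2)[OF cr] cp[OF cr] c5 by linarith+
  obtain M where M: "card M = 3" "card (M + C) \<le> card C + 3"
    using small_difference_pair_or_triple[OF pre]
  proof
    assume "\<exists>d. d \<noteq> 0 \<and> card (C + {0, d}) + card A0 \<le> card (A0 + C) + 2"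
    then show thesis using False pre(4) by force
  next
    assume "\<exists>M. card M = 3 \<and> card (M + C) = 3 + card C \<and> card (A0 + C) = card A0 + card C"
    then show thesis using that by force
  qed
  have six: "card C + 6 = CARD('p)" using rigid_triple[OF Cne p5 rigid M pc] by blast
  have "card A = 3 \<and> card B = 3 \<and> card (A + A) = 6 \<and>
       (\<forall>B'. card B' = 3 \<and> card (B' + C) \<le> card C + 3 \<longrightarrow> (\<exists>x. B' = x +o A))"
    if AB: "crit A B C" for A B
  proof -
    have A3: "card A = 3" "card B = 3" using cp[OF AB] six by linarith+
    then have AC: "card (A + C) \<le> card C + 3" using crit_plus(2)[OF AB] by simp
    have "card (A + A) = 6" using rigid_triple[OF Cne p5 rigid A3(1) AC pc] by blast
    then show ?thesis using A3 rigid_triples_translates[OF Cne p5 rigid pc A3(1) AC] by blast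
  qed
  then show ?thesis by blast
qed

section \<open>Uniqueness of the difference\<close>

text \<open>\<open>X\<close> omits one element of the interval \<open>P\<close> and one of the
  progression \<open>P'\<close>. Shifting \<open>P\<close> by \<open>d\<close> creates at most three
  new elements: the hole of \<open>P'\<close>, the successor of its last term, and the shifted hole
  of \<open>P\<close>. Hence \<open>j \<le> 3\<close>. If \<open>j \<ge> 2\<close>, then
  \<open>k\<close> consecutive terms of \<open>P'\<close> inside \<open>P\<close> spread over
  \<open>2 * (k - 1) > k\<close> steps, too many for \<open>P\<close>.\<close>

lemma AAP_difference_unique_small:
  fixes X :: "'p::prime_card mod_ring set"
  assumes X1: "AAP 1 X" and Xj: "AAP (of_nat j) X" and k: "3 \<le> card X" "card X + 7 \<le> CARD('p)"
    and j: "1 \<le> j" "2 * j \<le> CARD('p)"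
  shows "j = 1"
proof (rule ccontr)
  assume "j \<noteq> 1"
  then have j2: "j \<ge> 2" using j by simp
  define k d where "k = card X" and "d = (of_nat j :: 'p mod_ring)"
  have kp: "3 \<le> k" "k + 7 \<le> CARD('p)" using k by (auto simp: k_def)
  obtain s where s: "X \<subseteq> iv s (k + 1)" using X1 by (auto simp: AAP_1_iff k_def)
  obtain v where d0: "d \<noteq> 0" and v: "X \<subseteq> d *o iv v (k + 1)" using Xj by (auto simp: AAP_def k_def d_def)
  define P P' where "P = iv s (k + 1)" and "P' = d *o iv v (k + 1)"
  have cP: "card P = k + 1" "card P' = k + 1" using kp d0 by (simp_all add: P_def P'_def)
  have PX: "card (P - X) = 1" "card (P' - X) = 1"
    using s v cP by (simp_all add: card_Diff_subset P_def P'_def k_def)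
  have "(d +o P) - P \<subseteq> (P' - X) \<union> {d * (v + of_nat (k + 1))} \<union> (d +o (P - X))"
  proof
    fix y assume y: "y \<in> (d +o P) - P"
    then have yd: "y - d \<in> P" "y \<notin> X" using s by (auto simp: mem_translate_iff P_def)
    show "y \<in> (P' - X) \<union> {d * (v + of_nat (k + 1))} \<union> (d +o (P - X))"
    proof (cases "y - d \<in> X")
      case True
      then obtain i where i: "i < k + 1" "y - d = d * (v + of_nat i)"
        using v unfolding dilate_eq_image iv_def by blast
      then have y': "y = d * (v + of_nat (Suc i))" by (simp add: algebra_simps)
      show ?thesis
      proof (cases "Suc i < k + 1")
        case True
        then have "y \<in> P'" unfolding y' P'_def by blast
        then show ?thesis using yd by blast
      next
        case False
        then have "Suc i = k + 1" using i by simp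
        then have "y = d * (v + of_nat (k + 1))" using y' by metis
        then show ?thesis by (simp only: Un_iff singleton_iff simp_thms)
      qed
    qed (use yd in \<open>simp add: mem_translate_iff\<close>)
  qed
  then have "card ((d +o P) - P) \<le> card ((P' - X) \<union> {d * (v + of_nat (k + 1))} \<union> (d +o (P - X)))"
    by (rule card_mono[rotated]) simp
  also have "\<dots> \<le> card (P' - X) + card {d * (v + of_nat (k + 1))} + card (d +o (P - X))"
    by (meson add_le_mono1 card_Un_le order_trans)
  also have "\<dots> = 3" using PX by simp
  finally have three: "card ((d +o P) - P) \<le> 3" .
  have "min (min (k + 1) j) (min (CARD('p) - j) (CARD('p) - (k + 1))) \<le> card ((d +o P) - P)"
    unfolding d_def P_def using kp j by (intro card_shift_diff_iv) auto
  then have j3: "j \<le> 3" using three kp j by linarith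
  define y where "y i = d * (v + of_nat i)" for i
  have y_Suc: "y (Suc i) = y i + of_nat j" for i by (simp add: y_def d_def algebra_simps)
  have yP': "y i \<in> P'" if "i \<le> k" for i using that by (auto simp: y_def P'_def)
  have one: "y i \<in> P" if "i \<le> k" "i' \<le> k" "i \<noteq> i'" "y i' \<notin> P" for i i'
  proof (rule ccontr)
    assume "y i \<notin> P"
    then have "{y i, y i'} \<subseteq> P' - X" using yP' that s by (auto simp: P_def)
    then have "card {y i, y i'} \<le> 1" using card_mono[of "P' - X" "{y i, y i'}"] PX by simp
    moreover have "y i \<noteq> y i'" using that kp d0 by (auto simp: y_def of_nat_eq_iff_less)
    ultimately show False by simp
  qed
  have stepP: "pos (y (Suc i) - s) = pos (y i - s) + j" if "y i \<in> P" for i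
  proof -
    have "pos (y i - s) < k + 1" using that kp by (simp add: P_def mem_iv_iff)
    then have "pos (of_nat (pos (y i - s) + j) :: 'p mod_ring) = pos (y i - s) + j"
      using j3 kp by (intro pos_of_nat) linarith
    then show ?thesis by (simp add: y_Suc algebra_simps)
  qed
  have memP: "y i \<in> P \<longleftrightarrow> pos (y i - s) < k + 1" for i using kp by (simp add: P_def mem_iv_iff)
  \<comment> \<open>An interior term outside \<open>P\<close> has both neighbours in
    \<open>P\<close>. But two steps of at most 3 starting in \<open>P\<close> end at offset at most
    \<open>k + 6 < p\<close>, so they cannot wrap around and re-enter \<open>P\<close>. This uses
    the margin 7.\<close>
  have inner: "y (Suc i) \<in> P" if "Suc i < k" for i
  proof (rule ccontr)
    assume n: "y (Suc i) \<notin> P"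
    have "y i \<in> P" "y (Suc (Suc i)) \<in> P" using one[OF _ _ _ n] that by simp_all
    then have a: "pos (y i - s) < k + 1" "pos (y (Suc i) - s) = pos (y i - s) + j"
      "pos (y (Suc (Suc i)) - s) < k + 1" using memP stepP by auto
    have q: "y (Suc (Suc i)) - s = of_nat (pos (y (Suc i) - s) + j)" by (simp add: y_Suc algebra_simps)
    have "pos (y (Suc (Suc i)) - s) = pos (y (Suc i) - s) + j"
      unfolding q by (rule pos_of_nat) (use a j3 kp in linarith)
    then show False using a n memP by simp
  qed
  obtain b where b: "b \<le> 1" "\<And>i. i < k \<Longrightarrow> y (b + i) \<in> P"
  proof (cases "y 0 \<in> P")
    case True
    have "y (0 + i) \<in> P" if "i < k" for i using True inner that by (cases i) auto
    then show thesis using that[of 0] by simp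
  next
    case False
    have "y (1 + i) \<in> P" if "i < k" for i using one[OF _ _ _ False, of "Suc i"] that by simp
    then show thesis using that[of 1] by simp
  qed
  have "i < k \<Longrightarrow> pos (y (b + i) - s) = pos (y b - s) + i * j" for i
  proof (induction i)
    case (Suc i)
    then show ?case using stepP[OF b(2), of i] by simp
  qed simp
  from this[of "k - 1"] have "pos (y (b + (k - 1)) - s) = pos (y b - s) + (k - 1) * j" using kp by simp
  moreover have "pos (y (b + (k - 1)) - s) < k + 1" using b(2)[of "k - 1"] memP kp by simp
  moreover have "(k - 1) * 2 \<le> (k - 1) * j" using j2 by (intro mult_le_mono2)
  ultimately show False using kp by linarith
qed

lemma AAP_1_difference_unique:
  fixes X :: "'p::prime_card mod_ring set"
  assumes X: "AAP 1 X" "AAP d X" and k: "3 \<le> card X" "card X + 7 \<le> CARD('p)"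
  shows "d = 1 \<or> d = - 1"
proof -
  define j where "j = pos d"
  have j: "of_nat j = d" "j < CARD('p)" by (auto simp: j_def pos_less)
  have "d \<noteq> 0" using X by (simp add: AAP_def)
  then have j1: "j \<ge> 1" using j by (cases j) auto
  show ?thesis
  proof (cases "2 * j \<le> CARD('p)")
    case True
    then have "j = 1" using AAP_difference_unique_small[OF X(1) _ k j1] X(2) j by simp
    then show ?thesis using j by simp
  next
    case False
    have e: "of_nat (CARD('p) - j) = - d" using j by (simp add: of_nat_diff)
    have "AAP (of_nat (CARD('p) - j)) X" unfolding e using X(2) by (rule AAP_uminus)
    then have "CARD('p) - j = 1"
      using False j(2) by (intro AAP_difference_unique_small[OF X(1) _ k]) auto
    then have "- d = 1" using e by simp
    then show ?thesis by (metis minus_minus)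
  qed
qed

lemma AAP_difference_unique:
  fixes X :: "'p::prime_card mod_ring set"
  assumes X: "AAP e X" "AAP d X" and k: "3 \<le> card X" "card X + 7 \<le> CARD('p)"
  shows "d = e \<or> d = - e"
proof -
  have e: "e \<noteq> 0" using X by (simp add: AAP_def)
  define X' where "X' = inverse e *o X"
  have X': "X = e *o X'" using e by (simp add: X'_def dilate_inverse)
  have "AAP 1 X'" using AAP_dilate_iff[OF e, of 1 X'] X X' by simp
  moreover have "AAP (d / e) X'" using AAP_dilate_iff[OF e, of "d / e" X'] X X' e by simp
  moreover have "card X' = card X" using X' e by simp
  ultimately have "d / e = 1 \<or> d / e = - 1" using AAP_1_difference_unique k by metis
  then show ?thesis using e by (auto simp: divide_eq_eq)
qed

section \<open>Two sets\<close>

text \<open>Needed to exclude the ratio 2 between the differences of two triples: it leads to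
  \<open>t * t = 4\<close> and then to \<open>1 = 4 * 4\<close>.\<close>

lemma fifteen_ne_0:
  assumes "5 < CARD('p)" shows "(15 :: 'p::prime_card mod_ring) \<noteq> 0"
proof -
  have "(15 :: 'p mod_ring) = 3 * 5" by simp
  then show ?thesis using numeral_ne_0[OF assms] by (metis mult_eq_0_iff)
qed

lemma two_sets_critical:
  fixes X Y :: "'p::prime_card mod_ring set"
  assumes dis: "X \<inter> Y = {}" and X: "card X \<ge> 3" and Y: "card Y \<ge> 3"
    and p: "card X + card Y + 5 \<le> CARD('p)" and t: "t \<noteq> 0" "t \<noteq> 1"
    and le: "card ((X + t *o Y) \<union> (t *o X + Y)) \<le> card X + card Y"
  shows "t = - 1 \<and> (\<exists>r. AAP r X \<and> AAP r Y)"
proof -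
  define S where "S = (X + t *o Y) \<union> (t *o X + Y)"
  have p5: "5 < CARD('p)" using X Y p by linarith
  have "CARD('p) - (card X + card Y) \<le> card (uminus ` (- S))"
    using le card_compl[of S] by (simp add: card_image S_def)
  then obtain C where C: "C \<subseteq> uminus ` (- S)" "card C = CARD('p) - (card X + card Y)"
    by (meson obtain_subset_with_card_n)
  have ne: "a + b + c \<noteq> 0" if "a + b \<in> S" "c \<in> C" for a b c
  proof
    assume "a + b + c = 0"
    then have "a + b = - c" by (simp add: add_eq_0_iff2)
    moreover have "- c \<notin> S" using C that by (auto simp: mem_uminus_image_iff)
    ultimately show False using that by simp
  qed
  have cr1: "crit X (t *o Y) C"
  proof -
    have "a + b + c \<noteq> 0" if "a \<in> X" "b \<in> t *o Y" "c \<in> C" for a b c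
      using that by (intro ne) (auto simp: S_def)
    then show ?thesis unfolding crit_def using X Y p C t by simp
  qed
  have cr2: "crit (t *o X) Y C"
  proof -
    have "a + b + c \<noteq> 0" if "a \<in> t *o X" "b \<in> Y" "c \<in> C" for a b c
      using that by (intro ne) (auto simp: S_def)
    then show ?thesis unfolding crit_def using X Y p C t by simp
  qed
  have c5: "card C \<ge> 5" using C p by simp
  from crit_structure[OF cr1 c5] show ?thesis
  proof
    assume "\<exists>d. d \<noteq> 0 \<and> (\<forall>A B. crit A B C \<longrightarrow> (\<exists>e\<in>{d, d * inverse 2}. AAP e A \<and> AAP e B))"
    then obtain d where d: "d \<noteq> 0" "\<And>A B. crit A B C \<Longrightarrow> \<exists>e\<in>{d, d * inverse 2}. AAP e A \<and> AAP e B" by blast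
    obtain e1 where e1: "e1 \<in> {d, d * inverse 2}" "AAP e1 X" "AAP e1 (t *o Y)" using d(2)[OF cr1] by blast
    obtain e2 where e2: "e2 \<in> {d, d * inverse 2}" "AAP e2 (t *o X)" "AAP e2 Y" using d(2)[OF cr2] by blast
    have e0: "e1 \<noteq> 0" "e2 \<noteq> 0" using e1 e2 by (auto simp: AAP_def)
    have "AAP (e2 / t) X" using AAP_dilate_iff[OF t(1), of "e2 / t" X] e2 t by simp
    then have "e2 / t = e1 \<or> e2 / t = - e1" using AAP_difference_unique[OF e1(2)] X Y p by simp
    then have "e2 = t * e1 \<or> e2 = - (t * e1)" using t by (auto simp: divide_eq_eq mult.commute)
    \<comment> \<open>A difference is determined only up to sign; squaring absorbs the sign.\<close>
    then have sq1: "e2 * e2 = (t * t) * (e1 * e1)" by (auto simp: algebra_simps)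
    have "AAP (e1 / t) Y" using AAP_dilate_iff[OF t(1), of "e1 / t" Y] e1 t by simp
    then have "e1 / t = e2 \<or> e1 / t = - e2" using AAP_difference_unique[OF e2(3)] X Y p by simp
    then have "e1 = t * e2 \<or> e1 = - (t * e2)" using t by (auto simp: divide_eq_eq mult.commute)
    then have sq2: "e1 * e1 = (t * t) * (e2 * e2)" by (auto simp: algebra_simps)
    have two: "(2 :: 'p mod_ring) \<noteq> 0" using numeral_ne_0[OF p5] by simp
    have half: "d = 2 * (d * inverse 2)" using two by simp
    have no: False if "a = 2 * b" "b \<noteq> 0" "b * b = (t * t) * (a * a)" "a * a = (t * t) * (b * b)" for a b
    proof -
      have bb: "b * b \<noteq> 0" using that by simp
      have "4 * (b * b) = (t * t) * (b * b)" using that(4) unfolding that(1) by (simp add: algebra_simps)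
      then have t4: "t * t = 4" using bb by (metis mult_right_cancel)
      have "1 * (b * b) = (4 * 4) * (b * b)" using that(3) unfolding that(1) t4 by (simp add: algebra_simps)
      then have "(1 :: 'p mod_ring) = 4 * 4" using bb by (metis mult_right_cancel)
      then have "4 * 4 - (1 :: 'p mod_ring) = 0" by (metis diff_self)
      then have "(15 :: 'p mod_ring) = 0" by simp
      then show False using fifteen_ne_0[OF p5] by simp
    qed
    have "e1 = e2"
    proof (rule ccontr)
      assume "e1 \<noteq> e2"
      then have "e1 = 2 * e2 \<or> e2 = 2 * e1" using e1(1) e2(1) half by (metis insert_iff singletonD)
      then show False using no[of e1 e2] no[of e2 e1] e0 sq1 sq2 by blast
    qed
    then have "1 * (e1 * e1) = (t * t) * (e1 * e1)" using sq1 by simp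
    then have "t * t = 1" using e0 by (metis mult_right_cancel mult_eq_0_iff)
    then have "t = - 1" using t by (simp add: square_eq_1_iff)
    moreover have "AAP e1 Y" using e2(3) \<open>e1 = e2\<close> by simp
    ultimately show ?thesis using e1(2) by blast
  next
    \<comment> \<open>Rigid case: \<open>t *o Y\<close>, \<open>t *o X\<close> and \<open>Y\<close>
      are the translates of \<open>X\<close> by \<open>x1\<close>, \<open>x2\<close> and
      \<open>x3\<close>. Both halves of \<open>S\<close> fill \<open>S\<close>, whence
      \<open>x1 = x2 + x3\<close>; dilating \<open>Y = x3 +o X\<close> gives
      \<open>x1 = t * x3 + x2\<close>. So \<open>x3 = 0\<close> and \<open>Y = X\<close>.\<close>
    assume R: "\<forall>A B. crit A B C \<longrightarrow> card A = 3 \<and> card B = 3 \<and> card (A + A) = 6 \<and>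
       (\<forall>B'. card B' = 3 \<and> card (B' + C) \<le> card C + 3 \<longrightarrow> (\<exists>x. B' = x +o A))"
    have R0: "card X = 3" "card (t *o Y) = 3" "card (X + X) = 6"
      "\<And>B'. card B' = 3 \<Longrightarrow> card (B' + C) \<le> card C + 3 \<Longrightarrow> \<exists>x. B' = x +o X"
      using R cr1 by blast+
    then have "card Y = 3" using t by simp
    note R1 = R0(1) this R0(3,4)
    have small: "card (t *o Y + C) \<le> card C + 3" "card (t *o X + C) \<le> card C + 3" "card (Y + C) \<le> card C + 3"
      using crit_plus(2)[OF crit_commute[OF cr1]] crit_plus(2)[OF cr2] crit_plus(2)[OF crit_commute[OF cr2]]
        R1 t by simp_all
    obtain x1 where x1: "t *o Y = x1 +o X" using R1(4)[OF R0(2) small(1)] by blast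
    have "card (t *o X) = 3" using R1 t by simp
    then obtain x2 where x2: "t *o X = x2 +o X" using R1(4)[OF _ small(2)] by blast
    obtain x3 where x3: "Y = x3 +o X" using R1(4)[OF R1(2) small(3)] by blast
    have cS: "card S \<le> 6" using le R1 by (simp add: S_def)
    have s1: "X + t *o Y = x1 +o (X + X)" unfolding x1 by (rule set_plus_rearrange4)
    have s2: "t *o X + Y = (x2 + x3) +o (X + X)" unfolding x2 x3 by (rule set_plus_rearrange)
    have "x1 +o (X + X) = S" "(x2 + x3) +o (X + X) = S"
      using s1 s2 cS R1(3) by (intro card_seteq; auto simp: S_def)+
    then have "x1 +o (X + X) = (x2 + x3) +o (X + X)" by simp
    then have "(- x1) +o ((x2 + x3) +o (X + X)) = X + X"
      by (metis set_plus_rearrange2 add.left_inverse set_zero_plus)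
    then have per: "(- x1 + (x2 + x3)) +o (X + X) = X + X" by (simp only: set_plus_rearrange2)
    have XXne: "X + X \<noteq> {}" "X + X \<noteq> UNIV" using R1(3) p5 p R1 by auto
    have z: "- x1 + (x2 + x3) = 0"
      using translate_invariant_UNIV[of "- x1 + (x2 + x3)" "X + X"] per XXne by auto
    have "t *o Y = (t * x3 + x2) +o X"
      unfolding x3 set_times_plus_distrib x2 by (rule set_plus_rearrange2)
    then have "(- x1) +o ((t * x3 + x2) +o X) = X"
      using x1 by (metis set_plus_rearrange2 add.left_inverse set_zero_plus)
    then have per2: "(- x1 + (t * x3 + x2)) +o X = X" by (simp only: set_plus_rearrange2)
    have Xne: "X \<noteq> {}" "X \<noteq> UNIV" using R1 p by auto
    have "- x1 + (t * x3 + x2) = 0"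
      using translate_invariant_UNIV[of "- x1 + (t * x3 + x2)" X] per2 Xne by auto
    then have "t * x3 + x2 = x3 + x2" using z by (metis add.commute add_left_imp_eq)
    then have "t * x3 = x3" by simp
    then have "x3 = 0" using t by simp
    then have "Y = X" using x3 by simp
    then show ?thesis using dis Xne by simp
  qed
qed

lemma cyc_interval_eq_iv: "cyc_interval x y = iv x (Suc (pos (y - x)))"
  unfolding cyc_interval_def iv_def pos_def by (auto simp: less_Suc_eq_le)

lemma cyc_interval_iv:
  assumes "1 \<le> l" "l \<le> CARD('p)"
  shows "cyc_interval x (x + of_nat (l - 1)) = (iv x l :: 'p::prime_card mod_ring set)"
proof -
  have "pos (of_nat (l - 1) :: 'p mod_ring) = l - 1" using assms by (intro pos_of_nat) linarith
  then show ?thesis using assms by (simp add: cyc_interval_eq_iv)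
qed

text \<open>
  The equation expresses that the interval \<open>X\<close> and the punctured interval \<open>Y\<close> have the same
  midpoint modulo \<open>p\<close>.
\<close>
definition opposite :: "'p::prime_card mod_ring set \<Rightarrow> 'p mod_ring set \<Rightarrow> bool" where
  "opposite X Y \<longleftrightarrow> (\<exists>s u l z. X = iv s (card X) \<and> Y = iv u l - {z} \<and> 1 \<le> l \<and> l \<le> card Y + 1 \<and>
     2 * u + of_nat l = 2 * s + of_nat (card X))"

lemma oppositeI:
  assumes "X = iv s (card X)" "Y = iv u l - {z}" "1 \<le> l" "l \<le> card Y + 1"
    "2 * u + of_nat l = 2 * s + of_nat (card X)"
  shows "opposite X Y"
  unfolding opposite_def by (intro exI conjI) (rule assms)+

lemma opposite_cyc_intervals:
  fixes X Y :: "'p::prime_card mod_ring set"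
  assumes "opposite X Y" "1 \<le> card X" "card X \<le> CARD('p)" "card Y + 1 \<le> CARD('p)"
  shows "\<exists>x y c z. X = cyc_interval x y \<and> Y = cyc_interval (y + c) (x - c) - {z}"
proof -
  obtain s u l z where X: "X = iv s (card X)" and Y: "Y = iv u l - {z}" and l: "1 \<le> l" "l \<le> card Y + 1"
    and eq: "2 * u + of_nat l = 2 * s + of_nat (card X)"
    using assms(1) by (auto simp: opposite_def)
  define y where "y = s + of_nat (card X - 1)"
  have "cyc_interval s y = X" unfolding y_def using assms X cyc_interval_iv[of "card X" s] by metis
  \<comment> \<open>The parameter \<open>c\<close> of the exceptional form is \<open>u - y\<close>:
    it fixes one endpoint, and the midpoint equation yields the other.\<close>
  moreover have "y + (u - y) = u" by simp
  moreover have "s - (u - y) = u + of_nat (l - 1)"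
  proof -
    have "s - (u - y) = (2 * s + of_nat (card X)) - u - 1"
      using assms(2) by (simp add: y_def of_nat_diff algebra_simps)
    also have "\<dots> = u + of_nat (l - 1)" unfolding eq[symmetric] using l(1) by (simp add: of_nat_diff algebra_simps)
    finally show ?thesis .
  qed
  moreover have "cyc_interval u (u + of_nat (l - 1)) = iv u l" using assms l by (intro cyc_interval_iv) auto
  ultimately have "X = cyc_interval s y \<and> Y = cyc_interval (y + (u - y)) (s - (u - y)) - {z}"
    using Y by metis
  then show ?thesis by blast
qed

lemma iv_Un_succ: "1 \<le> n \<Longrightarrow> iv w n \<union> iv (w + 1) n = iv w (n + 1)"
proof -
  assume n: "1 \<le> n"
  have "iv w (1 + n) = iv w 1 \<union> iv (w + of_nat 1) n" by (rule iv_split)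
  moreover have "iv w 1 \<subseteq> iv w n" using n by (rule iv_mono)
  moreover have "iv w n \<subseteq> iv w (1 + n)" by (rule iv_mono) simp
  ultimately show ?thesis by auto
qed

lemma near_equal_intervals:
  assumes n: "2 \<le> n" "n + 2 \<le> CARD('p)"
    and d: "card (iv w' n - iv w n :: 'p::prime_card mod_ring set) \<le> 1"
  shows "w' = w \<or> w' = w + 1 \<or> w = w' + 1"
proof -
  define q where "q = pos (w' - w)"
  have q: "of_nat q = w' - w" "q < CARD('p)" by (auto simp: q_def pos_less)
  show ?thesis
  proof (cases "q = 0")
    case False
    have "of_nat q +o iv w n = iv w' n" by (simp add: translate_iv q)
    then have "min (min n q) (min (CARD('p) - q) (CARD('p) - n)) \<le> 1"
      using card_shift_diff_iv[of n q w] n d q(2) False by simp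
    then have "q = 1 \<or> q = CARD('p) - 1" using n q(2) False by linarith
    then have "w' - w = 1 \<or> w' - w = - 1" using q by (auto simp: of_nat_diff)
    then show ?thesis by (auto simp: algebra_simps)
  qed (use q in simp)
qed

lemma uminus_plus_image:
  "uminus ` (A + B) = uminus ` A + uminus ` (B :: 'a::ab_group_add set)"
proof (intro equalityI subsetI)
  fix x assume "x \<in> uminus ` (A + B)"
  then obtain a b where "a \<in> A" "b \<in> B" "x = - a + - b" by (auto simp: plus_mem_iff)
  then show "x \<in> uminus ` A + uminus ` B" by blast
next
  fix x assume "x \<in> uminus ` A + uminus ` B"
  then obtain a b where ab: "a \<in> A" "b \<in> B" "x = - (a + b)" by (auto simp: plus_mem_iff)
  have "a + b \<in> A + B" using ab by blast
  then show "x \<in> uminus ` (A + B)" unfolding ab(3) by (rule imageI)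
qed

lemma uminus_uminus_image [simp]: "uminus ` uminus ` A = (A :: 'a::group_add set)"
  by (simp add: image_image)

lemma card_uminus_image [simp]: "card (uminus ` A) = card (A :: 'a::group_add set)"
  by (simp add: card_image)

section \<open>The coefficient -1: differences of two disjoint sets\<close>

text \<open>Differences in both orders, i.e. the union of sums for the coefficients 1 and -1. The
  set is its own negative and, for disjoint sets, omits 0; these two properties drive all later
  comparisons.\<close>

definition sdiff :: "'p::prime_card mod_ring set \<Rightarrow> 'p mod_ring set \<Rightarrow> 'p mod_ring set" where
  "sdiff X Y = (X + uminus ` Y) \<union> (uminus ` X + Y)"

lemma sdiff_commute: "sdiff X Y = sdiff Y X"
  by (auto simp: sdiff_def add.commute)

lemma sdiff_eq: "sdiff X Y = (X + uminus ` Y) \<union> uminus ` (X + uminus ` Y)"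
  by (simp add: sdiff_def uminus_plus_image)

lemma uminus_sdiff: "uminus ` sdiff X Y = sdiff X Y"
  by (simp only: sdiff_eq image_Un uminus_uminus_image Un_commute)

lemma zero_notin_sdiff: "X \<inter> Y = {} \<Longrightarrow> 0 \<notin> sdiff X Y"
  by (auto simp: sdiff_def plus_mem_iff)

text \<open>The set \<open>W\<close> of differences \<open>y - x\<close> is an interval with
  \<open>k + l\<close> or \<open>k + l - 1\<close> elements, and \<open>sdiff X Y\<close> is
  \<open>W\<close> together with its negative. In the first case \<open>W\<close> equals its
  negative; in the second the negative starts at most one step away. Each possibility is the
  midpoint equation for a suitable interval from which \<open>Y\<close> arises by removing one
  point.\<close>

lemma sdiff_of_interval:
  fixes X Y :: "'p::prime_card mod_ring set"
  assumes X: "AP 1 X" and k: "card X \<ge> 3" and l: "card Y \<ge> 3" and p: "card X + card Y + 5 \<le> CARD('p)"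
    and dis: "X \<inter> Y = {}" and T: "card (sdiff X Y) \<le> card X + card Y"
  shows "AP 1 (sdiff X Y) \<and> opposite X Y"
proof -
  define k l where "k = card X" and "l = card Y"
  note kl = k[folded k_def] l[folded l_def] p[folded k_def l_def] T[folded k_def l_def]
  obtain s where s: "X = iv s k" using X by (auto simp: AP_1_iff k_def)
  have mX: "uminus ` X = iv (- s - of_nat (k - 1)) k" unfolding s using kl by (intro uminus_iv) simp
  define W where "W = Y + uminus ` X"
  have TW: "sdiff X Y = W \<union> uminus ` W"
    unfolding W_def sdiff_commute[of X Y] by (rule sdiff_eq)
  have WT: "card W \<le> card (sdiff X Y)" unfolding TW by (intro card_mono) auto
  have Y: "Y \<noteq> {}" using l by auto
  have le: "card (Y + iv (- s - of_nat (k - 1)) k) \<le> card Y + k - 1 + 1" "1 < k - 1"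
    "card (Y + iv (- s - of_nat (k - 1)) k) < CARD('p)"
    using WT kl unfolding W_def mX l_def by auto
  obtain u m where u: "Y \<subseteq> iv u m" "m \<le> l + 1" "1 \<le> m"
     "W = iv (u + (- s - of_nat (k - 1))) (m + k - 1)" "m + k - 1 < CARD('p)"
    using almost_interval_of_plus_iv[OF Y le] unfolding W_def mX l_def by blast
  have ml: "l \<le> m" using card_mono[OF _ u(1)] card_iv_le[of u m] by (simp add: l_def)
  define n w where "n = m + k - 1" and "w = u + (- s - of_nat (k - 1))"
  define w' where "w' = - w - of_nat (n - 1)"
  have W: "W = iv w n" using u by (simp add: n_def w_def)
  have n: "n \<ge> 5" "n + 5 \<le> CARD('p)" using ml kl u(2,3) by (auto simp: n_def)
  have mW: "uminus ` W = iv w' n" unfolding W w'_def using n by (intro uminus_iv) simp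
  have cW: "card W = n" using W n by simp
  have w2: "w = u - s - of_nat k + 1" using kl by (simp add: w_def of_nat_diff)
  have n2: "(of_nat (n - 1) :: 'p mod_ring) = of_nat m + of_nat k - 2"
    using kl ml by (simp add: n_def of_nat_diff)
  show ?thesis
  proof (cases "m = l + 1")
    case True
    then have "card W = k + l" using cW by (simp add: n_def)
    then have "W = sdiff X Y" "uminus ` W = sdiff X Y"
      using kl TW by (intro card_seteq; simp)+
    then have TI: "sdiff X Y = iv w n" "iv w n = iv w' n" using W mW by simp_all
    then have "w = w'" using iv_eq_iff[of n w w'] n by simp
    then have "2 * w + of_nat (n - 1) = 0" by (simp add: w'_def)
    then have eq: "2 * u + of_nat m = 2 * s + of_nat k" unfolding w2 n2 by (simp add: algebra_simps)
    have "card (iv u m - Y) = 1" using u True kl by (simp add: card_Diff_subset l_def)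
    then obtain z where "iv u m - Y = {z}" by (auto simp: card_1_singleton_iff)
    then have Yz: "Y = iv u m - {z}" using u by blast
    have "opposite X Y"
      by (rule oppositeI[OF s[unfolded k_def] Yz _ _ eq[unfolded k_def]]) (use True in \<open>simp_all add: l_def\<close>)
    moreover have "AP 1 (sdiff X Y)" unfolding AP_1_iff using TI n by (intro exI[of _ w]) simp
    ultimately show ?thesis by blast
  next
    case False
    then have m: "m = l" using ml u by simp
    have YI: "Y = iv u l"
      using u m kl by (intro card_seteq) (auto simp: l_def[symmetric])
    have "s \<in> X" using ivI[of 0 k s] kl s by simp
    then have sY: "s \<notin> Y" using dis by blast
    have "sdiff X Y = iv w n \<union> (iv w' n - iv w n)" using TW W mW by auto
    then have "card (sdiff X Y) = card (iv w n :: 'p mod_ring set) + card (iv w' n - iv w n)"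
      by (simp only:) (rule card_Un_disjoint, auto)
    then have "card (sdiff X Y) = n + card (iv w' n - iv w n)" using n by simp
    then have "card (iv w' n - iv w n) \<le> 1" using kl m by (simp add: n_def)
    then have "w' = w \<or> w' = w + 1 \<or> w = w' + 1" using n by (intro near_equal_intervals) auto
    then show ?thesis
    proof (elim disjE)
      assume e: "w' = w"
      then have "2 * w + of_nat (n - 1) = 0" by (simp add: w'_def algebra_simps)
      then have eq: "2 * u + of_nat l = 2 * s + of_nat k" unfolding w2 n2 m by (simp add: algebra_simps)
      \<comment> \<open>\<open>Y\<close> is already the full interval; \<open>s\<close> lies in
        \<open>X\<close>, hence not in \<open>Y\<close>, and serves as a dummy puncture.\<close>
      have Yz: "Y = iv u l - {s}" using YI sY by blast
      have "opposite X Y"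
        by (rule oppositeI[OF s[unfolded k_def] Yz _ _ eq[unfolded k_def]]) (use l in \<open>simp_all add: l_def\<close>)
      moreover have "AP 1 (sdiff X Y)" unfolding AP_1_iff using TW W mW e n by (intro exI[of _ w]) simp
      ultimately show ?thesis by blast
    next
      assume e: "w' = w + 1"
      then have "2 * w + of_nat (n - 1) + 1 = 0" by (simp add: w'_def algebra_simps)
      then have eq: "2 * u + of_nat (l + 1) = 2 * s + of_nat k" unfolding w2 n2 m by (simp add: algebra_simps)
      \<comment> \<open>\<open>Y\<close> is lengthened by one point, on the side that restores the
        midpoint equation, and punctured at that point.\<close>
      have "iv u (l + 1) = iv u l \<union> {u + of_nat l}" using iv_split[of u l 1] by simp
      moreover have "u + of_nat l \<notin> iv u l" using kl by (subst mem_iv_of_nat_iff) auto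
      ultimately have Yz: "Y = iv u (l + 1) - {u + of_nat l}" using YI by blast
      have "opposite X Y"
        by (rule oppositeI[OF s[unfolded k_def] Yz _ _ eq[unfolded k_def]]) (simp_all add: l_def)
      moreover have "sdiff X Y = iv w (n + 1)" using TW W mW e iv_Un_succ[of n w] n by simp
      then have "AP 1 (sdiff X Y)" unfolding AP_1_iff using n by (intro exI[of _ w]) simp
      ultimately show ?thesis by blast
    next
      assume e: "w = w' + 1"
      then have "2 * w + of_nat (n - 1) - 1 = 0" by (simp add: w'_def algebra_simps)
      then have eq: "2 * (u - 1) + of_nat (l + 1) = 2 * s + of_nat k" unfolding w2 n2 m by (simp add: algebra_simps)
      have "iv (u - 1) (1 + l) = iv (u - 1) 1 \<union> iv (u - 1 + of_nat 1) l" by (rule iv_split)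
      then have "iv (u - 1) (l + 1) = {u - 1} \<union> iv u l" by simp
      moreover have "u - 1 \<notin> iv u l"
      proof -
        have "u - 1 = u + of_nat (CARD('p) - 1)" by (simp add: of_nat_diff)
        moreover have "u + of_nat (CARD('p) - 1) \<notin> iv u l" using kl by (subst mem_iv_of_nat_iff) auto
        ultimately show ?thesis by simp
      qed
      ultimately have Yz: "Y = iv (u - 1) (l + 1) - {u - 1}" using YI by blast
      have "opposite X Y"
        by (rule oppositeI[OF s[unfolded k_def] Yz _ _ eq[unfolded k_def]]) (simp_all add: l_def)
      moreover have "sdiff X Y = iv w' (n + 1)" using TW W mW e iv_Un_succ[of n w'] n by (simp add: Un_commute)
      then have "AP 1 (sdiff X Y)" unfolding AP_1_iff using n by (intro exI[of _ w']) simp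
      ultimately show ?thesis by blast
    qed
  qed
qed

lemma almost_interval_ends:
  fixes X :: "'p::prime_card mod_ring set"
  assumes "X \<subseteq> iv s (card X + 1)" "\<not> AP 1 X"
  shows "s \<in> X" "s + of_nat (card X) \<in> X"
proof -
  have "iv s (1 + card X) = iv s 1 \<union> iv (s + of_nat 1) (card X)" by (rule iv_split)
  then have "s \<notin> X \<Longrightarrow> X \<subseteq> iv (s + 1) (card X)" using assms(1) by auto
  then show "s \<in> X" using assms(2) AP_1_I by blast
  have "iv s (card X + 1) = iv s (card X) \<union> iv (s + of_nat (card X)) 1" by (rule iv_split)
  then have "s + of_nat (card X) \<notin> X \<Longrightarrow> X \<subseteq> iv s (card X)" using assms(1) by auto
  then show "s + of_nat (card X) \<in> X" using assms(2) AP_1_I by blast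
qed

text \<open>If neither set is an interval, Vosper's theorem makes \<open>U\<close>, the differences
  \<open>x - y\<close>, large enough to be all of \<open>sdiff X Y\<close>, hence symmetric.
  \<open>U\<close> is an interval \<open>H\<close> minus one point and contains both ends of
  \<open>H\<close>, so \<open>H\<close> is symmetric too; its only hole is fixed by negation and
  therefore 0. Consequently the hulls of \<open>X\<close> and \<open>Y\<close> have the same
  midpoint and lengths of equal parity, so one contains the other, and two disjoint sets do not fit
  into the larger.\<close>

lemma sdiff_one_is_interval:
  fixes X Y :: "'p::prime_card mod_ring set"
  assumes X: "AAP 1 X" and Y: "AAP 1 Y" and k: "card X \<ge> 3" and l: "card Y \<ge> 3"
    and p: "card X + card Y + 5 \<le> CARD('p)"
    and dis: "X \<inter> Y = {}" and T: "card (sdiff X Y) \<le> card X + card Y"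
  shows "AP 1 X \<or> AP 1 Y"
proof (rule ccontr)
  assume "\<not> ?thesis"
  then have nX: "\<not> AP 1 X" and nY: "\<not> AP 1 Y" by auto
  define k l where "k = card X" and "l = card Y"
  note kl = k[folded k_def] l[folded l_def] p[folded k_def l_def] T[folded k_def l_def]
  obtain s where s: "X \<subseteq> iv s (k + 1)" using X by (auto simp: AAP_1_iff k_def)
  obtain v where v: "Y \<subseteq> iv v (l + 1)" using Y by (auto simp: AAP_1_iff l_def)
  have sk: "s \<in> X" "s + of_nat k \<in> X" using almost_interval_ends[OF s[unfolded k_def] nX] by (auto simp: k_def)
  have vl: "v \<in> Y" "v + of_nat l \<in> Y" using almost_interval_ends[OF v[unfolded l_def] nY] by (auto simp: l_def)
  define U where "U = X + uminus ` Y"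
  have TU: "sdiff X Y = U \<union> uminus ` U" unfolding U_def by (rule sdiff_eq)
  have "card U \<ge> k + l"
  proof (rule ccontr)
    assume "\<not> ?thesis"
    then have pre: "card X \<ge> 2" "card (uminus ` Y) \<ge> 2" "card (X + uminus ` Y) + 2 \<le> CARD('p)"
      "card (X + uminus ` Y) \<le> card X + card (uminus ` Y) - 1"
      using kl by (auto simp: U_def k_def l_def)
    obtain d where d: "AP d X" using Vosper[OF pre] by blast
    have "d = 1 \<or> d = - 1" using AAP_difference_unique[OF X AP_imp_AAP[OF d]] k p l by simp
    moreover have "X \<noteq> {}" using k by auto
    ultimately have "AP 1 X" using d AP_uminus[of X d] by auto
    then show False using nX by simp
  qed
  then have UT: "U = sdiff X Y" using kl TU by (intro card_seteq) auto
  then have mU: "uminus ` U = U" using uminus_sdiff by metis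
  have cU: "card U = k + l" using UT kl \<open>card U \<ge> k + l\<close> by simp
  define w n where "w = s - v - of_nat l" and "n = k + l + 1"
  define w' where "w' = - w - of_nat (n - 1)"
  define H where "H = iv w n"
  have n: "n \<ge> 7" "n + 4 \<le> CARD('p)" using kl by (auto simp: n_def)
  have "uminus ` Y \<subseteq> uminus ` iv v (l + 1)" using v by blast
  also have "\<dots> = iv (- v - of_nat l) (l + 1)" using uminus_iv[of "l + 1" v] by simp
  finally have "U \<subseteq> iv s (k + 1) + iv (- v - of_nat l) (l + 1)"
    unfolding U_def using s by (intro set_plus_mono2)
  also have "\<dots> = H" unfolding H_def w_def n_def by (subst iv_plus_iv) (auto simp: algebra_simps)
  finally have UH: "U \<subseteq> H" .
  have mH: "uminus ` H = iv w' n" unfolding H_def w'_def using n by (intro uminus_iv) simp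
  have Uw': "U \<subseteq> iv w' n" using image_mono[OF UH, of uminus] unfolding mU mH .
  have wU: "w \<in> U"
  proof -
    have "s + - (v + of_nat l) \<in> U" unfolding U_def using sk vl by (intro set_plus_intro imageI)
    then show ?thesis by (simp add: w_def algebra_simps)
  qed
  have wnU: "w + of_nat (n - 1) \<in> U"
  proof -
    have "(s + of_nat k) + - v \<in> U" unfolding U_def using sk vl by (intro set_plus_intro imageI)
    moreover have "(s + of_nat k) + - v = w + of_nat (n - 1)" by (simp add: w_def n_def algebra_simps)
    ultimately show ?thesis by simp
  qed
  have "card (iv w' n - iv w n) \<le> card (iv w' n - U)" using UH by (intro card_mono) (auto simp: H_def)
  also have "\<dots> = n - (k + l)" using Uw' n cU by (simp add: card_Diff_subset)
  finally have "card (iv w' n - iv w n) \<le> 1" by (simp add: n_def)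
  then have "w' = w \<or> w' = w + 1 \<or> w = w' + 1" using n by (intro near_equal_intervals) auto
  \<comment> \<open>A shift of the negative of \<open>H\<close> by one would exclude an end of
    \<open>H\<close>, although \<open>U\<close> contains that end and lies in both
    intervals.\<close>
  moreover have "w' \<noteq> w + 1"
  proof
    assume "w' = w + 1"
    then have "w = w' + of_nat (CARD('p) - 1)" by (simp add: of_nat_diff)
    then have "w' + of_nat (CARD('p) - 1) \<in> iv w' n" using wU Uw' by auto
    then show False using n by (subst (asm) mem_iv_of_nat_iff) auto
  qed
  moreover have "w \<noteq> w' + 1"
  proof
    assume "w = w' + 1"
    then have "w + of_nat (n - 1) = w' + of_nat n" using n by (simp add: of_nat_diff)
    then have "w' + of_nat n \<in> iv w' n" using wnU Uw' by auto
    then show False using n by (subst (asm) mem_iv_of_nat_iff) auto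
  qed
  ultimately have ww: "w' = w" by blast
  have mHH: "uminus ` H = H" using mH ww by (simp add: H_def)
  have "card (H - U) = 1" using UH cU n by (simp add: card_Diff_subset H_def) (simp add: n_def)
  then obtain z where z: "H - U = {z}" by (auto simp: card_1_singleton_iff)
  have "- z \<in> H - U"
  proof -
    have "z \<in> H" "z \<notin> U" using z by auto
    then have "- z \<in> uminus ` H" "- z \<notin> uminus ` U" by (auto simp: mem_uminus_image_iff)
    then show ?thesis using mHH mU by simp
  qed
  then have "- z = z" using z by blast
  then have "2 * z = 0" by (metis add.right_inverse mult_2)
  then have "z = 0" using numeral_ne_0(1)[where 'p='p] kl by simp
  then have "0 \<in> iv w n" using z by (auto simp: H_def)
  then obtain i where i: "i < n" "0 = w + of_nat i" by (rule ivE)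
  have w2: "2 * w + of_nat (n - 1) = 0" using ww by (simp add: w'_def algebra_simps)
  have wi: "w = - of_nat i" using i(2) by (metis add.inverse_unique add.commute minus_minus)
  have io: "of_nat (2 * i) = (of_nat (n - 1) :: 'p mod_ring)"
    using w2 unfolding wi by (simp add: algebra_simps)
  have "2 * i = n - 1"
  proof (cases "2 * i \<ge> n - 1")
    case True
    then have "of_nat (2 * i - (n - 1)) = (0 :: 'p mod_ring)" using io by (metis diff_self of_nat_diff)
    then have "2 * i - (n - 1) = 0" using n i by (subst (asm) of_nat_eq_0_iff_less) auto
    then show ?thesis using True by simp
  next
    case False
    then have "of_nat (n - 1 - 2 * i) = (0 :: 'p mod_ring)" using io by (metis diff_self of_nat_diff nat_le_linear)
    then have "n - 1 - 2 * i = 0" using n i by (subst (asm) of_nat_eq_0_iff_less) auto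
    then show ?thesis using False by simp
  qed
  then have par: "k + l = 2 * i" by (simp add: n_def)
  have c: "2 * s + of_nat k = 2 * v + of_nat l" using w2 by (simp add: w_def n_def algebra_simps)
  have two: "(2 :: 'p mod_ring) \<noteq> 0" using numeral_ne_0(1)[where 'p='p] kl by simp
  have contra: False if "X \<subseteq> iv v m" "Y \<subseteq> iv v m" "m < k + l" for v m
  proof -
    have "card (X \<union> Y) \<le> card (iv v m)" using that by (intro card_mono) auto
    also have "\<dots> \<le> m" by (rule card_iv_le)
    finally show False using dis that by (simp add: card_Un_disjoint k_def l_def)
  qed
  show False
  proof (cases "k \<le> l")
    case True
    define e where "e = i - k"
    have e: "k + 2 * e = l" using True par by (simp add: e_def)
    have "2 * s = 2 * (v + of_nat e)" using c unfolding e[symmetric] by (simp add: algebra_simps)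
    then have "s = v + of_nat e" using two by (metis mult_left_cancel)
    then have "iv s (k + 1) \<subseteq> iv v (l + 1)" using e by (simp only:) (rule iv_subset, simp)
    then show False using contra[of v "l + 1"] s v kl by auto
  next
    case False
    define e where "e = i - l"
    have e: "l + 2 * e = k" using False par by (simp add: e_def)
    have "2 * v = 2 * (s + of_nat e)" using c unfolding e[symmetric] by (simp add: algebra_simps)
    then have "v = s + of_nat e" using two by (metis mult_left_cancel)
    then have "iv v (l + 1) \<subseteq> iv s (k + 1)" using e by (simp only:) (rule iv_subset, simp)
    then show False using contra[of s "k + 1"] s v kl by auto
  qed
qed

text \<open>What comparing several pairs requires: a common difference, for which the symmetric set
  \<open>sdiff X Y\<close> is a progression too. The explicit form with intervals is stated
  separately, in \<open>two_sets\<close>.\<close>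

definition exceptional :: "'p::prime_card mod_ring \<Rightarrow> 'p mod_ring set \<Rightarrow> 'p mod_ring set \<Rightarrow> bool" where
  "exceptional r X Y \<longleftrightarrow> AAP r X \<and> AAP r Y \<and> AP r (sdiff X Y) \<and> card (sdiff X Y) \<le> card X + card Y"

lemma exceptional_commute: "exceptional r X Y \<Longrightarrow> exceptional r Y X"
  by (auto simp: exceptional_def sdiff_commute add.commute)

theorem two_sets:
  fixes X Y :: "'p::prime_card mod_ring set"
  assumes dis: "X \<inter> Y = {}" and X: "card X \<ge> 3" and Y: "card Y \<ge> 3"
    and p: "card X + card Y + 5 \<le> CARD('p)" and t: "t \<noteq> 0" "t \<noteq> 1"
    and le: "card ((X + t *o Y) \<union> (t *o X + Y)) \<le> card X + card Y"
  shows "t = - 1 \<and> (\<exists>r. exceptional r X Y \<and> (\<exists>x y c z. {X, Y} =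
               {r *o cyc_interval x y, r *o (cyc_interval (y + c) (x - c) - {z})}))"
proof -
  obtain r where t1: "t = - 1" and r: "AAP r X" "AAP r Y"
    using two_sets_critical[OF dis X Y p t le] by blast
  have r0: "r \<noteq> 0" using r by (simp add: AAP_def)
  have leT: "card (sdiff X Y) \<le> card X + card Y"
    using le unfolding t1 sdiff_def uminus_dilate .
  define X' Y' where "X' = inverse r *o X" and "Y' = inverse r *o Y"
  have XX: "X = r *o X'" "Y = r *o Y'" using r0 by (simp_all add: X'_def Y'_def dilate_inverse)
  have A: "AAP 1 X'" "AAP 1 Y'"
    using r AAP_dilate_iff[OF r0, of 1 X'] AAP_dilate_iff[OF r0, of 1 Y'] XX by simp_all
  have c: "card X' = card X" "card Y' = card Y" using XX r0 by simp_all
  have um: "uminus ` (r *o B) = r *o (uminus ` B)" for B by (simp add: dilate_eq_image image_image)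
  have T: "sdiff X Y = r *o sdiff X' Y'"
    unfolding sdiff_def XX um set_times_plus_distrib2[symmetric] by (simp add: dilate_eq_image image_Un)
  have dis': "X' \<inter> Y' = {}" using dis unfolding XX by (auto simp: dilate_eq_image)
  have pre: "3 \<le> card X'" "3 \<le> card Y'" "card X' + card Y' + 5 \<le> CARD('p)"
    "card (sdiff X' Y') \<le> card X' + card Y'" using X Y p leT c T r0 by simp_all
  have "AP 1 (sdiff X' Y') \<and> (opposite X' Y' \<or> opposite Y' X')"
    using sdiff_one_is_interval[OF A pre(1,2,3) dis' pre(4)]
  proof
    assume "AP 1 X'"
    then show ?thesis using sdiff_of_interval[OF _ pre(1,2,3) dis' pre(4)] by blast
  next
    assume "AP 1 Y'"
    then have "AP 1 (sdiff Y' X') \<and> opposite Y' X'"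
      using pre dis' by (intro sdiff_of_interval) (auto simp: sdiff_commute)
    then show ?thesis by (simp add: sdiff_commute)
  qed
  then have ap: "AP 1 (sdiff X' Y')" and op: "opposite X' Y' \<or> opposite Y' X'" by auto
  have "AP r (sdiff X Y)" using AP_dilate_iff[OF r0, of 1 "sdiff X' Y'"] ap T by simp
  then have "exceptional r X Y" using r leT by (simp add: exceptional_def)
  moreover have "\<exists>x y c z. {X, Y} = {r *o cyc_interval x y, r *o (cyc_interval (y + c) (x - c) - {z})}"
    using op
  proof
    assume "opposite X' Y'"
    then have "\<exists>x y c z. X' = cyc_interval x y \<and> Y' = cyc_interval (y + c) (x - c) - {z}"
      using pre by (intro opposite_cyc_intervals) auto
    then show ?thesis unfolding XX by blast
  next
    assume "opposite Y' X'"
    then have "\<exists>x y c z. Y' = cyc_interval x y \<and> X' = cyc_interval (y + c) (x - c) - {z}"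
      using pre by (intro opposite_cyc_intervals) auto
    then show ?thesis unfolding XX by blast
  qed
  ultimately have "exceptional r X Y \<and> (\<exists>x y c z. {X, Y} =
      {r *o cyc_interval x y, r *o (cyc_interval (y + c) (x - c) - {z})})" by (rule conjI)
  then have "\<exists>r. exceptional r X Y \<and> (\<exists>x y c z. {X, Y} =
      {r *o cyc_interval x y, r *o (cyc_interval (y + c) (x - c) - {z})})" by (rule exI)
  with t1 show ?thesis by (rule conjI)
qed

section \<open>Several sets\<close>

lemma AP_1_difference_unique:
  fixes S :: "'p::prime_card mod_ring set"
  assumes S: "AP 1 S" "AP d S" and c: "2 \<le> card S" "card S + 2 \<le> CARD('p)"
  shows "d = 1 \<or> d = - 1"
proof -
  define k where "k = card S"
  obtain s where s: "S = iv s k" using S by (auto simp: AP_1_iff k_def)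
  obtain v where d: "d \<noteq> 0" and v: "S = d *o iv v k" using S by (auto simp: AP_def k_def)
  have "(d +o S) - S \<subseteq> {d * (v + of_nat k)}"
  proof
    fix y assume y: "y \<in> (d +o S) - S"
    then have "y - d \<in> d *o iv v k" using v by (simp add: mem_translate_iff)
    then obtain i where i: "i < k" "y - d = d * (v + of_nat i)" unfolding dilate_eq_image iv_def by blast
    then have y': "y = d * (v + of_nat (Suc i))" by (simp add: algebra_simps)
    have "Suc i = k"
    proof (rule ccontr)
      assume "Suc i \<noteq> k"
      then have "Suc i < k" using i by simp
      then have "y \<in> S" unfolding v y' by blast
      then show False using y by simp
    qed
    then show "y \<in> {d * (v + of_nat k)}" using y' by blast
  qed
  then have "card ((d +o S) - S) \<le> card {d * (v + of_nat k)}" by (rule card_mono[rotated]) simp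
  then have "card (iv (d + s) k - iv s k) \<le> 1" by (simp add: s translate_iv)
  then have "d + s = s \<or> d + s = s + 1 \<or> s = d + s + 1"
    using c by (intro near_equal_intervals) (auto simp: k_def)
  then have "d = 0 \<or> d = 1 \<or> d + 1 = 0" by auto
  then show ?thesis using d by (auto simp: add_eq_0_iff2)
qed

lemma AP_difference_unique:
  fixes S :: "'p::prime_card mod_ring set"
  assumes S: "AP e S" "AP d S" and c: "2 \<le> card S" "card S + 2 \<le> CARD('p)"
  shows "d = e \<or> d = - e"
proof -
  have e: "e \<noteq> 0" using S by (simp add: AP_def)
  define S' where "S' = inverse e *o S"
  have S': "S = e *o S'" using e by (simp add: S'_def dilate_inverse)
  have "AP 1 S'" using AP_dilate_iff[OF e, of 1 S'] S S' by simp
  moreover have "AP (d / e) S'" using AP_dilate_iff[OF e, of "d / e" S'] S S' e by simp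
  moreover have "card S' = card S" using S' e by simp
  ultimately have "d / e = 1 \<or> d / e = - 1" using AP_1_difference_unique c by metis
  then show ?thesis using e by (auto simp: divide_eq_eq)
qed

lemma AP_same_direction:
  fixes S :: "'p::prime_card mod_ring set"
  assumes "AP e S" "AP d S" "2 \<le> card S" "card S + 2 \<le> CARD('p)" "AP d T" "T \<noteq> {}"
  shows "AP e T"
  using AP_difference_unique[OF assms(1-4)] AP_uminus[OF assms(6,5)] assms(5) by auto

text \<open>A proper symmetric interval of odd length contains its midpoint, which is its own
  negative and hence 0.\<close>

lemma symmetric_interval_even:
  fixes s :: "'p::prime_card mod_ring"
  assumes l: "0 < l" "l < CARD('p)" and sym: "uminus ` iv s l = iv s l" and z: "0 \<notin> iv s l"
    and two: "(2 :: 'p mod_ring) \<noteq> 0"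
  obtains q where "l = 2 * q" "2 * (s + of_nat q) = 1"
proof -
  have "iv (- s - of_nat (l - 1)) l = iv s l" using uminus_iv[of l s] sym l by simp
  then have "- s - of_nat (l - 1) = s" using iv_eq_iff[OF l] by blast
  then have eq: "2 * s + of_nat (l - 1) = 0" by (simp add: algebra_simps)
  show thesis
  proof (cases "even l")
    case True
    then obtain q where q: "l = 2 * q" by (auto elim: evenE)
    then have "2 * (s + of_nat q) = 1" using eq l by (simp add: of_nat_diff algebra_simps)
    then show thesis using q that by blast
  next
    case False
    then obtain q where q: "l = 2 * q + 1" by (auto elim: oddE)
    then have "2 * (s + of_nat q) = 0" using eq by (simp add: algebra_simps)
    then have "0 = s + of_nat q" using two by (metis mult_eq_0_iff)
    moreover have "s + of_nat q \<in> iv s l" using q by (intro ivI) simp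
    ultimately show thesis using z by simp
  qed
qed

text \<open>
  A symmetric interval avoiding 0 has even length and the same centre \<open>1/2\<close> (the antipode of 0),
  so any two of them are nested.
\<close>
lemma symmetric_AP_nested:
  fixes T T' :: "'p::prime_card mod_ring set"
  assumes T: "AP r T" "uminus ` T = T" "0 \<notin> T" and T': "AP r T'" "uminus ` T' = T'" "0 \<notin> T'"
    and two: "(2 :: 'p mod_ring) \<noteq> 0"
  shows "T \<subseteq> T' \<or> T' \<subseteq> T"
proof (cases "T = {} \<or> T' = {}")
  case False
  have r: "r \<noteq> 0" using T by (simp add: AP_def)
  have rep: "\<exists>s q. T = r *o iv s (2 * q) \<and> 2 * (s + of_nat q) = 1"
    if A: "AP r T" "uminus ` T = T" "0 \<notin> T" "T \<noteq> {}" for T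
  proof -
    obtain s where s: "T = r *o iv s (card T)" using A by (auto simp: AP_def)
    have lt: "0 < card T" "card T < CARD('p)"
    proof -
      show "0 < card T" using A by (simp add: card_gt_0_iff)
      have "card T < card (UNIV :: 'p mod_ring set)" using A(3) by (intro psubset_card_mono) auto
      then show "card T < CARD('p)" by simp
    qed
    have "r *o (uminus ` iv s (card T)) = uminus ` (r *o iv s (card T))"
      by (simp add: dilate_eq_image image_image)
    also have "\<dots> = r *o iv s (card T)" using A(2) unfolding s[symmetric] .
    finally have "r *o (uminus ` iv s (card T)) = r *o iv s (card T)" .
    then have sym: "uminus ` iv s (card T) = iv s (card T)" by (rule iffD1[OF dilate_eq_iff[OF r]])
    have z: "0 \<notin> iv s (card T)"
    proof
      assume "0 \<in> iv s (card T)"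
      then have "r * 0 \<in> r *o iv s (card T)" by (rule set_times_intro2)
      then show False using A(3) unfolding s[symmetric] by simp
    qed
    obtain q where "card T = 2 * q" "2 * (s + of_nat q) = 1"
      by (rule symmetric_interval_even[OF lt sym z two])
    then show ?thesis using s by (intro exI[of _ s] exI[of _ q]) simp
  qed
  obtain s q where sq1: "T = r *o iv s (2 * q)" "2 * (s + of_nat q) = 1"
    using rep[OF T] False by blast
  obtain s' q' where sq2: "T' = r *o iv s' (2 * q')" "2 * (s' + of_nat q') = 1"
    using rep[OF T'] False by blast
  note sq = sq1 sq2
  then have eq: "s + of_nat q = s' + of_nat q'" using two by (metis mult_left_cancel)
  have nest: "iv s (2 * q) \<subseteq> iv s' (2 * q')" if "q \<le> q'" "s + of_nat q = s' + of_nat q'"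
    for s s' :: "'p mod_ring" and q q'
  proof -
    have "s = s' + of_nat (q' - q)" using that by (simp add: of_nat_diff algebra_simps)
    then show ?thesis using that(1) by (simp only:) (rule iv_subset, simp)
  qed
  show ?thesis
  proof (cases "q \<le> q'")
    case True
    have "T \<subseteq> T'" unfolding sq using nest[OF True eq] by (rule set_times_mono)
    then show ?thesis ..
  next
    case False
    then have "q' \<le> q" by simp
    then have "T' \<subseteq> T" unfolding sq using nest[OF _ eq[symmetric]] by (intro set_times_mono)
    then show ?thesis ..
  qed
qed auto

lemma plus_uminus_Un_subset_sdiff: "X + uminus ` (Y \<union> Z) \<subseteq> sdiff X Y \<union> sdiff X Z"
  by (auto simp: sdiff_def image_Un set_plus_Un)

text \<open>The sets \<open>sdiff X Y\<close> and \<open>sdiff X Z\<close> are nested, so all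
  differences between \<open>X\<close> and \<open>Y \<union> Z\<close> fit into the larger one. It
  has at most \<open>card X + max (card Y) (card Z)\<close> elements, while Cauchy--Davenport
  demands \<open>card X + card Y + card Z - 1\<close>.\<close>

lemma exceptional_matching:
  fixes X Y Z :: "'p::prime_card mod_ring set"
  assumes e: "exceptional r X Y" "exceptional r' X Z"
    and dis: "X \<inter> Y = {}" "X \<inter> Z = {}" "Y \<inter> Z = {}"
    and c: "3 \<le> card X" "3 \<le> card Y" "3 \<le> card Z" "card X + card Y + card Z + 5 \<le> CARD('p)"
  shows False
proof -
  have two: "(2 :: 'p mod_ring) \<noteq> 0" using numeral_ne_0(1)[where 'p='p] c by simp
  have rr: "r' = r \<or> r' = - r"
    using e c by (intro AAP_difference_unique[of r X r']) (auto simp: exceptional_def)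
  have ne: "X \<noteq> {}" "Y \<noteq> {}" "Z \<noteq> {}" using c by auto
  then have "sdiff X Z \<noteq> {}" by (auto simp: sdiff_def plus_mem_iff)
  then have ap: "AP r (sdiff X Y)" "AP r (sdiff X Z)"
    using e rr AP_uminus[of "sdiff X Z" r'] by (auto simp: exceptional_def)
  have "sdiff X Y \<subseteq> sdiff X Z \<or> sdiff X Z \<subseteq> sdiff X Y"
    using symmetric_AP_nested[OF ap(1) uminus_sdiff _ ap(2) uminus_sdiff _ two] dis
    by (simp add: zero_notin_sdiff)
  then have "card (sdiff X Y \<union> sdiff X Z) \<le> max (card (sdiff X Y)) (card (sdiff X Z))"
    by (auto simp: Un_absorb1 Un_absorb2)
  also have "\<dots> \<le> card X + max (card Y) (card Z)" using e by (auto simp: exceptional_def)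
  finally have ub: "card (sdiff X Y \<union> sdiff X Z) \<le> card X + max (card Y) (card Z)" .
  have "card (X + uminus ` (Y \<union> Z)) \<le> card (sdiff X Y \<union> sdiff X Z)"
    by (intro card_mono plus_uminus_Un_subset_sdiff) simp
  moreover have "min CARD('p) (card X + card (uminus ` (Y \<union> Z)) - 1) \<le> card (X + uminus ` (Y \<union> Z))"
    using ne by (intro Cauchy_Davenport) auto
  moreover have "card (uminus ` (Y \<union> Z)) = card Y + card Z" using dis by (simp add: card_Un_disjoint)
  ultimately show False using ub c by auto
qed

section \<open>Intervals with a single different coefficient\<close>

text \<open>The length is written as a successor so that the empty sum \<open>{0}\<close> is
  covered, as an interval of length 1.\<close>

lemma sum_iv:
  assumes "finite I" "\<And>i. i \<in> I \<Longrightarrow> m i \<ge> 1"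
  shows "(\<Sum>i\<in>I. iv (s i) (m i)) = iv (\<Sum>i\<in>I. s i) (Suc (\<Sum>i\<in>I. m i - 1))"
  using assms
proof (induction I rule: finite_induct)
  case (insert x I)
  then have "(\<Sum>i\<in>insert x I. iv (s i) (m i)) = iv (s x) (m x) + iv (\<Sum>i\<in>I. s i) (Suc (\<Sum>i\<in>I. m i - 1))"
    by simp
  also have "\<dots> = iv (s x + (\<Sum>i\<in>I. s i)) (m x + Suc (\<Sum>i\<in>I. m i - 1) - 1)"
    using insert.prems by (intro iv_plus_iv) auto
  also have "m x + Suc (\<Sum>i\<in>I. m i - 1) - 1 = Suc (\<Sum>i\<in>insert x I. m i - 1)"
    using insert.hyps insert.prems[of x] by simp
  finally show ?case using insert.hyps by simp
qed simp

text \<open>Blocks of length \<open>lam\<close> placed at the multiples of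
  \<open>tau \<le> lam\<close> leave no gap between them.\<close>

lemma covering_steps:
  fixes r lam tau m :: nat
  assumes "r < lam + tau * m" "1 \<le> tau" "tau \<le> lam"
  shows "\<exists>i\<le>m. tau * i \<le> r \<and> r < tau * i + lam"
proof (cases "r div tau \<le> m")
  case True
  have "tau * (r div tau) \<le> r" by simp
  moreover have "r < tau * (r div tau) + tau"
    using assms(2) mult_div_mod_eq[of tau r] mod_less_divisor[of tau r] by linarith
  ultimately show ?thesis using True assms(3) by (intro exI[of _ "r div tau"]) linarith
next
  case False
  then have "tau * m \<le> tau * (r div tau)" by (intro mult_le_mono2) simp
  also have "\<dots> \<le> r" by simp
  finally have "tau * m \<le> r" .
  then show ?thesis using assms(1) by (intro exI[of _ m]) (simp add: mult.commute)
qed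

text \<open>In a window of width \<open>W < p / 2\<close> the relation
  \<open>2 * x1 = x0 + x2\<close> between three equidistant terms holds in the integers, so two
  steps together span at most \<open>W\<close>.\<close>

lemma three_term_step:
  fixes t :: "'p::prime_card mod_ring"
  assumes x: "z = u + of_nat x0" "z + t = u + of_nat x1" "z + t + t = u + of_nat x2"
    and le: "x0 \<le> W" "x1 \<le> W" "x2 \<le> W" "2 * W < CARD('p)"
  obtains c :: int where "t = of_int c" "2 * \<bar>c\<bar> \<le> int W"
proof -
  have "(z + t) - z = of_nat x1 - of_nat x0" by (subst x(2), subst x(1)) simp
  moreover have "(z + t + t) - (z + t) = of_nat x2 - of_nat x1" by (subst x(3), subst x(2)) simp
  ultimately have t: "t = of_nat x1 - of_nat x0" "t = of_nat x2 - of_nat x1" by simp_all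
  have "of_nat x1 + of_nat x1 = (of_nat x0 + of_nat x2 :: 'p mod_ring)"
    using t by (metis add_diff_eq diff_add_cancel diff_diff_eq2 add.commute)
  then have "(of_nat (x1 + x1) :: 'p mod_ring) = of_nat (x0 + x2)" by (simp only: of_nat_add)
  then have "x1 + x1 = x0 + x2"
    using le by (subst (asm) of_nat_eq_iff_less) auto
  then have "int x1 + int x1 = int x0 + int x2" by (metis of_nat_add)
  moreover have "0 \<le> int x0" "0 \<le> int x2" "int x0 \<le> int W" "int x2 \<le> int W" using le by simp_all
  ultimately have "2 * \<bar>int x1 - int x0\<bar> \<le> int W" by presburger
  moreover have "t = of_int (int x1 - int x0)" using t(1) by simp
  ultimately show thesis using that by blast
qed

text \<open>
  The exceptional coefficient \<open>t\<close> is a small integer, as \<open>S\<close> is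
  a short interval. If \<open>\<bar>t\<bar> \<ge> 2\<close>, then \<open>S\<close> contains translates by \<open>(t - 1) * f j\<close>, one for each
  \<open>j\<close>, of an interval with \<open>M + 2\<close> elements; if \<open>t = - 1\<close>, the three central elements of
  each interval can play the role of \<open>f j\<close> for an interval with \<open>M - 5\<close> elements.
\<close>
lemma intervals_one_coefficient:
  fixes s :: "'i \<Rightarrow> 'p::prime_card mod_ring" and k :: "'i \<Rightarrow> nat"
  assumes fin: "finite I" and n: "card I \<ge> 3" and k: "\<And>i. i \<in> I \<Longrightarrow> k i \<ge> 3"
    and dis: "disjoint_family_on (\<lambda>i. iv (s i) (k i)) I" and p: "(\<Sum>i\<in>I. k i) + 5 \<le> CARD('p)"
    and t: "t \<noteq> 0" "t \<noteq> 1" "t \<noteq> - 1 \<or> card I \<ge> 4"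
    and sub: "\<And>j. j \<in> I \<Longrightarrow> (\<Sum>i\<in>I - {j}. iv (s i) (k i)) + t *o iv (s j) (k j) \<subseteq> S"
    and S: "AP 1 S" "card S \<le> (\<Sum>i\<in>I. k i)"
  shows False
proof -
  define m M sg where "m i = k i - 1" and "M = (\<Sum>i\<in>I. m i)" and "sg = (\<Sum>i\<in>I. s i)" for i
  define n where "n = card I"
  have n3: "n \<ge> 3" using n by (simp add: n_def)
  have m2: "m i \<ge> 2" "k i = Suc (m i)" if "i \<in> I" for i using k[OF that] by (auto simp: m_def)
  have "(\<Sum>i\<in>I. k i) = (\<Sum>i\<in>I. m i + 1)" using m2 by (intro sum.cong) auto
  then have kM: "(\<Sum>i\<in>I. k i) = M + n" by (simp only: sum.distrib M_def n_def) simp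
  have mM: "m j \<le> M" if "j \<in> I" for j unfolding M_def using fin that by (intro member_le_sum) auto
  have base: "iv (sg - s j + t * x) (Suc (M - m j)) \<subseteq> S" if j: "j \<in> I" "x \<in> iv (s j) (k j)" for j x
  proof -
    have e1: "(\<Sum>i\<in>I - {j}. s i) = sg - s j" using fin j by (simp add: sum_diff1 sg_def)
    have e2: "(\<Sum>i\<in>I - {j}. k i - 1) = M - m j" using fin j by (simp add: sum_diff1_nat M_def m_def)
    have "(\<Sum>i\<in>I - {j}. iv (s i) (k i)) = iv (sg - s j) (Suc (M - m j))"
      unfolding e1[symmetric] e2[symmetric] using fin k by (intro sum_iv) force+
    moreover have "(t * x) +o iv (sg - s j) (Suc (M - m j)) \<subseteq> iv (sg - s j) (Suc (M - m j)) + t *o iv (s j) (k j)"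
      using j by (intro set_plus_mono4) auto
    ultimately show ?thesis using sub[OF j(1)] by (simp add: translate_iv add.commute)
  qed
  have ne: "I \<noteq> {}" using n by auto
  have "Min (m ` I) \<in> m ` I" using fin ne by simp
  then obtain j0 where j0: "j0 \<in> I" "m j0 = Min (m ` I)" by auto
  then have mmin: "m j0 \<le> m j" if "j \<in> I" for j using fin that by simp
  have rest: "(n - 1) * m j0 \<le> M - m j" if "j \<in> I" for j
  proof -
    have "of_nat (card (I - {j})) * m j0 \<le> (\<Sum>i\<in>I - {j}. m i)" using mmin by (intro sum_bounded_below) auto
    then show ?thesis using fin that by (simp add: sum_diff1_nat M_def n_def)
  qed
  obtain u N where SN: "S = iv u N" "N \<le> M + n" "N < CARD('p)"
    using S kM p by (auto simp: AP_1_iff)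
  \<comment> \<open>An interval of \<open>M - m j0 + 1\<close> elements inside one of at most
    \<open>M + n\<close> elements has offset at most \<open>W\<close>.\<close>
  define W where "W = m j0 + n - 1"
  have prod: "2 * m j0 + 2 * n \<le> (n - 1) * m j0 + m j0 + 4"
  proof -
    obtain a b where "m j0 = a + 2" "n = b + 3"
      using m2(1)[OF j0(1)] n3 by (metis add.commute le_Suc_ex)
    then show ?thesis by (simp add: algebra_simps)
  qed
  have W: "2 * W < CARD('p)" using prod rest[OF j0(1)] mM[OF j0(1)] p kM n3 unfolding W_def by linarith
  have off: "\<exists>x\<le>W. sg - s j0 + t * (s j0 + of_nat i) = u + of_nat x" if "i \<le> 2" for i
  proof -
    have "s j0 + of_nat i \<in> iv (s j0) (k j0)" using that k[OF j0(1)] by (intro ivI) linarith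
    then have "iv (sg - s j0 + t * (s j0 + of_nat i)) (Suc (M - m j0)) \<subseteq> iv u N"
      using base[OF j0(1)] SN by blast
    then obtain x where x: "sg - s j0 + t * (s j0 + of_nat i) = u + of_nat x" "x + Suc (M - m j0) \<le> N"
      using SN(3) by (auto elim: iv_subset_offset)
    then have "x \<le> W" using SN(2) mM[OF j0(1)] n3 unfolding W_def by linarith
    then show ?thesis using x by blast
  qed
  obtain x0 x1 x2 where x: "x0 \<le> W" "x1 \<le> W" "x2 \<le> W"
    "sg - s j0 + t * (s j0 + of_nat 0) = u + of_nat x0"
    "sg - s j0 + t * (s j0 + of_nat 1) = u + of_nat x1"
    "sg - s j0 + t * (s j0 + of_nat 2) = u + of_nat x2"
    using off[of 0] off[of 1] off[of 2] by (auto simp del: of_nat_0 of_nat_1 of_nat_numeral)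
  define z where "z = sg - s j0 + t * s j0"
  have xz: "z = u + of_nat x0" "z + t = u + of_nat x1" "z + t + t = u + of_nat x2"
    unfolding x(4,5,6)[symmetric] z_def by (simp_all add: algebra_simps)
  obtain c where c: "t = of_int c" "2 * \<bar>c\<bar> \<le> int W"
    by (rule three_term_step[OF xz x(1-3) W])
  \<comment> \<open>The shift \<open>t\<close> is no longer than any of the blocks with
    \<open>M - m j + 1\<close> elements, so blocks for neighbouring elements of one interval leave
    no gap.\<close>
  have clam: "\<bar>c\<bar> \<le> int (Suc (M - m j))" if "j \<in> I" for j
  proof -
    obtain a b where ab: "m j0 = a + 2" "n = b + 3"
      using m2(1)[OF j0(1)] n3 by (metis add.commute le_Suc_ex)
    have "m j0 + n \<le> 2 * ((n - 1) * m j0) + 1" unfolding ab by (simp add: algebra_simps)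
    then show ?thesis using rest[OF that] c(2) unfolding W_def by linarith
  qed
  have c01: "c \<noteq> 0" "c \<noteq> 1" using t c by auto
  have CD: "card V + card Z - 1 \<le> M + n" if "V + Z \<subseteq> S" "V \<noteq> {}" "Z \<noteq> {}" for V Z
  proof -
    have "card (V + Z) \<le> card S" using that by (intro card_mono) auto
    moreover have "min CARD('p) (card V + card Z - 1) \<le> card (V + Z)" using that by (intro Cauchy_Davenport)
    ultimately show ?thesis using S kM p by linarith
  qed
  have Mp: "M + 2 \<le> CARD('p)" using p kM by simp
  \<comment> \<open>Disjointness makes the \<open>n\<close> translations distinct, and
    Cauchy--Davenport yields \<open>(M + 2) + n - 1\<close> elements, one more than \<open>S\<close>
    can have.\<close>
  have big: False if f: "\<And>j. j \<in> I \<Longrightarrow> f j \<in> iv (s j) (k j)"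
      "\<And>j. j \<in> I \<Longrightarrow> iv (sg + (t - 1) * f j) (M + 2) \<subseteq> S" for f
  proof -
    have inj: "inj_on (\<lambda>j. (t - 1) * f j) I"
    proof (rule inj_onI)
      fix i j assume ij: "i \<in> I" "j \<in> I" "(t - 1) * f i = (t - 1) * f j"
      then have "f i = f j" using t by simp
      then have "f i \<in> iv (s i) (k i) \<inter> iv (s j) (k j)" using f(1)[OF ij(1)] f(1)[OF ij(2)] by simp
      then show "i = j" using dis ij unfolding disjoint_family_on_def by blast
    qed
    have "iv sg (M + 2) + (\<lambda>j. (t - 1) * f j) ` I \<subseteq> S"
    proof
      fix y assume "y \<in> iv sg (M + 2) + (\<lambda>j. (t - 1) * f j) ` I"
      then obtain a j where a: "a \<in> iv sg (M + 2)" "j \<in> I" "y = a + (t - 1) * f j" by (auto simp: plus_mem_iff)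
      then obtain i where "i < M + 2" "a = sg + of_nat i" by (auto elim: ivE)
      then have "y = sg + (t - 1) * f j + of_nat i" "i < M + 2" using a by (simp_all add: algebra_simps)
      then show "y \<in> S" using f(2)[OF a(2)] by (metis ivI subsetD)
    qed
    then have "card (iv sg (M + 2)) + card ((\<lambda>j. (t - 1) * f j) ` I) - 1 \<le> M + n"
      using ne by (intro CD) auto
    then show False using Mp n3 by (simp add: card_image[OF inj] n_def)
  qed
  consider "c \<ge> 2" | "c \<le> -2" | "c = -1" using c01 by linarith
  then show False
  proof cases
    case 1
    define tau where "tau = nat c"
    have tau: "t = of_nat tau" "tau \<ge> 2" using c 1 by (auto simp: tau_def)
    show False
    proof (rule big[of s])
      fix j assume j: "j \<in> I"
      show "s j \<in> iv (s j) (k j)" using ivI[of 0 "k j" "s j"] k[OF j] by simp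
      have tl: "tau \<le> Suc (M - m j)" using clam[OF j] 1 by (simp add: tau_def)
      show "iv (sg + (t - 1) * s j) (M + 2) \<subseteq> S"
      proof
        fix y assume "y \<in> iv (sg + (t - 1) * s j) (M + 2)"
        then obtain r where r: "r < M + 2" "y = sg + (t - 1) * s j + of_nat r" by (rule ivE)
        have "2 * m j \<le> tau * m j" using tau by simp
        then have "r < Suc (M - m j) + tau * m j" using r m2(1)[OF j] mM[OF j] by linarith
        then obtain i where i: "i \<le> m j" "tau * i \<le> r" "r < tau * i + Suc (M - m j)"
          using covering_steps[of r "Suc (M - m j)" tau "m j"] tau tl by auto
        have "y = sg - s j + t * (s j + of_nat i) + of_nat (r - tau * i)"
          using r i by (simp add: tau of_nat_diff algebra_simps)
        moreover have "r - tau * i < Suc (M - m j)" using i by linarith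
        moreover have "s j + of_nat i \<in> iv (s j) (k j)" using i m2(2)[OF j] by (intro ivI) simp
        ultimately show "y \<in> S" using base[OF j] by (metis ivI subsetD)
      qed
    qed
  next
    case 2
    define mu where "mu = nat (- c)"
    have mu: "t = - of_nat mu" "mu \<ge> 2" using c 2 by (auto simp: mu_def)
    define b where "b j = m j div 2" for j
    show False
    proof (rule big[of "\<lambda>j. s j + of_nat (m j - b j)"])
      fix j assume j: "j \<in> I"
      show "s j + of_nat (m j - b j) \<in> iv (s j) (k j)" using m2(2)[OF j] by (intro ivI) simp
      have tl: "mu \<le> Suc (M - m j)" using clam[OF j] 2 by (simp add: mu_def)
      \<comment> \<open>The distance from the start of the union of all blocks to the start of the
        required window; taking \<open>f j\<close> near the middle of its interval leaves room on
        both sides.\<close>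
      define g where "g = (mu + 1) * b j - m j"
      have "3 * b j \<le> (mu + 1) * b j" using mu by (intro mult_le_mono1) simp
      then have gm: "g + m j = (mu + 1) * b j" using m2(1)[OF j] unfolding g_def b_def by linarith
      have "(mu + 1) * (2 * b j) \<le> (mu + 1) * m j" by (intro mult_le_mono2) (simp add: b_def)
      then have "2 * ((mu + 1) * b j) \<le> (mu + 1) * m j" by (simp only: mult.left_commute)
      moreover have "(mu + 1) * m j < (2 * mu) * m j" using mu m2(1)[OF j] by (intro mult_less_mono1) auto
      ultimately have gm2: "g + m j < mu * m j" unfolding gm mult.assoc by linarith
      show "iv (sg + (t - 1) * (s j + of_nat (m j - b j))) (M + 2) \<subseteq> S"
      proof
        fix y assume "y \<in> iv (sg + (t - 1) * (s j + of_nat (m j - b j))) (M + 2)"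
        then obtain r where r: "r < M + 2" "y = sg + (t - 1) * (s j + of_nat (m j - b j)) + of_nat r" by (rule ivE)
        have "g + r < Suc (M - m j) + mu * m j" using r gm2 mM[OF j] by linarith
        then obtain i where i: "i \<le> m j" "mu * i \<le> g + r" "g + r < mu * i + Suc (M - m j)"
          using covering_steps[of "g + r" "Suc (M - m j)" mu "m j"] mu tl by auto
        have bm: "b j \<le> m j" by (simp add: b_def)
        have gg: "(of_nat g :: 'p mod_ring) = (of_nat mu + 1) * of_nat (b j) - of_nat (m j)"
          using arg_cong[OF gm, of "of_nat :: nat \<Rightarrow> 'p mod_ring"] by (simp add: algebra_simps)
        have "y = sg - s j + t * (s j + of_nat (m j - i)) + of_nat (g + r - mu * i)"
          unfolding r(2) of_nat_diff[OF bm] of_nat_diff[OF i(1)] of_nat_diff[OF i(2)] of_nat_add gg mu(1)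
          by (simp add: algebra_simps)
        moreover have "g + r - mu * i < Suc (M - m j)" using i by linarith
        moreover have "s j + of_nat (m j - i) \<in> iv (s j) (k j)" using m2(2)[OF j] by (intro ivI) simp
        ultimately show "y \<in> S" using base[OF j] by (metis ivI subsetD)
      qed
    qed
  next
    case 3
    then have t1: "t = - 1" using c by simp
    then have n4: "n \<ge> 4" using t by (simp add: n_def)
    define q where "q j = m j div 2" for j
    \<comment> \<open>With three elements from each interval, \<open>(M - 5) + 3 * n - 1\<close>
      exceeds \<open>M + n\<close> exactly when \<open>n \<ge> 4\<close>; this is why the
      coefficient -1 needs four sets.\<close>
    define U where "U = (\<Union>j\<in>I. iv (s j + of_nat (q j - 1)) 3)"
    have Uj: "iv (s j + of_nat (q j - 1)) 3 \<subseteq> iv (s j) (k j)" if "j \<in> I" for j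
      using m2[OF that] unfolding q_def by (intro iv_subset) linarith
    have "card U = (\<Sum>j\<in>I. card (iv (s j + of_nat (q j - 1)) 3))"
      unfolding U_def using fin Uj dis
      by (intro card_UN_disjoint) (auto simp: disjoint_family_on_def, blast)
    then have cU: "card U = 3 * n" using p n3 kM by (simp add: n_def)
    have M8: "8 \<le> M"
    proof -
      have "(n - 1) * 2 \<le> (n - 1) * m j0" using m2(1)[OF j0(1)] by (rule mult_le_mono2)
      then show ?thesis using rest[OF j0(1)] mM[OF j0(1)] m2(1)[OF j0(1)] n4 by linarith
    qed
    have "iv (sg + 3) (M - 5) + (\<lambda>x. - 2 * x) ` U \<subseteq> S"
    proof
      fix y assume "y \<in> iv (sg + 3) (M - 5) + (\<lambda>x. - 2 * x) ` U"
      then obtain a x where a: "a \<in> iv (sg + 3) (M - 5)" "x \<in> U" "y = a + - 2 * x" by (auto simp: plus_mem_iff)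
      obtain i where i: "i < M - 5" "a = sg + 3 + of_nat i" using a(1) by (rule ivE)
      obtain j where j: "j \<in> I" "x \<in> iv (s j + of_nat (q j - 1)) 3" using a(2) by (auto simp: U_def)
      obtain al' where al': "al' < 3" "x = s j + of_nat (q j - 1) + of_nat al'" using j(2) by (rule ivE)
      define al where "al = q j - 1 + al'"
      have x: "x = s j + of_nat al" using al' by (simp add: al_def)
      have al: "2 * al \<le> m j + 3 + i" "m j + 3 \<le> 2 * al + 6"
      proof -
        have "2 * q j \<le> m j" "m j \<le> 2 * q j + 1" "1 \<le> q j" using m2(1)[OF j(1)] unfolding q_def by simp_all
        then show "2 * al \<le> m j + 3 + i" "m j + 3 \<le> 2 * al + 6" using al'(1) unfolding al_def by simp_all
      qed
      define e where "e = m j + 3 + i - 2 * al"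
      have e: "e < Suc (M - m j) + 1 * m j" using al i mM[OF j(1)] M8 unfolding e_def by linarith
      obtain i' where i': "i' \<le> m j" "1 * i' \<le> e" "e < 1 * i' + Suc (M - m j)"
        using covering_steps[OF e] by auto
      have ee: "(of_nat e :: 'p mod_ring) = of_nat (m j) + 3 + of_nat i - 2 * of_nat al"
        unfolding e_def using al(1) by (simp add: of_nat_diff)
      have i'e: "i' \<le> e" using i' by simp
      have "y = sg - s j + t * (s j + of_nat (m j - i')) + of_nat (e - i')"
        unfolding a(3) i(2) x of_nat_diff[OF i'(1)] of_nat_diff[OF i'e] ee t1
        by (simp add: algebra_simps)
      moreover have "e - i' < Suc (M - m j)" using i' by linarith
      moreover have "s j + of_nat (m j - i') \<in> iv (s j) (k j)" using m2(2)[OF j(1)] by (intro ivI) simp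
      ultimately show "y \<in> S" using base[OF j(1)] by (metis ivI subsetD)
    qed
    moreover have "U \<noteq> {}" using cU n3 by auto
    ultimately have "card (iv (sg + 3) (M - 5)) + card ((\<lambda>x. - 2 * x) ` U) - 1 \<le> M + n"
      using M8 by (intro CD) auto
    moreover have "card ((\<lambda>x. - 2 * x) ` U) = 3 * n"
      using numeral_ne_0(1)[where 'p='p] p kM n3 M8 cU by (subst card_image) (auto simp: inj_on_def)
    moreover have "card (iv (sg + 3) (M - 5)) = M - 5" using Mp by (intro card_iv) simp
    ultimately show False using n4 M8 by linarith
  qed
qed

section \<open>Assignments of coefficients to sets\<close>

text \<open>Sets and coefficients are indexed separately and matched by bijections, so that an index
  can be removed on each side independently. For \<open>I = J\<close> the bijections amount to the
  permutations of \<open>I\<close>.\<close>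

definition perm_sums ::
  "'i set \<Rightarrow> 'j set \<Rightarrow> ('i \<Rightarrow> 'p::prime_card mod_ring set) \<Rightarrow> ('j \<Rightarrow> 'p mod_ring) \<Rightarrow> 'p mod_ring set" where
  "perm_sums I J X a = (\<Union>\<sigma>\<in>{\<sigma>. bij_betw \<sigma> I J}. \<Sum>i\<in>I. a (\<sigma> i) *o X i)"

definition two_coeffs ::
  "'p::prime_card mod_ring \<Rightarrow> 'p mod_ring \<Rightarrow> 'p mod_ring set \<Rightarrow> 'p mod_ring set \<Rightarrow> 'p mod_ring set" where
  "two_coeffs b c X Y = (b *o X + c *o Y) \<union> (c *o X + b *o Y)"

definition admissible :: "('i \<Rightarrow> 'p::prime_card mod_ring set) \<Rightarrow> 'i set \<Rightarrow> bool" where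
  "admissible X I \<longleftrightarrow> finite I \<and> disjoint_family_on X I \<and> (\<forall>i\<in>I. 3 \<le> card (X i)) \<and>
     (\<Sum>i\<in>I. card (X i)) + 5 \<le> CARD('p)"

lemma perm_sums_remove:
  assumes "finite I" "i \<in> I" "u \<in> J"
  shows "a u *o X i + perm_sums (I - {i}) (J - {u}) X a \<subseteq> perm_sums I J X a"
proof
  fix y assume "y \<in> a u *o X i + perm_sums (I - {i}) (J - {u}) X a"
  then obtain b c where b: "b \<in> a u *o X i" "c \<in> perm_sums (I - {i}) (J - {u}) X a" "y = b + c"
    by (auto simp: plus_mem_iff)
  then obtain \<sigma> where s: "bij_betw \<sigma> (I - {i}) (J - {u})" "c \<in> (\<Sum>k\<in>I - {i}. a (\<sigma> k) *o X k)"
    by (auto simp: perm_sums_def)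
  define \<tau> where "\<tau> = \<sigma>(i := u)"
  have "bij_betw \<tau> (I - {i}) (J - {u})" using s(1) by (rule bij_betw_cong[THEN iffD1, rotated]) (auto simp: \<tau>_def)
  moreover have "bij_betw \<tau> {i} {u}" by (simp add: \<tau>_def bij_betw_def)
  ultimately have "bij_betw \<tau> ((I - {i}) \<union> {i}) ((J - {u}) \<union> {u})" by (rule bij_betw_combine) auto
  moreover have "(I - {i}) \<union> {i} = I" "(J - {u}) \<union> {u} = J" using assms by auto
  ultimately have bt: "bij_betw \<tau> I J" by simp
  have "(\<Sum>k\<in>I. a (\<tau> k) *o X k) = a (\<tau> i) *o X i + (\<Sum>k\<in>I - {i}. a (\<tau> k) *o X k)"
    using assms by (intro sum.remove) auto
  also have "(\<Sum>k\<in>I - {i}. a (\<tau> k) *o X k) = (\<Sum>k\<in>I - {i}. a (\<sigma> k) *o X k)"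
    by (intro sum.cong) (auto simp: \<tau>_def)
  finally have "y \<in> (\<Sum>k\<in>I. a (\<tau> k) *o X k)" using b s by (auto simp: \<tau>_def)
  then show "y \<in> perm_sums I J X a" using bt by (auto simp: perm_sums_def)
qed

lemma perm_sums_empty: "perm_sums {} {} X a = {0}"
  by (auto simp: perm_sums_def bij_betw_def)

lemma perm_sums_remove2:
  assumes "finite I" "i \<in> I" "j \<in> I" "i \<noteq> j" "u \<in> J" "v \<in> J" "u \<noteq> v"
  shows "two_coeffs (a u) (a v) (X i) (X j) + perm_sums (I - {i, j}) (J - {u, v}) X a \<subseteq> perm_sums I J X a"
proof -
  have half: "(a u *o X i + a v *o X j) + perm_sums (I - {i, j}) (J - {u, v}) X a \<subseteq> perm_sums I J X a"
    if "u \<in> J" "v \<in> J" "u \<noteq> v" for u v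
  proof -
    have "a v *o X j + perm_sums (I - {i} - {j}) (J - {u} - {v}) X a \<subseteq> perm_sums (I - {i}) (J - {u}) X a"
      using assms that by (intro perm_sums_remove) auto
    then have "a u *o X i + (a v *o X j + perm_sums (I - {i} - {j}) (J - {u} - {v}) X a)
        \<subseteq> a u *o X i + perm_sums (I - {i}) (J - {u}) X a" by (intro set_plus_mono2) auto
    also have "\<dots> \<subseteq> perm_sums I J X a" using assms that by (intro perm_sums_remove) auto
    finally show ?thesis by (simp only: add.assoc Diff_insert2[symmetric])
  qed
  have "(a v *o X i + a u *o X j) + perm_sums (I - {i, j}) (J - {u, v}) X a \<subseteq> perm_sums I J X a"
    using half[of v u] assms by (simp add: insert_commute)
  then show ?thesis using half[of u v] assms by (simp add: two_coeffs_def Un_set_plus)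
qed

lemma perm_sums_two:
  assumes "i \<noteq> j" "u \<noteq> v"
  shows "two_coeffs (a u) (a v) (X i) (X j) \<subseteq> perm_sums {i, j} {u, v} X a"
  using perm_sums_remove2[of "{i, j}" i j u "{u, v}" v a X] assms by (simp add: perm_sums_empty)

lemma perm_sums_three:
  assumes "i \<noteq> j" "i \<noteq> l" "j \<noteq> l" "u \<noteq> v" "u \<noteq> w" "v \<noteq> w"
  shows "a u *o X l + two_coeffs (a v) (a w) (X i) (X j) \<subseteq> perm_sums {i, j, l} {u, v, w} X a"
proof -
  have "{i, j, l} - {l} = {i, j}" "{u, v, w} - {u} = {v, w}" using assms by auto
  then have "a u *o X l + perm_sums {i, j} {v, w} X a \<subseteq> perm_sums {i, j, l} {u, v, w} X a"
    using perm_sums_remove[of "{i, j, l}" l u "{u, v, w}" a X] by simp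
  moreover have "a u *o X l + two_coeffs (a v) (a w) (X i) (X j) \<subseteq> a u *o X l + perm_sums {i, j} {v, w} X a"
    using assms by (intro set_plus_mono2 perm_sums_two) auto
  ultimately show ?thesis by (rule order_trans[rotated])
qed

lemma two_coeffs_dilate:
  assumes "b \<noteq> 0"
  shows "two_coeffs b c X Y = b *o ((X + (c / b) *o Y) \<union> ((c / b) *o X + Y))"
proof -
  have "c *o Z = b *o ((c / b) *o Z)" for Z using assms by (simp add: set_times_rearrange2)
  then have "two_coeffs b c X Y = (b *o X + b *o ((c / b) *o Y)) \<union> (b *o ((c / b) *o X) + b *o Y)"
    unfolding two_coeffs_def by metis
  then show ?thesis unfolding set_times_plus_distrib2[symmetric] by (simp add: dilate_eq_image image_Un)
qed

lemma two_coeffs_opposite: "two_coeffs b (- b) X Y = b *o sdiff X Y"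
proof -
  have "(- b) *o Z = b *o (uminus ` Z)" for Z by (rule dilate_uminus)
  then have "two_coeffs b (- b) X Y = b *o (X + uminus ` Y) \<union> b *o (uminus ` X + Y)"
    unfolding two_coeffs_def set_times_plus_distrib2 by simp
  then show ?thesis unfolding sdiff_def by (simp add: dilate_eq_image image_Un)
qed

lemma two_coeffs_cases:
  fixes X Y :: "'p::prime_card mod_ring set"
  assumes "X \<inter> Y = {}" "card X \<ge> 3" "card Y \<ge> 3" "card X + card Y + 5 \<le> CARD('p)"
    and b: "b \<noteq> 0" "c \<noteq> 0" "b \<noteq> c"
  shows "card X + card Y + 1 \<le> card (two_coeffs b c X Y) \<or>
    c = - b \<and> (\<exists>r. exceptional r X Y \<and> (\<exists>x y e z. {X, Y} =
               {r *o cyc_interval x y, r *o (cyc_interval (y + e) (x - e) - {z})}))"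
proof (cases "card (two_coeffs b c X Y) \<le> card X + card Y")
  case True
  then have le: "card ((X + (c / b) *o Y) \<union> ((c / b) *o X + Y)) \<le> card X + card Y"
    using two_coeffs_dilate[OF b(1)] b(1) by (metis card_dilate)
  have t: "c / b \<noteq> 0" "c / b \<noteq> 1" using b by auto
  have T: "c / b = - 1 \<and> (\<exists>r. exceptional r X Y \<and> (\<exists>x y e z. {X, Y} =
               {r *o cyc_interval x y, r *o (cyc_interval (y + e) (x - e) - {z})}))"
    by (rule two_sets[OF assms(1-4) t le])
  then have "c = - b" using b by (simp add: divide_eq_eq)
  then show ?thesis using conjunct2[OF T] by (intro disjI2 conjI)
qed simp

lemma admissible_subset:
  assumes "admissible X I" "I' \<subseteq> I" shows "admissible X I'"
proof -
  have "(\<Sum>i\<in>I'. card (X i)) \<le> (\<Sum>i\<in>I. card (X i))"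
    using assms by (intro sum_mono2) (auto simp: admissible_def)
  then show ?thesis using assms unfolding admissible_def disjoint_family_on_def
    by (meson add_le_mono1 finite_subset order_trans subsetD)
qed

lemma admissible_pair:
  fixes X :: "'i \<Rightarrow> 'p::prime_card mod_ring set"
  assumes "admissible X I" "i \<in> I" "j \<in> I" "i \<noteq> j"
  shows "X i \<inter> X j = {}" "3 \<le> card (X i)" "3 \<le> card (X j)" "card (X i) + card (X j) + 5 \<le> CARD('p)"
proof -
  have "admissible X {i, j}" using assms by (intro admissible_subset[OF assms(1)]) auto
  then show "X i \<inter> X j = {}" "3 \<le> card (X i)" "3 \<le> card (X j)" "card (X i) + card (X j) + 5 \<le> CARD('p)"
    using assms(4) by (auto simp: admissible_def disjoint_family_on_def)
qed

definition exc :: "('i \<Rightarrow> 'p::prime_card mod_ring set) \<Rightarrow> 'i \<Rightarrow> 'i \<Rightarrow> bool" where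
  "exc X i j \<longleftrightarrow> (\<exists>r. exceptional r (X i) (X j))"

lemma exc_commute: "exc X i j \<longleftrightarrow> exc X j i"
  by (auto simp: exc_def intro: exceptional_commute)

lemma exc_unique:
  assumes "admissible X I" "i \<in> I" "j \<in> I" "k \<in> I" "i \<noteq> j" "i \<noteq> k" "j \<noteq> k" "exc X i j"
  shows "\<not> exc X i k"
proof
  assume "exc X i k"
  then obtain r r' where r: "exceptional r (X i) (X j)" "exceptional r' (X i) (X k)"
    using assms(8) by (auto simp: exc_def)
  have "admissible X {i, j, k}" using assms by (intro admissible_subset[OF assms(1)]) auto
  then show False
    using assms(5-7) by (intro exceptional_matching[OF r]) (auto simp: admissible_def disjoint_family_on_def)
qed

lemma two_coeffs_large:
  assumes "admissible X I" "i \<in> I" "j \<in> I" "i \<noteq> j" "b \<noteq> 0" "c \<noteq> 0" "b \<noteq> c" "c \<noteq> - b \<or> \<not> exc X i j"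
  shows "card (X i) + card (X j) + 1 \<le> card (two_coeffs b c (X i) (X j))"
  using two_coeffs_cases[OF admissible_pair[OF assms(1-4)] assms(5-7)] assms(8) by (auto simp: exc_def)

text \<open>A surplus of one in the summands and the upper bound on \<open>S\<close> force equality
  in Cauchy--Davenport, so \<open>S\<close> is the whole sumset and Vosper's theorem applies. Every
  contradiction for three sets, and for one different coefficient, begins here.\<close>

lemma plus_subset_tight:
  fixes A B S :: "'p::prime_card mod_ring set"
  assumes "A + B \<subseteq> S" "card A \<ge> 2" "card B \<ge> 2" "card S \<le> N" "N + 1 \<le> card A + card B" "N + 5 \<le> CARD('p)"
  obtains d where "AP d A" "AP d B" "AP d S" "card S = N"
proof -
  have ne: "A \<noteq> {}" "B \<noteq> {}" using assms by auto
  have le: "card (A + B) \<le> card S" using assms by (intro card_mono) auto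
  have "min CARD('p) (card A + card B - 1) \<le> card (A + B)" using ne by (rule Cauchy_Davenport)
  then have eq: "card (A + B) = N" "card S = N" using le assms by linarith+
  then have AB: "A + B = S" using assms by (intro card_subset_eq) auto
  have pre: "card A \<ge> 2" "card B \<ge> 2" "card (A + B) + 2 \<le> CARD('p)" "card (A + B) \<le> card A + card B - 1"
    using assms eq by linarith+
  obtain d where "AP d A" "AP d B" "AP d (A + B)" using Vosper[OF pre] by blast
  then show thesis using that AB eq by blast
qed

lemma AP_undilate:
  assumes "AP d (b *o X)" "b \<noteq> 0" shows "AP (d / b) X"
  using AP_dilate_iff[OF assms(2), of "d / b" X] assms by simp

lemma sum3: "i \<noteq> j \<Longrightarrow> i \<noteq> l \<Longrightarrow> j \<noteq> l \<Longrightarrow> (\<Sum>k\<in>{i, j, l}. f k) = f i + f j + (f l :: nat)"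
  by simp

section \<open>Three sets and the case of one different coefficient\<close>

text \<open>Nonexceptional pairs make \<open>P\<close> and \<open>Q\<close> larger than their two
  sets together. If the claim fails, \<open>P\<close> and \<open>Q\<close> inherit the difference of
  \<open>S\<close>, and by symmetry they are nested. The smaller one may then be added to
  \<open>X i\<close> and to \<open>X j\<close> alike, hence to their union, which overfills
  \<open>S\<close>.\<close>

lemma three_opposite:
  fixes X :: "'i \<Rightarrow> 'p::prime_card mod_ring set"
  assumes ad: "admissible X {i, j, l}" and d: "i \<noteq> j" "i \<noteq> l" "j \<noteq> l" "u \<noteq> v" "u \<noteq> w" "v \<noteq> w"
    and a: "a u = b" "a v = b" "a w = - b" "b \<noteq> 0" and ex: "\<not> exc X i l" "\<not> exc X j l"
  shows "(\<Sum>k\<in>{i, j, l}. card (X k)) < card (perm_sums {i, j, l} {u, v, w} X a)"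
proof (rule ccontr)
  define S N where "S = perm_sums {i, j, l} {u, v, w} X a" and "N = card (X i) + card (X j) + card (X l)"
  assume "\<not> ?thesis"
  then have le: "card S \<le> N" unfolding S_def N_def sum3[OF d(1-3)] by simp
  have c: "3 \<le> card (X i)" "3 \<le> card (X j)" "3 \<le> card (X l)" "N + 5 \<le> CARD('p)"
    using ad unfolding admissible_def sum3[OF d(1-3)] N_def by auto
  have p5: "5 < CARD('p)" using c(1,4) by (simp add: N_def)
  note two = numeral_ne_0(1)[OF p5]
  have bb: "b \<noteq> - b"
  proof
    assume "b = - b"
    then have "2 * b = 0" by (metis add.right_inverse mult_2)
    then show False using two a by simp
  qed
  have dis: "X i \<inter> X j = {}" "X i \<inter> X l = {}" "X j \<inter> X l = {}"
    using ad d by (auto simp: admissible_def disjoint_family_on_def)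
  define P Q where "P = sdiff (X i) (X l)" and "Q = sdiff (X j) (X l)"
  have PQ: "two_coeffs b (- b) (X i) (X l) = b *o P" "two_coeffs b (- b) (X j) (X l) = b *o Q"
    by (simp_all add: P_def Q_def two_coeffs_opposite)
  have cP: "card (X i) + card (X l) + 1 \<le> card P"
    using two_coeffs_large[OF ad, of i l b "- b"] d a bb ex PQ by simp
  have cQ: "card (X j) + card (X l) + 1 \<le> card Q"
    using two_coeffs_large[OF ad, of j l b "- b"] d a bb ex PQ by simp
  have s1: "b *o X j + b *o P \<subseteq> S"
    using perm_sums_three[of i l j u v w a X] d a by (simp add: PQ S_def insert_commute)
  have s2: "b *o X i + b *o Q \<subseteq> S"
    using perm_sums_three[of j l i u v w a X] d a by (simp add: PQ S_def insert_commute)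
  obtain d1 where d1: "AP d1 (b *o P)" "AP d1 S" "card S = N"
    by (rule plus_subset_tight[OF s1 _ _ le _ c(4)]) (use c cP a in \<open>auto simp: N_def\<close>)
  obtain d2 where d2: "AP d2 (b *o Q)" "AP d2 S"
    by (rule plus_subset_tight[OF s2 _ _ le _ c(4)]) (use c cQ a in \<open>auto simp: N_def\<close>)
  have "b *o Q \<noteq> {}" using cQ c by auto
  then have "AP d1 (b *o Q)"
    using AP_same_direction[OF d1(2) d2(2) _ _ d2(1)] d1(3) c by (simp add: N_def)
  then have ap: "AP (d1 / b) P" "AP (d1 / b) Q" using d1 a(4) by (auto intro: AP_undilate)
  have contra: False if R: "b *o X i + b *o R \<subseteq> S" "b *o X j + b *o R \<subseteq> S" "card (X l) + 4 \<le> card R" for R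
  proof -
    have "b *o ((X i \<union> X j) + R) \<subseteq> S"
      using R unfolding set_times_plus_distrib2 by (simp add: dilate_eq_image image_Un Un_set_plus)
    then have "card (b *o ((X i \<union> X j) + R)) \<le> card S" by (intro card_mono) auto
    then have "card ((X i \<union> X j) + R) \<le> N" using a le by simp
    moreover have "min CARD('p) (card (X i \<union> X j) + card R - 1) \<le> card ((X i \<union> X j) + R)"
      using R(3) c by (intro Cauchy_Davenport) auto
    moreover have "card (X i \<union> X j) = card (X i) + card (X j)" using dis by (simp add: card_Un_disjoint)
    ultimately show False using R(3) c unfolding N_def by linarith
  qed
  have "P \<subseteq> Q \<or> Q \<subseteq> P"
    using symmetric_AP_nested[OF ap(1) _ _ ap(2) _ _ two] dis
    unfolding P_def Q_def by (simp add: uminus_sdiff zero_notin_sdiff)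
  then show False
  proof
    assume "P \<subseteq> Q"
    then have "b *o X i + b *o P \<subseteq> S" using s2 by (meson order_trans set_plus_mono2 set_times_mono subset_refl)
    then show False using contra[of P] s1 cP c by simp
  next
    assume "Q \<subseteq> P"
    then have "b *o X j + b *o Q \<subseteq> S" using s1 by (meson order_trans set_plus_mono2 set_times_mono subset_refl)
    then show False using contra[of Q] s2 cQ c by simp
  qed
qed

text \<open>Both dilates of \<open>X\<close> have the difference of \<open>S\<close>, so
  \<open>X\<close> has the differences \<open>d / b\<close> and \<open>d / c\<close>, which agree up
  to sign.\<close>

lemma ratio_of_AP_dilates:
  fixes X S :: "'p::prime_card mod_ring set"
  assumes "AP d (b *o X)" "AP d S" "AP e (c *o X)" "AP e S" "b \<noteq> 0" "c \<noteq> 0"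
    and X: "2 \<le> card X" "card X + 2 \<le> CARD('p)" and S: "2 \<le> card S" "card S + 2 \<le> CARD('p)"
  shows "c = b \<or> c = - b"
proof -
  have "c *o X \<noteq> {}" using X by auto
  then have "AP d (c *o X)" using AP_same_direction[OF assms(2,4) S assms(3)] by blast
  then have "AP (d / b) X" "AP (d / c) X" using assms by (auto intro: AP_undilate)
  then have "d / c = d / b \<or> d / c = - (d / b)"
    by (rule AP_difference_unique[OF _ _ X])
  then have "d / c * (b * c) = d / b * (b * c) \<or> d / c * (b * c) = - (d / b * (b * c))" by fastforce
  moreover have "d / c * (b * c) = d * b" "d / b * (b * c) = d * c" using assms(5,6) by simp_all
  ultimately have "d * b = d * c \<or> d * b = d * (- c)" by simp
  moreover have "d \<noteq> 0" using assms by (simp add: AP_def)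
  ultimately have "b = c \<or> b = - c" unfolding mult_cancel_left by blast
  then show ?thesis by auto
qed

text \<open>The coefficient \<open>a u\<close> is opposite to neither of the others, so pairs using
  it are never exceptional. Splitting off \<open>a w\<close> and \<open>a v\<close> from the same
  set gives \<open>a v = - a w\<close>. If some pair of sets were nonexceptional, \<open>a u\<close>
  could be split off as well, giving \<open>a v = a u\<close> or \<open>a v = - a u\<close>. So all
  pairs would be exceptional, against uniqueness of the partner.\<close>

lemma three_distinct:
  fixes X :: "'i \<Rightarrow> 'p::prime_card mod_ring set"
  assumes ad: "admissible X {i, j, l}" and d: "i \<noteq> j" "i \<noteq> l" "j \<noteq> l" "u \<noteq> v" "u \<noteq> w" "v \<noteq> w"
    and a: "a u \<noteq> 0" "a v \<noteq> 0" "a w \<noteq> 0" "a u \<noteq> a v" "a u \<noteq> a w" "a v \<noteq> a w"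
    and uv: "a v \<noteq> - a u" "a w \<noteq> - a u"
  shows "(\<Sum>k\<in>{i, j, l}. card (X k)) < card (perm_sums {i, j, l} {u, v, w} X a)"
proof (rule ccontr)
  define S N where "S = perm_sums {i, j, l} {u, v, w} X a" and "N = card (X i) + card (X j) + card (X l)"
  assume "\<not> ?thesis"
  then have le: "card S \<le> N" unfolding S_def N_def sum3[OF d(1-3)] by simp
  have c: "3 \<le> card (X i)" "3 \<le> card (X j)" "3 \<le> card (X l)" "N + 5 \<le> CARD('p)"
    using ad unfolding admissible_def sum3[OF d(1-3)] N_def by auto
  have abc: "x = y" if "x \<in> {u, v, w}" "y \<in> {u, v, w}" "a x = a y" for x y
    using that a(4-6) by auto
  have tight: "\<exists>e. AP e (a u' *o X l') \<and> AP e S \<and> card S = N"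
    if "{i', j', l'} = {i, j, l}" "i' \<noteq> j'" "i' \<noteq> l'" "j' \<noteq> l'" "{u', v', w'} = {u, v, w}" "u' \<noteq> v'" "u' \<noteq> w'" "v' \<noteq> w'"
      "a w' \<noteq> - a v' \<or> \<not> exc X i' j'" for i' j' l' u' v' w'
  proof -
    have m: "u' \<in> {u, v, w}" "v' \<in> {u, v, w}" "w' \<in> {u, v, w}" using that(5) by blast+
    have nz: "a x \<noteq> 0" if "x \<in> {u, v, w}" for x using that a(1-3) by auto
    have an: "a u' \<noteq> 0" "a v' \<noteq> 0" "a w' \<noteq> 0" using m nz by simp_all
    have vw: "a v' \<noteq> a w'" using abc[OF m(2,3)] that(8) by metis
    have mi: "i' \<in> {i, j, l}" "j' \<in> {i, j, l}" using that(1) by blast+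
    have "a u' *o X l' + two_coeffs (a v') (a w') (X i') (X j') \<subseteq> S"
      using perm_sums_three[of i' j' l' u' v' w' a X] that by (simp add: S_def)
    moreover have "card (X i') + card (X j') + 1 \<le> card (two_coeffs (a v') (a w') (X i') (X j'))"
      using two_coeffs_large[OF ad mi that(2) an(2,3) vw that(9)] .
    moreover have "card (X i') + card (X j') + card (X l') = N" "3 \<le> card (X l')" "3 \<le> card (X i')"
    proof -
      have "(\<Sum>k\<in>{i', j', l'}. card (X k)) = (\<Sum>k\<in>{i, j, l}. card (X k))" using that(1) by simp
      then show "card (X i') + card (X j') + card (X l') = N"
        unfolding N_def sum3[OF d(1-3)] sum3[OF that(2-4)] .
      have "i' \<in> {i, j, l}" "l' \<in> {i, j, l}" using that(1) by blast+
      then show "3 \<le> card (X l')" "3 \<le> card (X i')" using c by auto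
    qed
    ultimately have P: "a u' *o X l' + two_coeffs (a v') (a w') (X i') (X j') \<subseteq> S"
        "2 \<le> card (a u' *o X l')" "2 \<le> card (two_coeffs (a v') (a w') (X i') (X j'))"
        "N + 1 \<le> card (a u' *o X l') + card (two_coeffs (a v') (a w') (X i') (X j'))"
      unfolding card_dilate[OF an(1)] by linarith+
    show ?thesis by (rule plus_subset_tight[OF P(1-3) le P(4) c(4)]) blast
  qed
  obtain e1 where e1: "AP e1 (a w *o X l)" "AP e1 S" "card S = N"
    using tight[of i j l w u v] d uv by auto
  obtain e2 where e2: "AP e2 (a v *o X l)" "AP e2 S"
    using tight[of i j l v u w] d uv by auto
  have rat: "a x = a y \<or> a x = - a y"
    if "AP e (a y *o X k)" "AP e S" "AP f (a x *o X k)" "AP f S" "a x \<noteq> 0" "a y \<noteq> 0" "k \<in> {i, j, l}" for e f x y k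
    using ratio_of_AP_dilates[OF that(1-4,6,5)] e1(3) c that(7) by (auto simp: N_def)
  have "a v = - a w" using rat[OF e1(1,2) e2(1,2)] a by auto
  have "exc X i' j'" if "{i', j', l'} = {i, j, l}" "i' \<noteq> j'" "i' \<noteq> l'" "j' \<noteq> l'" for i' j' l'
  proof (rule ccontr)
    assume n: "\<not> exc X i' j'"
    have "\<exists>e. AP e (a u *o X l') \<and> AP e S \<and> card S = N"
      using d n by (intro tight[OF that, of u v w]) simp_all
    moreover have "\<exists>e. AP e (a v *o X l') \<and> AP e S \<and> card S = N"
      using d uv by (intro tight[OF that, of v u w]) auto
    ultimately obtain e3 e4 where e3: "AP e3 (a u *o X l')" "AP e3 S" and e4: "AP e4 (a v *o X l')" "AP e4 S"
      by meson
    have "l' \<in> {i, j, l}" using that(1) by blast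
    then have "a v = a u \<or> a v = - a u" using rat[OF e3 e4] a by blast
    then show False using a uv by auto
  qed
  then have "exc X i j" "exc X i l" using d by (auto simp: insert_commute)
  then show False using exc_unique[OF ad, of i j l] d by auto
qed

lemma dilate_sum:
  "finite I \<Longrightarrow> d *o (\<Sum>i\<in>I. F i) = (\<Sum>i\<in>I. d *o (F i :: 'p::prime_card mod_ring set))"
proof (induction I rule: finite_induct)
  case empty
  show ?case by (auto simp: dilate_eq_image)
next
  case (insert x I)
  have "d *o (\<Sum>i\<in>insert x I. F i) = d *o (F x + (\<Sum>i\<in>I. F i))" by (simp only: sum.insert[OF insert(1,2)])
  also have "\<dots> = d *o F x + (\<Sum>i\<in>I. d *o F i)" by (simp only: set_times_plus_distrib2 insert.IH)
  also have "\<dots> = (\<Sum>i\<in>insert x I. d *o F i)" by (simp only: sum.insert[OF insert(1,2)])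
  finally show ?case .
qed

text \<open>By \<open>H\<close> the family without any one set and one copy of \<open>b\<close> has
  a surplus. Tightness then turns every \<open>b *o X l\<close> into a progression with the
  difference of \<open>S\<close>, and division by that difference reduces the question to
  intervals.\<close>

lemma one_different_coefficient:
  fixes X :: "'i \<Rightarrow> 'p::prime_card mod_ring set" and a :: "'j \<Rightarrow> 'p mod_ring"
  assumes ad: "admissible X I" and cI: "card I \<ge> 3" and fJ: "finite J" and cJ: "card J = card I"
    and w: "w \<in> J" "\<And>v. v \<in> J - {w} \<Longrightarrow> a v = b" "a w \<noteq> b" "b \<noteq> 0" "a w \<noteq> 0" "a w \<noteq> - b \<or> card I \<ge> 4"
    and u: "u \<in> J" "u \<noteq> w"
    and H: "\<And>l. l \<in> I \<Longrightarrow> (\<Sum>i\<in>I - {l}. card (X i)) + 1 \<le> card (perm_sums (I - {l}) (J - {u}) X a)"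
  shows "(\<Sum>i\<in>I. card (X i)) < card (perm_sums I J X a)"
proof (rule ccontr)
  define S N where "S = perm_sums I J X a" and "N = (\<Sum>i\<in>I. card (X i))"
  assume "\<not> ?thesis"
  then have le: "card S \<le> N" unfolding S_def N_def by simp
  have fI: "finite I" and c3: "\<And>i. i \<in> I \<Longrightarrow> 3 \<le> card (X i)" and Np: "N + 5 \<le> CARD('p)"
    using ad by (auto simp: admissible_def N_def)
  have Nl: "N = card (X l) + (\<Sum>i\<in>I - {l}. card (X i))" if "l \<in> I" for l
    unfolding N_def using fI that by (rule sum.remove)
  have N9: "9 \<le> N"
  proof -
    have "of_nat (card I) * 3 \<le> (\<Sum>i\<in>I. card (X i))" using c3 by (intro sum_bounded_below) auto
    then show ?thesis using cI unfolding N_def by simp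
  qed
  have tight: "\<exists>e. AP e (b *o X l) \<and> AP e S \<and> card S = N" if l: "l \<in> I" for l
  proof -
    have s: "a u *o X l + perm_sums (I - {l}) (J - {u}) X a \<subseteq> S"
      unfolding S_def using fI l u by (intro perm_sums_remove) auto
    have au: "a u = b" using w u by auto
    obtain l' where "l' \<in> I - {l}"
    proof -
      have "card (I - {l}) \<noteq> 0" using cI l fI by simp
      then show thesis using that by (metis card.empty ex_in_conv)
    qed
    then have "3 \<le> (\<Sum>i\<in>I - {l}. card (X i))"
      using member_le_sum[of l' "I - {l}" "\<lambda>i. card (X i)"] fI c3[of l'] by force
    have P: "2 \<le> card (perm_sums (I - {l}) (J - {u}) X a)" "2 \<le> card (a u *o X l)"
        "N + 1 \<le> card (a u *o X l) + card (perm_sums (I - {l}) (J - {u}) X a)"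
      using H[OF l] Nl[OF l] c3[OF l] w(4) \<open>3 \<le> (\<Sum>i\<in>I - {l}. card (X i))\<close> by (simp_all add: au)
    obtain e where "AP e (a u *o X l)" "AP e S" "card S = N"
      by (rule plus_subset_tight[OF s P(2,1) le P(3) Np])
    then show ?thesis unfolding au by blast
  qed
  have "I \<noteq> {}" using cI by auto
  then obtain l0 where "l0 \<in> I" by blast
  then obtain d where d: "AP d S" "card S = N" using tight by blast
  then have d0: "d \<noteq> 0" by (simp add: AP_def)
  have "AP d (b *o X l)" if l: "l \<in> I" for l
  proof -
    obtain e where e: "AP e (b *o X l)" "AP e S" using tight[OF l] by blast
    have "b *o X l \<noteq> {}" using c3[OF l] by auto
    then show ?thesis using AP_same_direction[OF d(1) e(2) _ _ e(1)] d(2) N9 Np by simp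
  qed
  then have "\<forall>l\<in>I. \<exists>s. b *o X l = d *o iv s (card (X l))" using w(4) by (auto simp: AP_def)
  then obtain s where s: "\<And>l. l \<in> I \<Longrightarrow> b *o X l = d *o iv (s l) (card (X l))" by metis
  have Xl: "X l = (d / b) *o iv (s l) (card (X l))" if "l \<in> I" for l
  proof -
    have "X l = inverse b *o (b *o X l)" using w(4) by (simp add: dilate_inverse)
    also have "\<dots> = inverse b *o (d *o iv (s l) (card (X l)))" using s[OF that] by simp
    also have "\<dots> = (d / b) *o iv (s l) (card (X l))" by (simp only: set_times_rearrange2) (simp add: field_simps)
    finally show ?thesis .
  qed
  define S' where "S' = inverse d *o S"
  have S': "S = d *o S'" using d0 by (simp add: S'_def dilate_inverse)
  show False
  proof (rule intervals_one_coefficient[of I "\<lambda>l. card (X l)" s "a w / b" S'])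
    show "disjoint_family_on (\<lambda>i. iv (s i) (card (X i))) I"
      unfolding disjoint_family_on_def
    proof (intro ballI impI)
      fix m n assume mn: "m \<in> I" "n \<in> I" "m \<noteq> n"
      then have "X m \<inter> X n = {}" using ad by (auto simp: admissible_def disjoint_family_on_def)
      moreover have "(d / b) *o iv (s m) (card (X m)) \<subseteq> X m" "(d / b) *o iv (s n) (card (X n)) \<subseteq> X n"
        using Xl mn by blast+
      ultimately show "iv (s m) (card (X m)) \<inter> iv (s n) (card (X n)) = {}" by blast
    qed
    show "AP 1 S'" using AP_dilate_iff[OF d0, of 1 S'] d(1) S' by simp
    show "card S' \<le> (\<Sum>i\<in>I. card (X i))" using le S' d0 by (simp add: N_def)
    show "a w / b \<noteq> 0" "a w / b \<noteq> 1" using w by auto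
    show "a w / b \<noteq> - 1 \<or> 4 \<le> card I" using w(4,6) by (auto simp: divide_eq_eq)
    fix j assume j: "j \<in> I"
    have "card (I - {j}) = card (J - {w})" using fI fJ j w cJ by simp
    then obtain \<sigma> where sg: "bij_betw \<sigma> (I - {j}) (J - {w})"
      using finite_same_card_bij fI fJ by (metis finite_Diff)
    have "(\<Sum>i\<in>I - {j}. a (\<sigma> i) *o X i) \<subseteq> perm_sums (I - {j}) (J - {w}) X a"
      using sg by (auto simp: perm_sums_def)
    then have "a w *o X j + (\<Sum>i\<in>I - {j}. a (\<sigma> i) *o X i) \<subseteq> a w *o X j + perm_sums (I - {j}) (J - {w}) X a"
      by (intro set_plus_mono2) auto
    also have "\<dots> \<subseteq> S" unfolding S_def using fI j w by (intro perm_sums_remove) auto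
    finally have "a w *o X j + (\<Sum>i\<in>I - {j}. a (\<sigma> i) *o X i) \<subseteq> S" .
    moreover have "(\<Sum>i\<in>I - {j}. a (\<sigma> i) *o X i) = (\<Sum>i\<in>I - {j}. d *o iv (s i) (card (X i)))"
    proof (intro sum.cong refl)
      fix i assume i: "i \<in> I - {j}"
      then have "\<sigma> i \<in> J - {w}" using sg by (auto simp: bij_betw_def)
      then show "a (\<sigma> i) *o X i = d *o iv (s i) (card (X i))" using w(2) s i by simp
    qed
    moreover have "a w *o X j = d *o ((a w / b) *o iv (s j) (card (X j)))"
    proof -
      have "a w *o X j = (a w * (d / b)) *o iv (s j) (card (X j))"
        by (subst Xl[OF j]) (rule set_times_rearrange2)
      also have "a w * (d / b) = d * (a w / b)" by simp
      finally show ?thesis by (simp only: set_times_rearrange2)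
    qed
    moreover have "d *o ((\<Sum>i\<in>I - {j}. iv (s i) (card (X i))) + (a w / b) *o iv (s j) (card (X j)))
      = (\<Sum>i\<in>I - {j}. d *o iv (s i) (card (X i))) + d *o ((a w / b) *o iv (s j) (card (X j)))"
      using fI by (simp only: set_times_plus_distrib2 dilate_sum finite_Diff)
    ultimately have "d *o ((\<Sum>i\<in>I - {j}. iv (s i) (card (X i))) + (a w / b) *o iv (s j) (card (X j))) \<subseteq> d *o S'"
      unfolding S'[symmetric] by (simp only: add.commute)
    then show "(\<Sum>i\<in>I - {j}. iv (s i) (card (X i))) + (a w / b) *o iv (s j) (card (X j)) \<subseteq> S'"
      using dilate_mono_iff[OF d0] by blast
  qed (use fI cI c3 Np in \<open>auto simp: N_def\<close>)
qed

lemma pair_sets: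
  fixes X :: "'i \<Rightarrow> 'p::prime_card mod_ring set"
  assumes "admissible X {i, j}" "i \<noteq> j" "a v \<noteq> 0" "a w \<noteq> 0" "a v \<noteq> a w" "a w \<noteq> - a v \<or> \<not> exc X i j"
  shows "card (X i) + card (X j) + 1 \<le> card (perm_sums {i, j} {v, w} X a)"
proof -
  have "v \<noteq> w" using assms(5) by auto
  then have "card (two_coeffs (a v) (a w) (X i) (X j)) \<le> card (perm_sums {i, j} {v, w} X a)"
    by (intro card_mono perm_sums_two assms(2)) simp
  moreover have "card (X i) + card (X j) + 1 \<le> card (two_coeffs (a v) (a w) (X i) (X j))"
    using assms by (intro two_coeffs_large[OF assms(1)]) auto
  ultimately show ?thesis by linarith
qed

text \<open>For opposite coefficients at most one of the three pairs is exceptional, and the sets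
  are relabelled so that it is the pair \<open>i\<close>, \<open>j\<close>, whose members are never
  paired. Otherwise the pairs left after removing a set have nonopposite coefficients and hence a
  surplus.\<close>

lemma three_sets_two_equal:
  fixes X :: "'i \<Rightarrow> 'p::prime_card mod_ring set"
  assumes ad: "admissible X {i, j, l}" and d: "i \<noteq> j" "i \<noteq> l" "j \<noteq> l" "u \<noteq> v" "u \<noteq> w" "v \<noteq> w"
    and a: "a u = b" "a v = b" "a w \<noteq> b" "b \<noteq> 0" "a w \<noteq> 0"
  shows "(\<Sum>k\<in>{i, j, l}. card (X k)) < card (perm_sums {i, j, l} {u, v, w} X a)"
proof (cases "a w = - b")
  case True
  note uniq = exc_unique[OF ad]
  have sym: "{i, l, j} = {i, j, l}" "{j, l, i} = {i, j, l}" by auto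
  consider "\<not> exc X i l" "\<not> exc X j l" | "exc X i l" | "exc X j l" by blast
  then show ?thesis
  proof cases
    case 1
    then show ?thesis using three_opposite[OF ad d a(1,2) True a(4)] by simp
  next
    case 2
    have "\<not> exc X i j" using uniq[of i l j] 2 d by auto
    moreover have "\<not> exc X l j" using uniq[of l i j] 2 exc_commute[of X i l] d by auto
    ultimately show ?thesis
      using three_opposite[of X i l j u v w a b] ad d a True unfolding sym by auto
  next
    case 3
    have "\<not> exc X j i" using uniq[of j l i] 3 d by auto
    moreover have "\<not> exc X l i" using uniq[of l j i] 3 exc_commute[of X j l] d by auto
    ultimately show ?thesis
      using three_opposite[of X j l i u v w a b] ad d a True unfolding sym by auto
  qed
next
  case False
  show ?thesis
  proof (rule one_different_coefficient[OF ad, of "{u, v, w}" w a b u])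
    fix k assume "k \<in> {i, j, l}"
    then obtain m n where mn: "{i, j, l} - {k} = {m, n}" "m \<noteq> n"
    proof -
      have "card ({i, j, l} - {k}) = 2" using \<open>k \<in> {i, j, l}\<close> d by auto
      then show thesis using that by (auto simp: card_2_iff)
    qed
    have J: "{u, v, w} - {u} = {v, w}" using d by auto
    have "{m, n} \<subseteq> {i, j, l}" unfolding mn(1)[symmetric] by (rule Diff_subset)
    then have "admissible X {m, n}" by (rule admissible_subset[OF ad])
    then have "card (X m) + card (X n) + 1 \<le> card (perm_sums {m, n} {v, w} X a)"
      using mn(2) a False by (intro pair_sets) auto
    then show "(\<Sum>i\<in>{i, j, l} - {k}. card (X i)) + 1 \<le> card (perm_sums ({i, j, l} - {k}) ({u, v, w} - {u}) X a)"
      unfolding mn(1) J using mn(2) by simp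
  qed (use d a False in auto)
qed

text \<open>Among three distinct coefficients at most one pair is opposite, so some coefficient is
  opposite to neither of the others and can take the place of \<open>u\<close> in
  \<open>three_distinct\<close>.\<close>

lemma three_sets:
  fixes X :: "'i \<Rightarrow> 'p::prime_card mod_ring set"
  assumes ad: "admissible X I" and c: "card I = 3" "card J = 3"
    and nz: "\<forall>v\<in>J. a v \<noteq> 0" and nc: "\<exists>v\<in>J. \<exists>w\<in>J. a v \<noteq> a w"
  shows "(\<Sum>k\<in>I. card (X k)) < card (perm_sums I J X a)"
proof -
  obtain i j l where I: "I = {i, j, l}" "i \<noteq> j" "i \<noteq> l" "j \<noteq> l" using c(1) by (auto simp: card_3_iff)
  obtain u v w where J: "J = {u, v, w}" "u \<noteq> v" "u \<noteq> w" "v \<noteq> w" using c(2) by (auto simp: card_3_iff)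
  have ad': "admissible X {i, j, l}" using ad I by simp
  have perm: "J = {u, w, v}" "J = {v, w, u}" "J = {w, u, v}" "J = {v, u, w}" using J(1) by auto
  have az: "a u \<noteq> 0" "a v \<noteq> 0" "a w \<noteq> 0" using nz J by auto
  note eqs = three_sets_two_equal[OF ad' I(2-4)]
  note dis = three_distinct[OF ad' I(2-4)]
  consider "a u = a v" | "a u = a w" | "a v = a w" | "a u \<noteq> a v" "a u \<noteq> a w" "a v \<noteq> a w" by blast
  then show ?thesis
  proof cases
    case 1
    then have "a w \<noteq> a u" using nc J(1) by auto
    then show ?thesis unfolding I(1) J(1) using J az 1 by (intro eqs[of u v w a "a u"]) simp_all
  next
    case 2
    then have "a v \<noteq> a u" using nc J(1) by auto
    then show ?thesis unfolding I(1) perm(1) using J az 2 by (intro eqs[of u w v a "a u"]) simp_all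
  next
    case 3
    then have "a u \<noteq> a v" using nc J(1) by auto
    then show ?thesis unfolding I(1) perm(2) using J az 3 by (intro eqs[of v w u a "a v"]) simp_all
  next
    case 4
    consider "a v \<noteq> - a u" "a w \<noteq> - a u" | "a v = - a u" | "a w = - a u" by blast
    then show ?thesis
    proof cases
      case 1
      then show ?thesis unfolding I(1) J(1) using J az 4 by (intro dis) simp_all
    next
      case 2
      have "a u \<noteq> - a w" "a v \<noteq> - a w" using 2 4 by auto
      then show ?thesis unfolding I(1) perm(3) using J az 4 by (intro dis) simp_all
    next
      case 3
      have "a u \<noteq> - a v" "a w \<noteq> - a v" using 3 4 by auto
      then show ?thesis unfolding I(1) perm(4) using J az 4 by (intro dis) simp_all
    qed
  qed
qed

section \<open>Any number of sets\<close>

text \<open>Two surpluses of one survive the single unit lost in Cauchy--Davenport as a surplus of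
  one.\<close>

lemma combine_pair:
  fixes X :: "'i \<Rightarrow> 'p::prime_card mod_ring set"
  assumes ad: "admissible X I" and ij: "i \<in> I" "j \<in> I" "i \<noteq> j" "\<not> exc X i j"
    and uv: "u \<in> J" "v \<in> J" "a u \<noteq> a v" "a u \<noteq> 0" "a v \<noteq> 0"
    and R: "(\<Sum>k\<in>I - {i, j}. card (X k)) < card (perm_sums (I - {i, j}) (J - {u, v}) X a)"
  shows "(\<Sum>k\<in>I. card (X k)) < card (perm_sums I J X a)"
proof -
  define P Q where "P = two_coeffs (a u) (a v) (X i) (X j)"
    and "Q = perm_sums (I - {i, j}) (J - {u, v}) X a"
  have fI: "finite I" and Np: "(\<Sum>k\<in>I. card (X k)) + 5 \<le> CARD('p)" using ad by (auto simp: admissible_def)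
  have N: "(\<Sum>k\<in>I. card (X k)) = card (X i) + card (X j) + (\<Sum>k\<in>I - {i, j}. card (X k))"
    using sum.subset_diff[of "{i, j}" I "\<lambda>k. card (X k)"] ij fI by simp
  have P: "card (X i) + card (X j) + 1 \<le> card P"
    unfolding P_def by (rule two_coeffs_large[OF ad ij(1-3) uv(4,5,3)]) (use ij in simp)
  have "u \<noteq> v" using uv by auto
  then have "P + Q \<subseteq> perm_sums I J X a"
    unfolding P_def Q_def using perm_sums_remove2[OF fI ij(1-3) uv(1,2)] by simp
  then have "card (P + Q) \<le> card (perm_sums I J X a)" by (intro card_mono) auto
  moreover have "min CARD('p) (card P + card Q - 1) \<le> card (P + Q)"
    using P R unfolding Q_def[symmetric] by (intro Cauchy_Davenport) auto
  ultimately show ?thesis using P R N Np unfolding Q_def[symmetric] by linarith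
qed

text \<open>A nonexceptional pair of sets with unequal coefficients is split off whenever the
  remaining coefficients can be kept nonconstant. This reduces the size by two, so the induction
  hypothesis applies from five sets on; four sets are split into two pairs directly.\<close>

lemma many_sets:
  fixes X :: "'i \<Rightarrow> 'p::prime_card mod_ring set" and a :: "'j \<Rightarrow> 'p mod_ring"
  assumes "admissible X I" "card I \<ge> 3" "card J = card I"
    and "\<forall>v\<in>J. a v \<noteq> 0" "\<exists>v\<in>J. \<exists>w\<in>J. a v \<noteq> a w"
  shows "(\<Sum>k\<in>I. card (X k)) < card (perm_sums I J X a)"
  using assms
proof (induction "card I" arbitrary: I J rule: less_induct)
  case less
  note ad = less.prems(1) and cJ = less.prems(3) and nz = less.prems(4)
  note uniq = exc_unique[OF ad]
  have fI: "finite I" and fJ: "finite J" using less.prems by (auto intro: card_ge_0_finite)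
  have IH: "(\<Sum>k\<in>I'. card (X k)) < card (perm_sums I' J' X a)"
    if "I' \<subseteq> I" "card I' < card I" "3 \<le> card I'" "card J' = card I'" "J' \<subseteq> J" "\<exists>v\<in>J'. \<exists>w\<in>J'. a v \<noteq> a w" for I' J'
  proof (rule less.hyps[OF that(2) admissible_subset[OF ad that(1)] that(3,4) _ that(6)])
    show "\<forall>v\<in>J'. a v \<noteq> 0" using nz that(5) by blast
  qed
  consider "card I = 3" | "card I \<ge> 4" using less.prems by linarith
  then show ?case
  proof cases
    case 1
    then show ?thesis using less.prems by (intro three_sets) auto
  next
    case n4: 2
    show ?thesis
    proof (cases "\<exists>u\<in>J. \<exists>v\<in>J. a u \<noteq> a v \<and> (\<exists>x\<in>J - {u, v}. \<exists>y\<in>J - {u, v}. a x \<noteq> a y)")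
      case True
      then obtain u v x y where uv: "u \<in> J" "v \<in> J" "a u \<noteq> a v"
        and xy: "x \<in> J - {u, v}" "y \<in> J - {u, v}" "a x \<noteq> a y" by blast
      have z: "a u \<noteq> 0" "a v \<noteq> 0" "a x \<noteq> 0" "a y \<noteq> 0" using nz uv xy by auto
      have uv': "u \<noteq> v" using uv by auto
      have cJ': "card (J - {u, v}) = card I - 2" using uv uv' fJ cJ by (simp add: card_Diff_subset)
      have cI': "card (I - {i, j}) = card I - 2" if "i \<in> I" "j \<in> I" "i \<noteq> j" for i j
        using that fI by (simp add: card_Diff_subset)
      show ?thesis
      proof (cases "card I = 4")
        case True
        \<comment> \<open>Both pairs must be nonexceptional here. As a set has at most one
          exceptional partner, a pairing containing an exceptional pair can be exchanged for one
          containing none.\<close>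
        have four: "(\<Sum>k\<in>I. card (X k)) < card (perm_sums I J X a)"
          if I: "I = {i, j, k, l}" and d: "distinct [i, j, k, l]" and e: "\<not> exc X i j" "\<not> exc X k l" for i j k l
        proof (rule combine_pair[OF ad _ _ _ e(1) uv z(1,2)])
          show "i \<in> I" "j \<in> I" "i \<noteq> j" using I d by auto
          have I': "I - {i, j} = {k, l}" using I d by auto
          have "x \<noteq> y" using xy by auto
          then have J': "J - {u, v} = {x, y}"
            using xy cJ' True fJ by (intro card_seteq[symmetric]) auto
          have "admissible X {k, l}" using I by (intro admissible_subset[OF ad]) auto
          then have "card (X k) + card (X l) + 1 \<le> card (perm_sums {k, l} {x, y} X a)"
            using d z xy e by (intro pair_sets) auto
          then show "(\<Sum>m\<in>I - {i, j}. card (X m)) < card (perm_sums (I - {i, j}) (J - {u, v}) X a)"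
            unfolding I' J' using d by simp
        qed
        obtain i I' where i: "I = insert i I'" "i \<notin> I'" "card I' = 3"
          using True card_Suc_eq[of I 3] by auto
        obtain j k l where I': "I' = {j, k, l}" "j \<noteq> k" "k \<noteq> l" "j \<noteq> l" using i(3) unfolding card_3_iff by blast
        have I: "I = {i, j, k, l}" and d: "distinct [i, j, k, l]" using i I' by auto
        have mem: "i \<in> I" "j \<in> I" "k \<in> I" "l \<in> I" using I by auto
        show ?thesis
        proof (cases "exc X i j \<or> exc X k l")
          case True
          have "\<not> exc X i k" using True uniq[of i j k] uniq[of k l i] mem d exc_commute[of X] by auto
          moreover have "\<not> exc X j l" using True uniq[of j i l] uniq[of l k j] mem d exc_commute[of X] by auto
          moreover have "I = {i, k, j, l}" using I by auto
          ultimately show ?thesis using d by (intro four[of i k j l]) auto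
        next
          case False
          then show ?thesis using I d by (intro four[of i j k l]) auto
        qed
      next
        case False
        then have n5: "5 \<le> card I" using n4 by linarith
        obtain T where T: "T \<subseteq> I" "card T = 3" using n4 obtain_subset_with_card_n[of 3 I] by auto
        then obtain i j k where t: "T = {i, j, k}" "i \<noteq> j" "j \<noteq> k" "i \<noteq> k" unfolding card_3_iff by blast
        then have mem: "i \<in> I" "j \<in> I" "k \<in> I" using T by auto
        have "\<not> exc X i j \<or> \<not> exc X i k" using uniq[of i j k] mem t by auto
        then obtain m where m: "m \<in> I" "i \<noteq> m" "\<not> exc X i m" using mem t by blast
        show ?thesis
        proof (rule combine_pair[OF ad mem(1) m uv z(1,2)])
          show "(\<Sum>k\<in>I - {i, m}. card (X k)) < card (perm_sums (I - {i, m}) (J - {u, v}) X a)"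
            using n5 cI'[OF mem(1) m(1,2)] cJ' xy by (intro IH) auto
        qed
      qed
    next
      case False
      \<comment> \<open>Removing any two unequal coefficients leaves equal ones; with at least four
        coefficients, all but one of them therefore coincide.\<close>
      then have const: "a x = a y" if "u \<in> J" "v \<in> J" "a u \<noteq> a v" "x \<in> J - {u, v}" "y \<in> J - {u, v}" for u v x y
        using that by blast
      obtain v0 w0 where vw: "v0 \<in> J" "w0 \<in> J" "a v0 \<noteq> a w0" using less.prems by blast
      then have "v0 \<noteq> w0" by auto
      then have "card (J - {v0, w0}) \<ge> 2" using vw fJ n4 cJ by (simp add: card_Diff_subset)
      then obtain T where "T \<subseteq> J - {v0, w0}" "card T = 2" using obtain_subset_with_card_n by metis
      then obtain x y where xy: "x \<in> J - {v0, w0}" "y \<in> J - {v0, w0}" "x \<noteq> y" unfolding card_2_iff by blast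
      have cx: "a z = a x" if "z \<in> J - {v0, w0}" for z using const[OF vw that xy(1)] .
      have "\<exists>w\<in>J. (\<forall>v\<in>J - {w}. a v = a x) \<and> a w \<noteq> a x"
      proof (cases "a x = a v0")
        case True
        have "a v = a x" if "v \<in> J - {w0}" for v
          using cx[of v] that True by (cases "v = v0") simp_all
        moreover have "a w0 \<noteq> a x" using vw(3) unfolding True by (rule not_sym)
        ultimately show ?thesis using vw(2) by meson
      next
        case False
        then have "a w0 = a y" using vw xy \<open>v0 \<noteq> w0\<close> by (intro const[of x v0 w0 y]) auto
        then have "a w0 = a x" using cx[OF xy(2)] by simp
        then have "a v = a x" if "v \<in> J - {v0}" for v
          using cx[of v] that by (cases "v = w0") simp_all
        moreover have "a v0 \<noteq> a x" using False by (rule not_sym)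
        ultimately show ?thesis using vw(1) by meson
      qed
      then obtain w where w: "w \<in> J" "\<And>v. v \<in> J - {w} \<Longrightarrow> a v = a x" "a w \<noteq> a x" by blast
      have x: "x \<in> J" "x \<noteq> w" using xy(1) w(3) by auto
      then have "card (J - {w, x}) \<noteq> 0" using w(1) n4 cJ fJ by (simp add: card_Diff_subset)
      then obtain v where v: "v \<in> J - {w, x}" by (metis card.empty ex_in_conv)
      have z: "a x \<noteq> 0" "a w \<noteq> 0" using nz x(1) w(1) by blast+
      have H: "(\<Sum>i\<in>I - {l}. card (X i)) + 1 \<le> card (perm_sums (I - {l}) (J - {x}) X a)" if l: "l \<in> I" for l
      proof -
        have "a v = a x" using v by (intro w(2)) simp
        then have "a v \<noteq> a w" using not_sym[OF w(3)] by simp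
        moreover have "v \<in> J - {x}" "w \<in> J - {x}" using v w(1) x by auto
        ultimately have "\<exists>v\<in>J - {x}. \<exists>w\<in>J - {x}. a v \<noteq> a w" by meson
        moreover have "card (I - {l}) = card I - 1" "card (J - {x}) = card I - 1"
          using l x(1) cJ fI fJ by simp_all
        ultimately have "(\<Sum>i\<in>I - {l}. card (X i)) < card (perm_sums (I - {l}) (J - {x}) X a)"
          using n4 by (intro IH Diff_subset) linarith+
        then show ?thesis by simp
      qed
      show ?thesis
        by (rule one_different_coefficient[where J = J and w = w and b = "a x" and u = x,
              OF ad less.prems(2) fJ cJ w z disjI2[OF n4] x H])
    qed
  qed
qed

lemma perm_sums_permutes:
  "perm_sums I I X a \<subseteq> (\<Union>\<sigma>\<in>{\<sigma>. \<sigma> permutes I}. \<Sum>i\<in>I. a (\<sigma> i) *o X i)"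
proof
  fix y assume "y \<in> perm_sums I I X a"
  then obtain \<sigma> where s: "bij_betw \<sigma> I I" "y \<in> (\<Sum>i\<in>I. a (\<sigma> i) *o X i)" by (auto simp: perm_sums_def)
  define \<tau> where "\<tau> = (\<lambda>i. if i \<in> I then \<sigma> i else i)"
  have "bij_betw \<tau> I I" using s(1) by (rule bij_betw_cong[THEN iffD1, rotated]) (simp add: \<tau>_def)
  then have "\<tau> permutes I" by (rule bij_imp_permutes) (simp add: \<tau>_def)
  moreover have "(\<Sum>i\<in>I. a (\<tau> i) *o X i) = (\<Sum>i\<in>I. a (\<sigma> i) *o X i)"
    by (rule sum.cong) (simp_all add: \<tau>_def)
  ultimately show "y \<in> (\<Union>\<sigma>\<in>{\<sigma>. \<sigma> permutes I}. \<Sum>i\<in>I. a (\<sigma> i) *o X i)" using s(2) by blast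
qed

theorem theorem1p1:
  fixes n :: nat
    and X :: "nat \<Rightarrow> 'p::prime_card mod_ring set"
    and a :: "nat \<Rightarrow> 'p mod_ring"
  assumes "n \<ge> 2"
    and "disjoint_family_on X {1..n}"
    and "(MIN i\<in>{1..n}. card (X i)) \<ge> 3"
    and "(\<Sum>i=1..n. int (card (X i))) \<le> int CARD('p) - 5"
    and "\<forall>i\<in>{1..n}. a i \<noteq> 0"
    and "\<not> (\<forall>i\<in>{1..n}. \<forall>j\<in>{1..n}. a i = a j)"
  shows "(n = 2 \<and> a 1 = - a 2 \<and>
            (\<exists>x y c r z. {X 1, X 2} =
               {r *o cyc_interval x y, r *o (cyc_interval (y + c) (x - c) - {z})}))
       \<or> card (\<Union>\<sigma>\<in>{\<sigma>. \<sigma> permutes {1..n}}. \<Sum>i=1..n. a (\<sigma> i) *o X i)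
           > (\<Sum>i=1..n. card (X i))"
proof -
  define S where "S = (\<Union>\<sigma>\<in>{\<sigma>. \<sigma> permutes {1..n}}. \<Sum>i=1..n. a (\<sigma> i) *o X i)"
  have "3 \<le> card (X i)" if "i \<in> {1..n}" for i
  proof -
    have "(MIN i\<in>{1..n}. card (X i)) \<le> card (X i)" using that by (intro Min_le) auto
    then show ?thesis using assms(3) by linarith
  qed
  moreover have "(\<Sum>i=1..n. card (X i)) + 5 \<le> CARD('p)"
    using assms(4) unfolding of_nat_sum[symmetric] by linarith
  ultimately have ad: "admissible X {1..n}" using assms(2) by (simp add: admissible_def)
  have "card (perm_sums {1..n} {1..n} X a) \<le> card S"
    unfolding S_def by (rule card_mono[rotated, OF perm_sums_permutes]) simp
  note le = this
  consider "n = 2" | "n \<ge> 3" using assms(1) by linarith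
  then show ?thesis
  proof cases
    case 1
    have I: "{1..n} = {1, 2}" using 1 by auto
    have p: "two_coeffs (a 1) (a 2) (X 1) (X 2) \<subseteq> perm_sums {1..n} {1..n} X a"
      unfolding I by (rule perm_sums_two) auto
    then have le2: "card (two_coeffs (a 1) (a 2) (X 1) (X 2)) \<le> card S"
      using le card_mono[OF _ p] by fastforce
    have a: "a 1 \<noteq> 0" "a 2 \<noteq> 0" "a 1 \<noteq> a 2" using assms(5,6) unfolding I by auto
    have m: "1 \<in> {1..n}" "2 \<in> {1..n}" "(1::nat) \<noteq> 2" using 1 by auto
    from two_coeffs_cases[OF admissible_pair[OF ad m] a] show ?thesis
    proof
      assume "card (X 1) + card (X 2) + 1 \<le> card (two_coeffs (a 1) (a 2) (X 1) (X 2))"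
      then have "(\<Sum>i=1..n. card (X i)) < card S" using le2 unfolding I by simp
      then show ?thesis unfolding S_def by (rule disjI2)
    next
      assume "a 2 = - a 1 \<and> (\<exists>r. exceptional r (X 1) (X 2) \<and> (\<exists>x y e z. {X 1, X 2} =
               {r *o cyc_interval x y, r *o (cyc_interval (y + e) (x - e) - {z})}))"
      then obtain r x y e z where h: "a 2 = - a 1"
        "{X 1, X 2} = {r *o cyc_interval x y, r *o (cyc_interval (y + e) (x - e) - {z})}"
        by (elim conjE exE) (rule that)
      have "a 1 = - a 2" using h(1) by simp
      then show ?thesis using 1 h(2) by meson
    qed
  next
    case 2
    have "\<exists>v\<in>{1..n}. \<exists>w\<in>{1..n}. a v \<noteq> a w" using assms(6) by blast
    then have "(\<Sum>i=1..n. card (X i)) < card (perm_sums {1..n} {1..n} X a)"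
      using 2 assms(5) by (intro many_sets[OF ad]) auto
    then have "(\<Sum>i=1..n. card (X i)) < card S" using le by linarith
    then show ?thesis unfolding S_def by (rule disjI2)
  qed
qed

end
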